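(* Let $M,m,A,A_1,B,B_1>0$ and $\mu:=\frac{2M+m}{m}$, and assume $\mu>1+\frac{A}{4A_1}$, $\mu>1+\frac{B}{16B_1}$ and $(\mu-1)^{4/15}\left(\frac{4A_1}{A}\right)^{2/3}\neq\left(\frac{16B_1}{B}\right)^{2/5}$. Consider the isosceles Schwarzschild problem with any angular momentum $C\in\mathbb R$. Then, on any energy level $\{H_{\mathrm{red}}=h\}$, $h\in\mathbb R$, the set of initial conditions leading to triple collision with a limiting geometric configuration which is the geometric configuration of a homographic solution has positive Lebesgue measure.
   Context: The isosceles Schwarzschild problem: two equal point masses $M$ move in a horizontal plane, symmetrically with respect to their midpoint $O$, and a third point mass $m$ moves on the vertical axis through $O$. Let $R>0$ be the distance between the equal masses and $z\in\mathbb R$ the signed height of $m$ above $O$. After reduction by rotations, with conserved angular momentum $C$, the motion is the Hamiltonian system on $\{(R,z,P_R,P_z):R>0\}$ with $$H_{\mathrm{red}}=\frac1M\left(P_R^2+\frac{C^2}{R^2}\right)+\frac{2M+m}{4Mm}P_z^2-\frac{A}{R}-\frac{B}{R^3}-\frac{4A_1}{(R^2+4z^2)^{1/2}}-\frac{16B_1}{(R^2+4z^2)^{3/2}}.$$ Lebesgue measure on the 3-dimensional energy level means the induced 3-dimensional measure. A solution leads to triple collision if $(R,z)\to(0,0)$ as $t$ tends to the forward end of its maximal interval of existence; its limiting geometric configuration is the limit $\ell=\lim z/R\in[-\infty,\infty]$ there. A solution is homographic if the geometric configuration of the masses remains similar to the initial one, i.e. in Jacobi coordinates (${\bf r}_1$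 from one mass $M$ to the other, ${\bf r}_2$ from their midpoint to $m$) ${\bf r}_1(t)=\varphi(t)\Omega(t){\bf a}_1$, ${\bf r}_2(t)=\varphi(t){\bf a}_2$ with $\varphi(t)\in\mathbb R\setminus\{0\}$ a scalar function, $\Omega(t)$ rotations about the vertical axis, ${\bf a}_1$ a fixed horizontal vector and ${\bf a}_2$ a fixed vertical vector, not both zero. The limiting configuration $\ell$ is the geometric configuration of a homographic solution if there is a homographic solution along which $z/R\equiv\ell$. *)

theory Defs
  imports "HOL-Analysis.Analysis"
begin

subsection \<open>Hausdorff measure\<close>

text \<open>
  The normalising factor makes the \<open>k\<close>-dimensional Hausdorff measure restricted to a
  \<open>k\<close>-dimensional \<open>C\<^sup>1\<close> submanifold of a Euclidean space the Riemannian volume of the induced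
  metric; on a \<open>k\<close>-dimensional Euclidean space it is Lebesgue measure.  Only \<open>k > 0\<close> is meant
  (for \<open>k = 0\<close> empty covering sets would count).  The \<open>\<sigma>\<close>-algebra consists of all
  Caratheodory measurable sets, so the measure is complete and non-measurable sets stay
  non-measurable.
\<close>

definition hausdorff_pre :: "nat \<Rightarrow> real \<Rightarrow> 'a::metric_space set \<Rightarrow> ennreal" where
  "hausdorff_pre k \<delta> S =
     (INF U \<in> {U :: nat \<Rightarrow> 'a set.
                 S \<subseteq> (\<Union>i. U i) \<and> (\<forall>i. bounded (U i) \<and> diameter (U i) \<le> \<delta>)}.
        (\<Sum>i. ennreal (unit_ball_vol (real k) * (diameter (U i) / 2) ^ k)))"

definition hausdorff_outer :: "nat \<Rightarrow> 'a::metric_space set \<Rightarrow> ennreal" where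
  "hausdorff_outer k S = (SUP \<delta> \<in> {0<..}. hausdorff_pre k \<delta> S)"

definition hausdorff_measure :: "nat \<Rightarrow> 'a::metric_space measure" where
  "hausdorff_measure k =
     measure_of UNIV (lambda_system UNIV (Pow UNIV) (hausdorff_outer k)) (hausdorff_outer k)"

lemma hausdorff_pre_empty:
  assumes "k > 0" "\<delta> > 0"
  shows "hausdorff_pre k \<delta> ({} :: 'a::metric_space set) = 0"
proof -
  have "hausdorff_pre k \<delta> ({} :: 'a set) \<le>
      (\<Sum>i::nat. ennreal (unit_ball_vol (real k) * (diameter ({} :: 'a set) / 2) ^ k))"
    unfolding hausdorff_pre_def
    by (rule INF_lower2[where i = "\<lambda>_. {}"]) (use assms in auto)
  also have "\<dots> = 0"
    using assms by (simp add: power_0_left)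
  finally show ?thesis by simp
qed

lemma hausdorff_pre_mono: "S \<subseteq> T \<Longrightarrow> hausdorff_pre k \<delta> S \<le> hausdorff_pre k \<delta> T"
  unfolding hausdorff_pre_def by (rule INF_superset_mono) auto

lemma hausdorff_pre_subadditive:
  fixes A :: "nat \<Rightarrow> 'a::metric_space set"
  shows "hausdorff_pre k \<delta> (\<Union>i. A i) \<le> (\<Sum>i. hausdorff_pre k \<delta> (A i))"
proof (rule ennreal_le_epsilon)
  fix e :: real
  assume fin: "(\<Sum>i. hausdorff_pre k \<delta> (A i)) < top" and e: "0 < e"
  define w where "w = (\<lambda>V :: 'a set. ennreal (unit_ball_vol (real k) * (diameter V / 2) ^ k))"
  have "\<exists>U :: nat \<Rightarrow> 'a set. (A n \<subseteq> (\<Union>i. U i) \<and> (\<forall>i. bounded (U i) \<and> diameter (U i) \<le> \<delta>)) \<and>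
      (\<Sum>i. w (U i)) \<le> hausdorff_pre k \<delta> (A n) + ennreal (e * (1/2) ^ Suc n)" for n
  proof -
    have "hausdorff_pre k \<delta> (A n) \<noteq> top"
      using ennreal_suminf_lessD[OF fin, of n] by simp
    then have "hausdorff_pre k \<delta> (A n) < hausdorff_pre k \<delta> (A n) + ennreal (e * (1/2) ^ Suc n)"
      using e by (simp add: less_top ennreal_add_left_cancel_less[of _ 0, simplified])
    then show ?thesis
      unfolding hausdorff_pre_def INF_less_iff w_def by (auto intro: less_imp_le)
  qed
  then obtain U :: "nat \<Rightarrow> nat \<Rightarrow> 'a set" where
    U: "\<And>n. A n \<subseteq> (\<Union>i. U n i)" "\<And>n i. bounded (U n i)" "\<And>n i. diameter (U n i) \<le> \<delta>"
    and w: "\<And>n. (\<Sum>i. w (U n i)) \<le> hausdorff_pre k \<delta> (A n) + ennreal (e * (1/2) ^ Suc n)"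
    by metis
  define V where "V = (\<lambda>j. case prod_decode j of (n, i) \<Rightarrow> U n i)"
  have cover: "(\<Union>i. A i) \<subseteq> (\<Union>j. V j)"
  proof
    fix x assume "x \<in> (\<Union>i. A i)"
    then obtain n i where "x \<in> U n i" using U(1) by blast
    then have "x \<in> V (prod_encode (n, i))" by (simp add: V_def)
    then show "x \<in> (\<Union>j. V j)" by blast
  qed
  have "hausdorff_pre k \<delta> (\<Union>i. A i) \<le> (\<Sum>j. w (V j))"
    unfolding hausdorff_pre_def w_def
    by (rule INF_lower) (use cover U in \<open>auto simp: V_def split: prod.split\<close>)
  also have "\<dots> = (\<Sum>n. \<Sum>i. w (U n i))"
    using suminf_ennreal_2dimen[where f = "\<lambda>(n, i). w (U n i)", OF refl]
    by (simp add: V_def comp_def prod.case_distrib[of w])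
  also have "\<dots> \<le> (\<Sum>n. hausdorff_pre k \<delta> (A n) + ennreal (e * (1/2) ^ Suc n))"
    by (intro suminf_le w) auto
  also have "\<dots> = (\<Sum>n. hausdorff_pre k \<delta> (A n)) + (\<Sum>n. ennreal (e * (1/2) ^ Suc n))"
    by (intro suminf_add[symmetric]) auto
  also have "(\<Sum>n. ennreal (e * (1/2) ^ Suc n)) = ennreal e"
    using sums_mult[OF power_half_series, of e] e
    by (intro suminf_ennreal_eq) auto
  finally show "hausdorff_pre k \<delta> (\<Union>i. A i) \<le> (\<Sum>i. hausdorff_pre k \<delta> (A i)) + ennreal e" .
qed

lemma outer_measure_space_hausdorff_outer:
  assumes "k > 0"
  shows "outer_measure_space UNIV (hausdorff_outer k :: 'a::metric_space set \<Rightarrow> ennreal)"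
  unfolding outer_measure_space_def positive_def increasing_def countably_subadditive_def
proof (intro conjI ballI allI impI)
  show "hausdorff_outer k ({} :: 'a set) = 0"
  proof -
    have "hausdorff_outer k ({} :: 'a set) \<le> 0"
      unfolding hausdorff_outer_def
      by (rule SUP_least) (use assms in \<open>simp add: hausdorff_pre_empty\<close>)
    then show ?thesis by simp
  qed
next
  fix S T :: "'a set" assume "S \<subseteq> T"
  then show "hausdorff_outer k S \<le> hausdorff_outer k T"
    unfolding hausdorff_outer_def by (intro SUP_mono') (simp add: hausdorff_pre_mono)
next
  fix A :: "nat \<Rightarrow> 'a set"
  show "hausdorff_outer k (\<Union>i. A i) \<le> (\<Sum>i. hausdorff_outer k (A i))"
    unfolding hausdorff_outer_def[of k "\<Union>i. A i"]
  proof (rule SUP_least)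
    fix \<delta> :: real assume "\<delta> \<in> {0<..}"
    then have "(\<Sum>i. hausdorff_pre k \<delta> (A i)) \<le> (\<Sum>i. hausdorff_outer k (A i))"
      unfolding hausdorff_outer_def by (intro suminf_le SUP_upper) auto
    with hausdorff_pre_subadditive show "hausdorff_pre k \<delta> (\<Union>i. A i) \<le> (\<Sum>i. hausdorff_outer k (A i))"
      by (rule order_trans)
  qed
qed

lemma
  assumes "k > 0"
  shows space_hausdorff_measure: "space (hausdorff_measure k :: 'a::metric_space measure) = UNIV"
    and sets_hausdorff_measure: "sets (hausdorff_measure k :: 'a measure) =
      lambda_system UNIV UNIV (hausdorff_outer k)"
    and emeasure_hausdorff_measure: "S \<in> sets (hausdorff_measure k :: 'a measure) \<Longrightarrow>
      emeasure (hausdorff_measure k) S = hausdorff_outer k S"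
proof -
  interpret sigma_algebra "UNIV :: 'a set" "Pow UNIV" by (rule sigma_algebra_Pow)
  have ms: "measure_space (UNIV :: 'a set) (lambda_system UNIV UNIV (hausdorff_outer k)) (hausdorff_outer k)"
    using caratheodory_lemma[of "hausdorff_outer k"] outer_measure_space_hausdorff_outer[OF assms] by simp
  interpret L: sigma_algebra "UNIV :: 'a set" "lambda_system UNIV UNIV (hausdorff_outer k)"
    using ms by (simp add: measure_space_def)
  show "space (hausdorff_measure k :: 'a measure) = UNIV"
    by (simp add: hausdorff_measure_def)
  show s: "sets (hausdorff_measure k :: 'a measure) = lambda_system UNIV UNIV (hausdorff_outer k)"
    by (simp add: hausdorff_measure_def)
  show "S \<in> sets (hausdorff_measure k :: 'a measure) \<Longrightarrow>
      emeasure (hausdorff_measure k) S = hausdorff_outer k S"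
    using ms unfolding s unfolding hausdorff_measure_def
    by (simp add: emeasure_measure_of_sigma measure_space_def)
qed


subsection \<open>Hamiltonian systems on \<open>{(R, z, P\<^sub>R, P\<^sub>z). R > 0}\<close>\<close>

type_synonym state = "real \<times> real \<times> real \<times> real"

fun pos_R :: "state \<Rightarrow> real" where "pos_R (R, z, PR, Pz) = R"
fun pos_z :: "state \<Rightarrow> real" where "pos_z (R, z, PR, Pz) = z"

definition phase_space :: "state set" where
  "phase_space = {x. pos_R x > 0}"

fun hamiltonian_vf :: "(state \<Rightarrow> real) \<Rightarrow> state \<Rightarrow> state" where
  "hamiltonian_vf H (R, z, PR, Pz) =
     (deriv (\<lambda>p. H (R, z, p, Pz)) PR,
      deriv (\<lambda>p. H (R, z, PR, p)) Pz,
      - deriv (\<lambda>q. H (q, z, PR, Pz)) R,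
      - deriv (\<lambda>q. H (R, q, PR, Pz)) z)"

definition solution :: "(state \<Rightarrow> real) \<Rightarrow> ereal \<Rightarrow> ereal \<Rightarrow> (real \<Rightarrow> state) \<Rightarrow> bool" where
  "solution H a b x \<longleftrightarrow> a < b \<and>
     (\<forall>t \<in> einterval a b. x t \<in> phase_space \<and>
        (x has_vector_derivative hamiltonian_vf H (x t)) (at t))"

definition maximal_solution :: "(state \<Rightarrow> real) \<Rightarrow> ereal \<Rightarrow> ereal \<Rightarrow> (real \<Rightarrow> state) \<Rightarrow> bool" where
  "maximal_solution H a b x \<longleftrightarrow> solution H a b x \<and>
     (\<forall>a' b' y. a' \<le> a \<and> b \<le> b' \<and> solution H a' b' y \<and> (\<forall>t \<in> einterval a b. y t = x t)
        \<longrightarrow> a' = a \<and> b' = b)"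


subsection \<open>The isosceles Schwarzschild problem\<close>

fun H_red :: "real \<Rightarrow> real \<Rightarrow> real \<Rightarrow> real \<Rightarrow> real \<Rightarrow> real \<Rightarrow> real \<Rightarrow> state \<Rightarrow> real" where
  "H_red M m A A1 B B1 C (R, z, PR, Pz) =
     1 / M * (PR\<^sup>2 + C\<^sup>2 / R\<^sup>2) + (2 * M + m) / (4 * M * m) * Pz\<^sup>2
       - A / R - B / R ^ 3
       - 4 * A1 / (R\<^sup>2 + 4 * z\<^sup>2) powr (1 / 2)
       - 16 * B1 / (R\<^sup>2 + 4 * z\<^sup>2) powr (3 / 2)"

definition energy_level :: "(state \<Rightarrow> real) \<Rightarrow> real \<Rightarrow> state set" where
  "energy_level H h = {x \<in> phase_space. H x = h}"

text \<open>For smooth \<open>H\<close> the level is, away from critical points of \<open>H\<close>, a smooth hypersurface of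
  \<open>\<real>\<^sup>4\<close> (the norm on \<open>state\<close> is Euclidean), so the restricted Hausdorff measure is its induced
  3-dimensional measure.\<close>

definition level_measure :: "(state \<Rightarrow> real) \<Rightarrow> real \<Rightarrow> state measure" where
  "level_measure H h = restrict_space (hausdorff_measure 3) (energy_level H h)"

text \<open>Limits at a possibly infinite endpoint \<open>b\<close> are taken along \<open>at_left b\<close> in \<open>ereal\<close>, after
  composition with \<open>real_of_ereal\<close>, as in the library's interval integrals.\<close>

definition triple_collision :: "ereal \<Rightarrow> (real \<Rightarrow> state) \<Rightarrow> bool" where
  "triple_collision b x \<longleftrightarrow>
     (((\<lambda>t. (pos_R (x t), pos_z (x t))) \<circ> real_of_ereal) \<longlongrightarrow> (0, 0)) (at_left b)"

definition limiting_configuration :: "ereal \<Rightarrow> (real \<Rightarrow> state) \<Rightarrow> ereal \<Rightarrow> bool" where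
  "limiting_configuration b x \<l> \<longleftrightarrow>
     (((\<lambda>t. ereal (pos_z (x t) / pos_R (x t))) \<circ> real_of_ereal) \<longlongrightarrow> \<l>) (at_left b)"

definition rot_vertical :: "real \<Rightarrow> real ^ 3 \<Rightarrow> real ^ 3" where
  "rot_vertical \<omega> v = vector [cos \<omega> * v $ 1 - sin \<omega> * v $ 2, sin \<omega> * v $ 1 + cos \<omega> * v $ 2, v $ 3]"

text \<open>A reduced solution \<open>x\<close> is lifted to Jacobi vectors \<open>r1\<close>, \<open>r2\<close> by reconstructing the polar
  angle \<open>\<theta>\<close> of \<open>r1\<close> from \<open>\<theta>' = \<partial>H/\<partial>C = 2 C / (M R\<^sup>2)\<close>; the lift is unique up to the initial angle.\<close>

definition jacobi_lift ::
  "real \<Rightarrow> real \<Rightarrow> ereal \<Rightarrow> ereal \<Rightarrow> (real \<Rightarrow> state) \<Rightarrow> (real \<Rightarrow> real ^ 3) \<Rightarrow> (real \<Rightarrow> real ^ 3) \<Rightarrow> bool" where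
  "jacobi_lift M C a b x r1 r2 \<longleftrightarrow>
     (\<exists>\<theta> :: real \<Rightarrow> real. \<forall>t \<in> einterval a b.
        (\<theta> has_real_derivative 2 * C / (M * (pos_R (x t))\<^sup>2)) (at t) \<and>
        r1 t = pos_R (x t) *\<^sub>R vector [cos (\<theta> t), sin (\<theta> t), 0] \<and>
        r2 t = vector [0, 0, pos_z (x t)])"

definition homographic ::
  "ereal \<Rightarrow> ereal \<Rightarrow> (real \<Rightarrow> real ^ 3) \<Rightarrow> (real \<Rightarrow> real ^ 3) \<Rightarrow> bool" where
  "homographic a b r1 r2 \<longleftrightarrow>
     (\<exists>(\<phi> :: real \<Rightarrow> real) (\<omega> :: real \<Rightarrow> real) a1 a2.
        a1 $ 3 = 0 \<and> a2 $ 1 = 0 \<and> a2 $ 2 = 0 \<and> \<not> (a1 = 0 \<and> a2 = 0) \<and>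
        (\<forall>t \<in> einterval a b. \<phi> t \<noteq> 0 \<and>
           r1 t = \<phi> t *\<^sub>R rot_vertical (\<omega> t) a1 \<and> r2 t = \<phi> t *\<^sub>R a2))"

definition homographic_configuration ::
  "real \<Rightarrow> real \<Rightarrow> real \<Rightarrow> real \<Rightarrow> real \<Rightarrow> real \<Rightarrow> real \<Rightarrow> ereal \<Rightarrow> bool" where
  "homographic_configuration M m A A1 B B1 C \<l> \<longleftrightarrow>
     (\<exists>a b x r1 r2. maximal_solution (H_red M m A A1 B B1 C) a b x \<and>
        jacobi_lift M C a b x r1 r2 \<and> homographic a b r1 r2 \<and>
        (\<forall>t \<in> einterval a b. ereal (pos_z (x t) / pos_R (x t)) = \<l>))"

definition homographic_triple_collisions ::
  "real \<Rightarrow> real \<Rightarrow> real \<Rightarrow> real \<Rightarrow> real \<Rightarrow> real \<Rightarrow> real \<Rightarrow> real \<Rightarrow> state set" where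
  "homographic_triple_collisions M m A A1 B B1 C h =
     {x0 \<in> energy_level (H_red M m A A1 B B1 C) h.
        \<exists>a b x \<l>. maximal_solution (H_red M m A A1 B B1 C) a b x \<and>
          0 \<in> einterval a b \<and> x 0 = x0 \<and>
          triple_collision b x \<and> limiting_configuration b x \<l> \<and>
          homographic_configuration M m A A1 B B1 C \<l>}"

end

theory Submission
  imports Defs
begin

text \<open>
  Let \<open>V = R'\<close>, let \<open>u = z / R\<close> be the shape and \<open>L = R\<^sup>2 u'\<close>.  Near a triple collision the
  terms with \<open>B\<close> and \<open>B1\<close> dominate, and the radial equation says that \<open>R\<^sup>4 R''\<close> stays between two
  negative constants.  Hence an infalling motion keeps falling, reaches \<open>R = 0\<close> in finite time,
  and \<open>V\<^sup>2 R\<^sup>3\<close> settles between two positive constants.  In the time \<open>s\<close> with \<open>ds = R\<^bsup>-5/2\<^esup> dt\<close> and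
  with \<open>w = R\<^bsup>1/2\<^esup> L\<close>, \<open>v = R\<^bsup>3/2\<^esup> V\<close> the shape obeys
  \[ du/ds = w, \qquad dw/ds = - G(R, u) u + v w / 2 . \]
  The assumption \<open>\<mu> > 1 + B / (16 B1)\<close> makes \<open>G(0, 0) > 0\<close>: the planar configuration \<open>u = 0\<close> is a
  local maximum of the dominant force function on shapes.  Since \<open>v < 0\<close> during the fall, the shape is an oscillator
  with a restoring force and genuine damping (for the Newtonian potential the sign of the damping is
  the opposite one).  A strict Lyapunov function, quadratic in \<open>(u, w)\<close>, therefore decays
  like a power of \<open>R\<close> (\<open>damped_oscillator_lyapunov\<close>, \<open>lyap_decay_along\<close>).

  This produces an open set of states, the trap, which is forward invariant
  (\<open>trapped_forward_invariant\<close>) and from which every motion ends in a triple collision with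
  \<open>z / R \<rightarrow> 0\<close> (\<open>trap_imp_planar_triple_collision\<close>).  Conversely a motion that ends in a triple
  collision with \<open>z / R \<rightarrow> 0\<close> enters the trap (\<open>planar_collision_enters_trap\<close>).  The configuration
  \<open>0\<close> is homographic because the plane \<open>z = 0\<close> is invariant, and it is the only one: along a nonplanar
  homographic motion the size varies, so the terms in \<open>A, A1\<close> and those in \<open>B, B1\<close> must balance for
  the same shape, which the condition with the exponents \<open>4/15\<close>, \<open>2/3\<close> and \<open>2/5\<close> excludes.  So the set
  in question is the energy level intersected with the set of initial conditions whose orbits
  enter the trap.

  That basin is open by continuous dependence on initial conditions.  Open sets are measurable
  because Hausdorff outer measure is additive on separated sets.  Finally every energy level meets
  the trap: for small \<open>R\<close> there is so much potential energy that the planar state with any prescribed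
  energy \<open>h\<close> falls in with nearly the limiting value of \<open>V\<^sup>2 R\<^sup>3\<close>.  Near such a state the level is
  a graph over \<open>(R, z, P\<^sub>z)\<close>, so the set projects onto a set containing a box, and a projection does
  not increase Hausdorff measure.
\<close>


section \<open>Hausdorff measure: Borel sets and Lipschitz projections\<close>

lemma hausdorff_pre_antimono_scale:
  "\<delta> \<le> \<delta>' \<Longrightarrow> hausdorff_pre k \<delta>' S \<le> hausdorff_pre k \<delta> S"
  unfolding hausdorff_pre_def by (rule INF_superset_mono) (auto intro: order_trans)

text \<open>
  A covering set of diameter below \<open>d\<close> cannot meet two sets at distance \<open>d\<close>.  A cover of the union
  therefore splits into a cover of each part without using any set twice.
\<close>

lemma hausdorff_pre_separated:
  fixes S T :: "'a::metric_space set"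
  assumes k: "k > 0" and "\<delta> < d" and sep: "\<And>x y. x \<in> S \<Longrightarrow> y \<in> T \<Longrightarrow> d \<le> dist x y"
  shows "hausdorff_pre k \<delta> S + hausdorff_pre k \<delta> T \<le> hausdorff_pre k \<delta> (S \<union> T)"
  unfolding hausdorff_pre_def[of k \<delta> "S \<union> T"]
proof (rule INF_greatest, safe)
  fix U :: "nat \<Rightarrow> 'a set"
  assume cov: "S \<union> T \<subseteq> (\<Union>i. U i)" and U: "\<forall>i. bounded (U i) \<and> diameter (U i) \<le> \<delta>"
  define w where "w = (\<lambda>V :: 'a set. ennreal (unit_ball_vol (real k) * (diameter V / 2) ^ k))"
  define pick where "pick = (\<lambda>Z i. if U i \<inter> Z \<noteq> {} then U i else {})"
  have w0: "w {} = 0" using k by (simp add: w_def power_0_left)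
  have d0: "0 \<le> \<delta>" using U diameter_ge_0 order_trans by blast
  have le: "hausdorff_pre k \<delta> Z \<le> (\<Sum>i. w (pick Z i))" if Z: "Z \<subseteq> S \<union> T" for Z
    unfolding hausdorff_pre_def w_def
  proof (rule INF_lower, safe)
    fix x assume "x \<in> Z"
    then obtain i where "x \<in> U i" using cov Z by blast
    then have "x \<in> pick Z i" using \<open>x \<in> Z\<close> by (auto simp: pick_def)
    then show "x \<in> (\<Union>i. pick Z i)" by blast
  qed (use U d0 in \<open>auto simp: pick_def\<close>)
  have "w (pick S i) + w (pick T i) \<le> w (U i)" for i
  proof -
    have "\<not> (U i \<inter> S \<noteq> {} \<and> U i \<inter> T \<noteq> {})"
    proof
      assume "U i \<inter> S \<noteq> {} \<and> U i \<inter> T \<noteq> {}"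
      then obtain x y where xy: "x \<in> U i" "x \<in> S" "y \<in> U i" "y \<in> T" by blast
      have "dist x y \<le> diameter (U i)" using U xy by (intro diameter_bounded_bound) auto
      also have "\<dots> < d" using U \<open>\<delta> < d\<close> by (meson le_less_trans)
      finally show False using sep xy by force
    qed
    then show ?thesis by (auto simp: pick_def w0)
  qed
  then have "(\<Sum>i. w (pick S i) + w (pick T i)) \<le> (\<Sum>i. w (U i))"
    by (intro suminf_le) auto
  moreover have "(\<Sum>i. w (pick S i) + w (pick T i)) = (\<Sum>i. w (pick S i)) + (\<Sum>i. w (pick T i))"
    by (intro suminf_add[symmetric]) auto
  ultimately have "hausdorff_pre k \<delta> S + hausdorff_pre k \<delta> T \<le> (\<Sum>i. w (U i))"
    using add_mono[OF le[of S] le[of T]] by auto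
  then show "hausdorff_pre k \<delta> S + hausdorff_pre k \<delta> T
      \<le> (\<Sum>i. ennreal (unit_ball_vol (real k) * (diameter (U i) / 2) ^ k))"
    by (simp add: w_def)
qed

lemma hausdorff_outer_separated:
  fixes S T :: "'a::metric_space set"
  assumes k: "k > 0" and "0 < d" and sep: "\<And>x y. x \<in> S \<Longrightarrow> y \<in> T \<Longrightarrow> d \<le> dist x y"
  shows "hausdorff_outer k S + hausdorff_outer k T \<le> hausdorff_outer k (S \<union> T)"
proof -
  have "hausdorff_outer k S + hausdorff_outer k T
      = (SUP \<delta>\<in>{0<..}. hausdorff_pre k \<delta> S + hausdorff_pre k \<delta> T)"
    unfolding hausdorff_outer_def
  proof (rule SUP_add_directed_ennreal[symmetric])
    fix i j :: real assume "i \<in> {0<..}" "j \<in> {0<..}"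
    then show "\<exists>l\<in>{0<..}. hausdorff_pre k i S + hausdorff_pre k j T
        \<le> hausdorff_pre k l S + hausdorff_pre k l T"
      by (intro bexI[of _ "min i j"] add_mono hausdorff_pre_antimono_scale) auto
  qed
  also have "\<dots> \<le> hausdorff_outer k (S \<union> T)"
  proof (rule SUP_least)
    fix \<delta> :: real assume "\<delta> \<in> {0<..}"
    define \<epsilon> where "\<epsilon> = min \<delta> (d / 2)"
    have "hausdorff_pre k \<delta> S + hausdorff_pre k \<delta> T \<le> hausdorff_pre k \<epsilon> S + hausdorff_pre k \<epsilon> T"
      by (intro add_mono hausdorff_pre_antimono_scale) (auto simp: \<epsilon>_def)
    also have "\<dots> \<le> hausdorff_pre k \<epsilon> (S \<union> T)"
      by (rule hausdorff_pre_separated[OF k _ sep]) (use \<open>0 < d\<close> in \<open>auto simp: \<epsilon>_def\<close>)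
    also have "\<dots> \<le> hausdorff_outer k (S \<union> T)"
      unfolding hausdorff_outer_def
      by (rule SUP_upper) (use \<open>0 < d\<close> \<open>\<delta> \<in> {0<..}\<close> in \<open>auto simp: \<epsilon>_def\<close>)
    finally show "hausdorff_pre k \<delta> S + hausdorff_pre k \<delta> T \<le> hausdorff_outer k (S \<union> T)" .
  qed
  finally show ?thesis .
qed

text \<open>
  Countable subadditivity holds for arbitrary sequences; \<open>countably_subadditive\<close> speaks of disjoint
  ones only.
\<close>

lemma
  assumes "k > 0"
  shows hausdorff_outer_empty: "hausdorff_outer k ({} :: 'a::metric_space set) = 0"
    and hausdorff_outer_mono: "S \<subseteq> T \<Longrightarrow> hausdorff_outer k S \<le> hausdorff_outer k (T :: 'a set)"
    and hausdorff_outer_UN: "hausdorff_outer k (\<Union>i. A i :: 'a set) \<le> (\<Sum>i::nat. hausdorff_outer k (A i))"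
proof -
  note * = outer_measure_space_hausdorff_outer[OF assms, where 'a = 'a,
      unfolded outer_measure_space_def positive_def increasing_def]
  then show "hausdorff_outer k ({} :: 'a set) = 0" by blast
  show "S \<subseteq> T \<Longrightarrow> hausdorff_outer k S \<le> hausdorff_outer k (T :: 'a set)" using * by blast
  show "hausdorff_outer k (\<Union>i. A i :: 'a set) \<le> (\<Sum>i::nat. hausdorff_outer k (A i))"
    unfolding hausdorff_outer_def[of k "\<Union>i. A i"]
  proof (rule SUP_least)
    fix \<delta> :: real assume "\<delta> \<in> {0<..}"
    then have "(\<Sum>i. hausdorff_pre k \<delta> (A i)) \<le> (\<Sum>i. hausdorff_outer k (A i))"
      unfolding hausdorff_outer_def by (intro suminf_le SUP_upper) auto
    with hausdorff_pre_subadditive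
    show "hausdorff_pre k \<delta> (\<Union>i. A i) \<le> (\<Sum>i. hausdorff_outer k (A i))"
      by (rule order_trans)
  qed
qed

lemma hausdorff_outer_Un:
  assumes k: "k > 0"
  shows "hausdorff_outer k (S \<union> T :: 'a::metric_space set) \<le> hausdorff_outer k S + hausdorff_outer k T"
proof -
  define A where "A = (\<lambda>n::nat. if n = 0 then S else if n = 1 then T else {})"
  have "(\<Union>i. A i) = S \<union> T"
    by (auto simp: A_def split: if_splits)
  moreover have "(\<Sum>i. hausdorff_outer k (A i)) = (\<Sum>i<2. hausdorff_outer k (A i))"
    by (rule suminf_finite) (auto simp: A_def hausdorff_outer_empty[OF k])
  moreover have "\<dots> = hausdorff_outer k S + hausdorff_outer k T"
    by (simp add: A_def numeral_2_eq_2)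
  ultimately show ?thesis using hausdorff_outer_UN[OF k, of A] by simp
qed

text \<open>
  Shells that are not neighbours are separated, so the measures of those with even index add up to at
  most the measure of \<open>S\<close>, and likewise for odd index.
\<close>

lemma hausdorff_outer_shells:
  fixes D :: "nat \<Rightarrow> 'a::metric_space set"
  assumes k: "k > 0" and sub: "\<And>i. D i \<subseteq> S"
    and sep: "\<And>i j. i + 2 \<le> j \<Longrightarrow> \<exists>d>0. \<forall>j'\<ge>j. \<forall>x\<in>D i. \<forall>y\<in>D j'. d \<le> dist x y"
  shows "(\<Sum>i. hausdorff_outer k (D i)) \<le> 2 * hausdorff_outer k S"
proof -
  let ?\<mu> = "hausdorff_outer k"
  have half: "(\<Sum>i<n. ?\<mu> (D (2 * i + p))) \<le> ?\<mu> S" for n p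
  proof -
    have "(\<Sum>i\<in>{m..<m+n}. ?\<mu> (D (2 * i + p))) \<le> ?\<mu> (\<Union>i\<in>{m..<m+n}. D (2 * i + p))" for m
    proof (induction n arbitrary: m)
      case 0 then show ?case by simp
    next
      case (Suc n)
      let ?T = "\<Union>i\<in>{Suc m..<Suc m+n}. D (2 * i + p)"
      obtain d where d: "d > 0" "\<And>j' x y. j' \<ge> 2 * m + p + 2 \<Longrightarrow> x \<in> D (2 * m + p) \<Longrightarrow> y \<in> D j' \<Longrightarrow> d \<le> dist x y"
        using sep[of "2 * m + p" "2 * m + p + 2"] by blast
      have "{m..<m + Suc n} = insert m {Suc m..<Suc m+n}" by auto
      then have "(\<Sum>i\<in>{m..<m + Suc n}. ?\<mu> (D (2 * i + p)))
          = ?\<mu> (D (2 * m + p)) + (\<Sum>i\<in>{Suc m..<Suc m+n}. ?\<mu> (D (2 * i + p)))" by simp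
      also have "\<dots> \<le> ?\<mu> (D (2 * m + p)) + ?\<mu> ?T"
        by (intro add_mono order_refl Suc.IH)
      also have "\<dots> \<le> ?\<mu> (D (2 * m + p) \<union> ?T)"
        proof (rule hausdorff_outer_separated[OF k d(1)])
        fix x y assume "x \<in> D (2 * m + p)" "y \<in> ?T"
        then obtain i where "Suc m \<le> i" "y \<in> D (2 * i + p)" by auto
        then show "d \<le> dist x y" using \<open>x \<in> _\<close> by (intro d(2)[of "2 * i + p"]) auto
      qed
      also have "D (2 * m + p) \<union> ?T = (\<Union>i\<in>{m..<m + Suc n}. D (2 * i + p))"
        using \<open>{m..<m + Suc n} = _\<close> by simp
      finally show ?case .
    qed
    from this[of 0] have "(\<Sum>i<n. ?\<mu> (D (2 * i + p))) \<le> ?\<mu> (\<Union>i\<in>{0..<n}. D (2 * i + p))"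
      by (simp add: lessThan_atLeast0)
    also have "\<dots> \<le> ?\<mu> S" by (rule hausdorff_outer_mono[OF k]) (use sub in blast)
    finally show ?thesis .
  qed
  have "(\<Sum>i. ?\<mu> (D i)) = (SUP n. \<Sum>i<n. ?\<mu> (D i))" by (rule suminf_eq_SUP)
  also have "\<dots> \<le> 2 * ?\<mu> S"
  proof (rule SUP_least)
    fix n
    have "(\<Sum>i<n. ?\<mu> (D i)) \<le> (\<Sum>i<2*n. ?\<mu> (D i))"
      by (rule sum_mono2) auto
    also have "\<dots> = (\<Sum>i<n. ?\<mu> (D (2 * i)) + ?\<mu> (D (2 * i + 1)))"
      by (induction n) (simp_all add: add.assoc)
    also have "\<dots> \<le> ?\<mu> S + ?\<mu> S"
      unfolding sum.distrib using half[of 0 n] half[of 1 n] by (intro add_mono) simp_all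
    finally show "(\<Sum>i<n. ?\<mu> (D i)) \<le> 2 * ?\<mu> S" by (simp add: mult_2)
  qed
  finally show ?thesis .
qed

text \<open>
  Continuity from below along the sets of points at distance at least \<open>1 / (n + 1)\<close> from \<open>F\<close>, although
  none of these sets is known to be measurable: what is missing from the \<open>n\<close>-th one is the union of
  the later shells, and their measures are the tail of a convergent series.
\<close>

lemma hausdorff_outer_exhaust_complement:
  fixes F :: "'a::metric_space set"
  assumes k: "k > 0" and F: "closed F" "F \<noteq> {}" and fin: "hausdorff_outer k S < top"
  shows "hausdorff_outer k (S - F) \<le> (SUP n. hausdorff_outer k {x \<in> S. 1 / real (Suc n) \<le> infdist x F})"
proof -
  let ?\<mu> = "hausdorff_outer k"
  define A where "A = (\<lambda>n. {x \<in> S. 1 / real (Suc n) \<le> infdist x F})"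
  define D where "D = (\<lambda>n. A (Suc n) - A n)"
  have A_mono: "A n \<subseteq> A m" if "n \<le> m" for n m
    proof -
    have "1 / real (Suc m) \<le> 1 / real (Suc n)" using that by (intro frac_le) auto
    then show ?thesis by (auto simp: A_def)
  qed
  have "\<exists>d>0. \<forall>j'\<ge>j. \<forall>x\<in>D i. \<forall>y\<in>D j'. d \<le> dist x y" if "i + 2 \<le> j" for i j
  proof (intro exI conjI allI impI ballI)
    have "1 / real (i + 3) < 1 / real (i + 2)" by (intro divide_strict_left_mono) auto
    then show "1 / real (i + 2) - 1 / real (i + 3) > 0" by simp
    fix j' x y assume "j \<le> j'" "x \<in> D i" "y \<in> D j'"
    then have x: "1 / real (i + 2) \<le> infdist x F" by (auto simp: D_def A_def)
    have "y \<in> S" "y \<notin> A j'" using \<open>y \<in> D j'\<close> by (auto simp: D_def A_def)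
    then have "infdist y F < 1 / real (Suc j')" by (auto simp: A_def)
    also have "\<dots> \<le> 1 / real (i + 3)" using that \<open>j \<le> j'\<close> by (intro frac_le) auto
    finally have "infdist y F < 1 / real (i + 3)" .
    moreover have "infdist x F \<le> infdist y F + dist x y" by (rule infdist_triangle)
    ultimately show "1 / real (i + 2) - 1 / real (i + 3) \<le> dist x y" using x by linarith
  qed
  then have "(\<Sum>i. ?\<mu> (D i)) \<le> 2 * ?\<mu> S"
    by (intro hausdorff_outer_shells[OF k]) (auto simp: D_def A_def)
  also have "\<dots> < top" using fin by (simp add: ennreal_mult_less_top)
  finally have sumfin: "(\<Sum>i. ?\<mu> (D i)) < top" .
  have tail: "?\<mu> (S - F) \<le> ?\<mu> (A n) + (\<Sum>i. ?\<mu> (D (i + n)))" for n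
  proof -
    have "S - F \<subseteq> A n \<union> (\<Union>i. D (i + n))"
    proof
      fix x assume x: "x \<in> S - F"
      then have "infdist x F > 0"
        using F by (metis DiffD2 in_closed_iff_infdist_zero infdist_nonneg less_eq_real_def)
      then obtain m where "1 / real (Suc m) < infdist x F"
        using nat_approx_posE by blast
      then have ex: "\<exists>m. x \<in> A m" using x by (auto simp: A_def intro!: exI[of _ m])
      show "x \<in> A n \<union> (\<Union>i. D (i + n))"
      proof (cases "x \<in> A n")
        case False
        define l where "l = (LEAST m. x \<in> A m)"
        have l: "x \<in> A l" unfolding l_def using ex by (metis LeastI_ex)
        have "n < l" using False l A_mono by (meson not_le_imp_less subsetD)
        then have "x \<notin> A (l - 1)" unfolding l_def
          by (metis diff_less gr0I less_numeral_extra(1) not_less_Least not_less_zero)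
        then have "x \<in> D ((l - 1 - n) + n)" using l \<open>n < l\<close> by (simp add: D_def)
        then show ?thesis by blast
      qed simp
    qed
    then have "?\<mu> (S - F) \<le> ?\<mu> (A n \<union> (\<Union>i. D (i + n)))"
      by (rule hausdorff_outer_mono[OF k])
    also have "\<dots> \<le> ?\<mu> (A n) + ?\<mu> (\<Union>i. D (i + n))" by (rule hausdorff_outer_Un[OF k])
    also have "\<dots> \<le> ?\<mu> (A n) + (\<Sum>i. ?\<mu> (D (i + n)))"
      by (intro add_mono order_refl hausdorff_outer_UN[OF k])
    finally show ?thesis .
  qed
  show ?thesis
  proof (rule ennreal_le_epsilon)
    fix e :: real assume "e > 0"
    have lt: "(\<Sum>i. ?\<mu> (D i)) < (\<Sum>i. ?\<mu> (D i)) + ennreal e"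
      using sumfin \<open>e > 0\<close> by (simp add: less_top ennreal_add_left_cancel_less[of _ 0, simplified])
    obtain n where n: "(\<Sum>i. ?\<mu> (D i)) \<le> (\<Sum>i<n. ?\<mu> (D i)) + ennreal e"
    proof -
      assume a: "\<And>n. (\<Sum>i. ?\<mu> (D i)) \<le> (\<Sum>i<n. ?\<mu> (D i)) + ennreal e \<Longrightarrow> thesis"
      have "(\<lambda>n. (\<Sum>i<n. ?\<mu> (D i)) + ennreal e) \<longlonglongrightarrow> (\<Sum>i. ?\<mu> (D i)) + ennreal e"
        by (intro tendsto_add tendsto_const summable_LIMSEQ) simp
      from order_tendstoD(1)[OF this lt]
      obtain n where "(\<Sum>i. ?\<mu> (D i)) < (\<Sum>i<n. ?\<mu> (D i)) + ennreal e"
        unfolding eventually_sequentially by blast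
      then show thesis by (intro a[of n]) simp
    qed
    have split: "(\<Sum>i. ?\<mu> (D i)) = (\<Sum>i. ?\<mu> (D (i + n))) + (\<Sum>i<n. ?\<mu> (D i))"
      by (rule suminf_offset) simp
    have "(\<Sum>i<n. ?\<mu> (D i)) \<noteq> top" using sumfin split by (auto simp: less_top)
    then have "(\<Sum>i. ?\<mu> (D (i + n))) \<le> ennreal e"
    proof -
      assume P: "(\<Sum>i<n. ?\<mu> (D i)) \<noteq> top"
      have "(\<Sum>i<n. ?\<mu> (D i)) + (\<Sum>i. ?\<mu> (D (i + n))) \<le> (\<Sum>i<n. ?\<mu> (D i)) + ennreal e"
        using n split by (simp add: add.commute)
      then show ?thesis using P by (simp add: ennreal_add_left_cancel_le)
    qed
    then have "?\<mu> (S - F) \<le> ?\<mu> (A n) + ennreal e"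
      using tail[of n] by (meson add_left_mono order_trans)
    also have "\<dots> \<le> (SUP n. ?\<mu> (A n)) + ennreal e"
      by (intro add_mono SUP_upper) auto
    finally show "?\<mu> (S - F) \<le> (SUP n. ?\<mu> {x \<in> S. 1 / real (Suc n) \<le> infdist x F}) + ennreal e"
      by (simp add: A_def)
  qed
qed

text \<open>
  Caratheodory's criterion: a set function that is additive on separated sets splits every set along a
  closed \<open>F\<close>, because the part outside \<open>F\<close> is exhausted by sets separated from \<open>F\<close>.
\<close>

theorem borel_sets_hausdorff_measure:
  assumes k: "k > 0" and S: "S \<in> sets borel"
  shows "S \<in> sets (hausdorff_measure k :: 'a::metric_space measure)"
proof -
  let ?\<mu> = "hausdorff_outer k :: 'a set \<Rightarrow> ennreal"
  have closed: "F \<in> sets (hausdorff_measure k)" if F: "closed F" for F :: "'a set"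
  proof -
    have "?\<mu> (F \<inter> X) + ?\<mu> (X - F) = ?\<mu> X" for X
    proof (rule antisym)
      have "X = (F \<inter> X) \<union> (X - F)" by blast
      then show "?\<mu> X \<le> ?\<mu> (F \<inter> X) + ?\<mu> (X - F)"
        using hausdorff_outer_Un[OF k] by metis
      show "?\<mu> (F \<inter> X) + ?\<mu> (X - F) \<le> ?\<mu> X"
      proof (cases "F = {} \<or> ?\<mu> X = top")
        case True
        then show ?thesis by (auto simp: hausdorff_outer_empty[OF k])
      next
        case False
        let ?A = "\<lambda>n. {x \<in> X. 1 / real (Suc n) \<le> infdist x F}"
        have "?\<mu> (F \<inter> X) + ?\<mu> (X - F) \<le> ?\<mu> (F \<inter> X) + (SUP n. ?\<mu> (?A n))"
          using False F by (intro add_mono order_refl hausdorff_outer_exhaust_complement[OF k])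
            (auto simp: less_top)
        also have "\<dots> = (SUP n. ?\<mu> (F \<inter> X) + ?\<mu> (?A n))"
          by (rule ennreal_SUP_add_right) simp
        also have "\<dots> \<le> ?\<mu> X"
        proof (rule SUP_least)
          fix n
          have "?\<mu> (F \<inter> X) + ?\<mu> (?A n) \<le> ?\<mu> ((F \<inter> X) \<union> ?A n)"
          proof (rule hausdorff_outer_separated[OF k])
            show "0 < 1 / real (Suc n)" by simp
            fix x y assume "x \<in> F \<inter> X" "y \<in> ?A n"
            then have "infdist y F \<le> dist x y" by (metis IntD1 dist_commute infdist_le)
            then show "1 / real (Suc n) \<le> dist x y" using \<open>y \<in> ?A n\<close> by auto
          qed
          also have "\<dots> \<le> ?\<mu> X" by (rule hausdorff_outer_mono[OF k]) auto
          finally show "?\<mu> (F \<inter> X) + ?\<mu> (?A n) \<le> ?\<mu> X" .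
        qed
        finally show ?thesis .
      qed
    qed
    moreover have "(UNIV - F) \<inter> X = X - F" for X by blast
    ultimately show ?thesis
      unfolding sets_hausdorff_measure[OF k] lambda_system_def by simp
  qed
  have "sigma_sets UNIV (Collect closed) \<subseteq> sets (hausdorff_measure k :: 'a measure)"
    using closed by (intro sets.sigma_sets_subset'[where M = "hausdorff_measure k :: 'a measure",
          unfolded space_hausdorff_measure[OF k]]) (auto simp: space_hausdorff_measure[OF k])
  then show ?thesis using S by (auto simp: borel_eq_closed)
qed

text \<open>
  The image of a covering set \<open>U\<close> lies in a ball of radius \<open>diameter U\<close>, twice the radius that
  enters the Hausdorff sum; this is the factor \<open>2 ^ DIM('b)\<close>.
\<close>

lemma hausdorff_outer_ge_lebesgue_projection:
  fixes f :: "'a::metric_space \<Rightarrow> 'b::euclidean_space"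
  assumes lip: "1-lipschitz_on UNIV f" and box: "box a b \<subseteq> f ` S"
  shows "emeasure lborel (box a b) \<le> 2 ^ DIM('b) * hausdorff_outer DIM('b) S"
proof -
  let ?k = "DIM('b)"
  have "emeasure lborel (box a b) \<le> 2 ^ ?k * (\<Sum>i. ennreal (unit_ball_vol (real ?k) * (diameter (U i) / 2) ^ ?k))"
    if cov: "S \<subseteq> (\<Union>i. U i)" and U: "\<And>i. bounded (U i)" for U :: "nat \<Rightarrow> 'a set"
  proof -
    define p where "p = (\<lambda>i. f (SOME x. x \<in> U i))"
    have "f x \<in> cball (p i) (diameter (U i))" if "x \<in> U i" for x i
    proof -
      have "(SOME x. x \<in> U i) \<in> U i" using that by (rule someI)
      then have "dist (SOME x. x \<in> U i) x \<le> diameter (U i)"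
        using that U by (intro diameter_bounded_bound) auto
      then show ?thesis
        using lipschitz_onD[OF lip, of "SOME x. x \<in> U i" x] by (simp add: p_def)
    qed
    then have "box a b \<subseteq> (\<Union>i. cball (p i) (diameter (U i)))"
    proof -
      assume p: "\<And>x i. x \<in> U i \<Longrightarrow> f x \<in> cball (p i) (diameter (U i))"
      show ?thesis
      proof
        fix y assume "y \<in> box a b"
        then obtain x where "y = f x" "x \<in> S" using box by blast
        moreover from \<open>x \<in> S\<close> obtain i where "x \<in> U i" using cov by blast
        ultimately show "y \<in> (\<Union>i. cball (p i) (diameter (U i)))" using p by blast
      qed
    qed
    then have "emeasure lborel (box a b) \<le> emeasure lborel (\<Union>i. cball (p i) (diameter (U i)))"
      by (intro emeasure_mono) auto
    also have "\<dots> \<le> (\<Sum>i. emeasure lborel (cball (p i) (diameter (U i))))"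
      by (intro emeasure_subadditive_countably) auto
    also have "\<dots> = (\<Sum>i. 2 ^ ?k * ennreal (unit_ball_vol (real ?k) * (diameter (U i) / 2) ^ ?k))"
    proof (intro suminf_cong)
      fix i
      have d: "diameter (U i) \<ge> 0" by (rule diameter_ge_0[OF U])
      have "emeasure lborel (cball (p i) (diameter (U i)))
          = ennreal (unit_ball_vol (real ?k) * diameter (U i) ^ ?k)"
        by (rule emeasure_cball[OF d])
      also have "unit_ball_vol (real ?k) * diameter (U i) ^ ?k
          = 2 ^ ?k * (unit_ball_vol (real ?k) * (diameter (U i) / 2) ^ ?k)"
        by (simp add: power_divide)
      also have "ennreal \<dots> = 2 ^ ?k * ennreal (unit_ball_vol (real ?k) * (diameter (U i) / 2) ^ ?k)"
        using d by (subst ennreal_mult) (auto simp flip: ennreal_power)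
      finally show "emeasure lborel (cball (p i) (diameter (U i)))
        = 2 ^ ?k * ennreal (unit_ball_vol (real ?k) * (diameter (U i) / 2) ^ ?k)" .
    qed
    finally show ?thesis by simp
  qed
  then have "emeasure lborel (box a b) / 2 ^ ?k \<le> hausdorff_pre ?k 1 S"
    unfolding hausdorff_pre_def
    by (intro INF_greatest divide_le_posI_ennreal) (auto simp: mult.commute zero_less_iff_neq_zero)
  also have "\<dots> \<le> hausdorff_outer ?k S"
    unfolding hausdorff_outer_def by (rule SUP_upper) simp
  finally have "2 ^ ?k * (emeasure lborel (box a b) / 2 ^ ?k) \<le> 2 ^ ?k * hausdorff_outer ?k S"
    by (rule mult_left_mono) simp
  then show ?thesis
    by (simp add: ennreal_times_divide mult.commute ennreal_mult_divide_eq power_eq_top_ennreal)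
qed


section \<open>Ordinary differential equations with Lipschitz right-hand side\<close>

lemma antiderivative_exp_bound:
  fixes G :: "real \<Rightarrow> 'a::euclidean_space"
  assumes G: "\<And>t. (G has_vector_derivative g t) (at t)"
    and bnd: "\<And>t. norm (g t) \<le> K * exp (l * \<bar>t\<bar>)" and "l > 0"
  shows "norm (G t - G 0) \<le> K / l * exp (l * \<bar>t\<bar>)"
proof -
  have K: "0 \<le> K" using order_trans[OF norm_ge_zero bnd[of 0]] by simp
  have *: "norm (H t - H 0) \<le> K / l * exp (l * t)"
    if H: "\<And>t. (H has_vector_derivative h t) (at t)"
      and hb: "\<And>t. norm (h t) \<le> K * exp (l * \<bar>t\<bar>)" and "t > 0" for H h :: "real \<Rightarrow> 'a" and t
  proof -
    have "norm (H t - H 0) \<le> K / l * exp (l * t) - K / l * exp (l * 0)"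
    proof (rule differentiable_bound_general[OF \<open>t > 0\<close>, where f' = h and \<phi>' = "\<lambda>t. K * exp (l * t)"])
      show "continuous_on {0..t} H"
        using H by (meson continuous_at_imp_continuous_on has_vector_derivative_continuous)
      show "continuous_on {0..t} (\<lambda>t. K / l * exp (l * t))" by (intro continuous_intros)
      fix x :: real assume x: "0 < x" "x < t"
      show "((\<lambda>t. K / l * exp (l * t)) has_vector_derivative K * exp (l * x)) (at x)"
        unfolding has_real_derivative_iff_has_vector_derivative[symmetric]
        using \<open>l > 0\<close> by (auto intro!: derivative_eq_intros)
      show "norm (h x) \<le> K * exp (l * x)" using hb[of x] x by simp
      show "(H has_vector_derivative h x) (at x)" by (rule H)
    qed
    also have "\<dots> \<le> K / l * exp (l * t)" using K \<open>l > 0\<close> by simp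
    finally show ?thesis .
  qed
  consider "t > 0" | "t = 0" | "t < 0" by linarith
  then show ?thesis
  proof cases
    case 1
    then show ?thesis using *[OF G bnd 1] by simp
  next
    case 2
    then show ?thesis using K \<open>l > 0\<close> by simp
  next
    case 3
    have "((\<lambda>t. G (- t)) has_vector_derivative - g (- t)) (at t)" for t
    proof -
      have "(uminus has_vector_derivative (- 1 :: real)) (at t)"
        by (auto intro!: derivative_eq_intros)
      from vector_diff_chain_at[OF this G] show ?thesis by (simp add: o_def)
    qed
    from *[OF this, of "- t"] bnd[of "- _"] 3 show ?thesis by simp
  qed
qed

text \<open>
  Picard iteration on the whole line at once.  Writing a candidate as \<open>exp (l \<bar>t\<bar>) u(t)\<close> with \<open>u\<close>
  bounded makes the integral operator a contraction for the supremum norm of \<open>u\<close>, because \<open>l\<close>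
  exceeds twice the Lipschitz constant; \<open>antiderivative_exp_bound\<close> is the estimate behind it.
\<close>

theorem lipschitz_ode_global_solution:
  fixes F :: "'a::euclidean_space \<Rightarrow> 'a"
  assumes lip: "L-lipschitz_on UNIV F"
  shows "\<exists>y. y t0 = x0 \<and> (\<forall>t. (y has_vector_derivative F (y t)) (at t))"
proof -
  define l where "l = 2 * L + 1"
  have L: "0 \<le> L" using lip by (rule lipschitz_on_nonneg)
  have l: "l > 0" using L by (simp add: l_def)
  have contF: "continuous_on UNIV F" by (rule lipschitz_on_continuous_on[OF lip])
  define g where "g = (\<lambda>(u :: real \<Rightarrow>\<^sub>C 'a) s. F (exp (l * \<bar>s\<bar>) *\<^sub>R u s))"
  have cont_g: "isCont (g u) s" for u s
    unfolding g_def
    by (intro continuous_on_interior[of UNIV] continuous_on_compose2[OF contF] continuous_intros) auto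
  have "\<exists>G. \<forall>t. (G has_vector_derivative g u t) (at t)" for u
    using einterval_antiderivative[of "-\<infinity>" "\<infinity>" "g u"] cont_g by auto
  then obtain I where I: "\<And>u t. (I u has_vector_derivative g u t) (at t)" by metis
  define T where "T = (\<lambda>u t. exp (- (l * \<bar>t\<bar>)) *\<^sub>R (x0 + (I u t - I u 0)))"
  have contT: "continuous_on UNIV (T u)" for u
  proof -
    have "continuous_on UNIV (I u)"
      using I by (meson continuous_at_imp_continuous_on has_vector_derivative_continuous)
    then show ?thesis unfolding T_def by (intro continuous_intros)
  qed
  have T_bcont: "T u \<in> bcontfun" for u
  proof (rule bcontfun_normI[OF contT])
    fix t :: real
    have "norm (g u s) \<le> (norm (F 0) + L * norm u) * exp (l * \<bar>s\<bar>)" for s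
    proof -
      have "norm (g u s) \<le> norm (F 0) + norm (F (exp (l * \<bar>s\<bar>) *\<^sub>R u s) - F 0)"
        unfolding g_def by (rule norm_triangle_sub)
      also have "norm (F (exp (l * \<bar>s\<bar>) *\<^sub>R u s) - F 0) \<le> L * (exp (l * \<bar>s\<bar>) * norm (u s))"
        using lipschitz_on_normD[OF lip, of "exp (l * \<bar>s\<bar>) *\<^sub>R u s" 0] by simp
      also have "\<dots> \<le> L * (exp (l * \<bar>s\<bar>) * norm u)"
        using L norm_bounded[of u s] by (intro mult_left_mono) auto
      also have "norm (F 0) \<le> norm (F 0) * exp (l * \<bar>s\<bar>)"
        using l by (simp add: mult_le_cancel_left1)
      finally show ?thesis by (simp add: algebra_simps)
    qed
    from antiderivative_exp_bound[OF I this l]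
    have "norm (I u t - I u 0) \<le> (norm (F 0) + L * norm u) / l * exp (l * \<bar>t\<bar>)" .
    moreover have "norm x0 \<le> norm x0 * exp (l * \<bar>t\<bar>)" using l by (simp add: mult_le_cancel_left1)
    ultimately have "norm (x0 + (I u t - I u 0)) \<le> (norm x0 + (norm (F 0) + L * norm u) / l) * exp (l * \<bar>t\<bar>)"
      using norm_triangle_ineq[of x0 "I u t - I u 0"] by (simp add: algebra_simps)
    then have "exp (- (l * \<bar>t\<bar>)) * norm (x0 + (I u t - I u 0))
        \<le> exp (- (l * \<bar>t\<bar>)) * ((norm x0 + (norm (F 0) + L * norm u) / l) * exp (l * \<bar>t\<bar>))"
      by (intro mult_left_mono) auto
    also have "\<dots> = norm x0 + (norm (F 0) + L * norm u) / l"
      by (simp add: exp_minus field_simps)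
    finally show "norm (T u t) \<le> norm x0 + (norm (F 0) + L * norm u) / l"
      by (simp add: T_def)
  qed
  define \<Phi> where "\<Phi> = (\<lambda>u. Bcontfun (T u))"
  have \<Phi>: "apply_bcontfun (\<Phi> u) = T u" for u
    unfolding \<Phi>_def by (rule Bcontfun_inverse[OF T_bcont])
  have contr: "dist (\<Phi> u) (\<Phi> v) \<le> 1 / 2 * dist u v" for u v
  proof (rule dist_bound)
    fix t :: real
    have "((\<lambda>t. I u t - I v t) has_vector_derivative g u t - g v t) (at t)" for t
      by (intro has_vector_derivative_diff I)
    moreover have "norm (g u s - g v s) \<le> (L * dist u v) * exp (l * \<bar>s\<bar>)" for s
    proof -
      have "norm (g u s - g v s) \<le> L * norm (exp (l * \<bar>s\<bar>) *\<^sub>R u s - exp (l * \<bar>s\<bar>) *\<^sub>R v s)"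
        unfolding g_def by (rule lipschitz_on_normD[OF lip]) auto
      also have "\<dots> = L * (exp (l * \<bar>s\<bar>) * dist (u s) (v s))"
        by (simp add: dist_norm flip: scaleR_diff_right)
      also have "\<dots> \<le> L * (exp (l * \<bar>s\<bar>) * dist u v)"
        using L dist_bounded[of u s v] by (intro mult_left_mono) auto
      finally show ?thesis by (simp add: ac_simps)
    qed
    ultimately have "norm ((I u t - I v t) - (I u 0 - I v 0)) \<le> (L * dist u v) / l * exp (l * \<bar>t\<bar>)"
      by (rule antiderivative_exp_bound[OF _ _ l])
    moreover have "T u t - T v t = exp (- (l * \<bar>t\<bar>)) *\<^sub>R ((I u t - I v t) - (I u 0 - I v 0))"
      by (simp add: T_def algebra_simps)
    ultimately have "norm (T u t - T v t) \<le> exp (- (l * \<bar>t\<bar>)) * ((L * dist u v) / l * exp (l * \<bar>t\<bar>))"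
      by (simp only: norm_scaleR abs_exp_cancel) (intro mult_left_mono, auto)
    also have "\<dots> = L / l * dist u v" by (simp add: exp_minus field_simps)
    also have "\<dots> \<le> 1 / 2 * dist u v"
      using L by (intro mult_right_mono) (auto simp: l_def field_simps)
    finally show "dist (\<Phi> u t) (\<Phi> v t) \<le> 1 / 2 * dist u v" by (simp add: \<Phi> dist_norm)
  qed
  then obtain u where u: "\<Phi> u = u"
    using banach_fix_type[of "1/2" \<Phi>] by auto
  define y where "y = (\<lambda>t. exp (l * \<bar>t\<bar>) *\<^sub>R u t)"
  have y: "y t = x0 + (I u t - I u 0)" for t
    unfolding y_def by (subst u[symmetric]) (simp add: \<Phi> T_def exp_minus)
  have dy: "(y has_vector_derivative F (y t)) (at t)" for t
  proof -
    have "((\<lambda>t. x0 + (I u t - I u 0)) has_vector_derivative g u t) (at t)"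
      by (auto intro!: derivative_eq_intros I)
    moreover have "g u t = F (y t)" by (simp add: g_def y_def)
    ultimately show ?thesis using y by (simp add: ext[of y "\<lambda>t. x0 + (I u t - I u 0)"])
  qed
  show ?thesis
  proof (intro exI[of _ "\<lambda>t. y (t - t0)"] conjI allI)
    show "y (t0 - t0) = x0" using y[of 0] by simp
    fix t
    show "((\<lambda>t. y (t - t0)) has_vector_derivative F (y (t - t0))) (at t)"
    proof -
      have "((\<lambda>t. t - t0) has_vector_derivative 1) (at t)"
        by (auto intro!: derivative_eq_intros)
      from vector_diff_chain_at[OF this dy] show ?thesis by (simp add: o_def)
    qed
  qed
qed

text \<open>
  Gronwall's estimate: the squared distance of two solutions, multiplied by \<open>exp (- 2 L t)\<close>, does not
  increase.
\<close>

lemma lipschitz_ode_dist_forward: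
  fixes F :: "'a::euclidean_space \<Rightarrow> 'a"
  assumes lip: "L-lipschitz_on X F" and "s \<le> t"
    and x: "\<And>r. r \<in> {s..t} \<Longrightarrow> (x has_vector_derivative F (x r)) (at r)" "\<And>r. r \<in> {s..t} \<Longrightarrow> x r \<in> X"
    and y: "\<And>r. r \<in> {s..t} \<Longrightarrow> (y has_vector_derivative F (y r)) (at r)" "\<And>r. r \<in> {s..t} \<Longrightarrow> y r \<in> X"
  shows "dist (x t) (y t) \<le> dist (x s) (y s) * exp (L * (t - s))"
proof -
  define d where "d = (\<lambda>r. x r - y r)"
  define \<phi> where "\<phi> = (\<lambda>r. (d r \<bullet> d r) * exp (- 2 * L * r))"
  have "\<phi> t \<le> \<phi> s"
  proof (rule DERIV_nonpos_imp_nonincreasing[OF \<open>s \<le> t\<close>])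
    fix r assume "s \<le> r" "r \<le> t"
    then have r: "r \<in> {s..t}" by simp
    let ?D = "F (x r) - F (y r)"
    have "(d has_vector_derivative ?D) (at r)"
      unfolding d_def by (intro has_vector_derivative_diff x y r)
    from bounded_bilinear.has_vector_derivative[OF bounded_bilinear_inner this this]
    have "((\<lambda>r. d r \<bullet> d r) has_real_derivative 2 * (d r \<bullet> ?D)) (at r)"
      by (simp add: has_real_derivative_iff_has_vector_derivative inner_commute)
    then have "(\<phi> has_real_derivative 2 * (d r \<bullet> ?D) * exp (- 2 * L * r)
        + (d r \<bullet> d r) * (exp (- 2 * L * r) * (- 2 * L))) (at r)"
      unfolding \<phi>_def by (auto intro!: derivative_eq_intros)
    moreover have "d r \<bullet> ?D \<le> L * (d r \<bullet> d r)"
    proof -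
      have "d r \<bullet> ?D \<le> norm (d r) * norm ?D" by (rule norm_cauchy_schwarz)
      also have "\<dots> \<le> norm (d r) * (L * norm (d r))"
        unfolding d_def using lipschitz_on_normD[OF lip x(2)[OF r] y(2)[OF r]] by (intro mult_left_mono) auto
      finally show ?thesis by (simp add: dot_square_norm power2_eq_square ac_simps)
    qed
    then have "2 * (d r \<bullet> ?D) * exp (- 2 * L * r) + (d r \<bullet> d r) * (exp (- 2 * L * r) * (- 2 * L)) \<le> 0"
      using mult_right_mono[of "d r \<bullet> ?D" "L * (d r \<bullet> d r)" "2 * exp (- 2 * L * r)"]
      by (simp add: algebra_simps)
    ultimately show "\<exists>y. (\<phi> has_real_derivative y) (at r) \<and> y \<le> 0" by blast
  qed
  then have "(norm (d t))\<^sup>2 * exp (- 2 * L * t) \<le> (norm (d s))\<^sup>2 * exp (- 2 * L * s)"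
    by (simp add: \<phi>_def dot_square_norm)
  then have "(norm (d t))\<^sup>2 * exp (- 2 * L * t) * exp (2 * L * t)
      \<le> (norm (d s))\<^sup>2 * exp (- 2 * L * s) * exp (2 * L * t)"
    by (rule mult_right_mono) simp
  also have "\<dots> = (norm (d s) * exp (L * (t - s)))\<^sup>2"
    by (simp add: power_mult_distrib mult.assoc exp_add[symmetric] algebra_simps flip: exp_double)
  also have "(norm (d t))\<^sup>2 * exp (- 2 * L * t) * exp (2 * L * t) = (norm (d t))\<^sup>2"
    by (simp add: mult.assoc exp_add[symmetric])
  finally show ?thesis
    by (auto simp: d_def dist_norm intro: power2_le_imp_le)
qed

lemma lipschitz_ode_unique:
  fixes F :: "'a::euclidean_space \<Rightarrow> 'a"
  assumes lip: "L-lipschitz_on X F"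
    and x: "\<And>r. r \<in> closed_segment s t \<Longrightarrow> (x has_vector_derivative F (x r)) (at r)"
      "\<And>r. r \<in> closed_segment s t \<Longrightarrow> x r \<in> X"
    and y: "\<And>r. r \<in> closed_segment s t \<Longrightarrow> (y has_vector_derivative F (y r)) (at r)"
      "\<And>r. r \<in> closed_segment s t \<Longrightarrow> y r \<in> X"
    and eq: "x s = y s"
  shows "x t = y t"
proof (cases "s \<le> t")
  case True
  have "dist (x t) (y t) \<le> dist (x s) (y s) * exp (L * (t - s))"
    by (rule lipschitz_ode_dist_forward[OF lip True])
      (use x y True in \<open>auto simp: closed_segment_eq_real_ivl\<close>)
  then show ?thesis using eq by simp
next
  case False
  have rev: "((\<lambda>r. w (- r)) has_vector_derivative - F (w (- r))) (at r)"
    if "(w has_vector_derivative F (w (- r))) (at (- r))" for w :: "real \<Rightarrow> 'a" and r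
  proof -
    have "(uminus has_vector_derivative (- 1 :: real)) (at r)"
      by (auto intro!: derivative_eq_intros)
    from vector_diff_chain_at[OF this that] show ?thesis by (simp add: o_def)
  qed
  have "dist (x (- (- t))) (y (- (- t))) \<le> dist (x (- (- s))) (y (- (- s))) * exp (L * (- t - - s))"
    by (rule lipschitz_ode_dist_forward[where F = "\<lambda>p. - F p" and X = X])
      (use lip False x y in \<open>auto intro!: rev simp: closed_segment_eq_real_ivl\<close>)
  then show ?thesis using eq by simp
qed

lemma pos_R_inner: "pos_R x = x \<bullet> (1, 0, 0, 0)"
  by (cases x) simp

lemma continuous_on_pos_R [continuous_intros]: "continuous_on S f \<Longrightarrow> continuous_on S (\<lambda>x. pos_R (f x))"
  unfolding pos_R_inner by (intro continuous_intros)

lemma open_phase_space: "open phase_space"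
  unfolding phase_space_def by (intro open_Collect_less continuous_intros)

text \<open>
  Half of the minimum of \<open>R\<close> on \<open>K\<close> serves as the margin \<open>e\<close>: the enlarged box still has \<open>R > 0\<close>.
  Boxes are convenient because \<open>clamp\<close> retracts onto them without increasing distances.
\<close>

lemma compact_in_phase_space_box:
  assumes K: "compact K" "K \<subseteq> phase_space"
  obtains c d e where "e > 0" "K \<subseteq> cbox c d" "cbox (c - e *\<^sub>R One) (d + e *\<^sub>R One) \<subseteq> phase_space"
proof -
  obtain r where r: "r > 0" "\<And>x. x \<in> K \<Longrightarrow> r \<le> pos_R x"
  proof (cases "K = {}")
    case False
    then obtain x where "x \<in> K" "\<And>y. y \<in> K \<Longrightarrow> pos_R x \<le> pos_R y"
      using continuous_attains_inf[OF K(1) False continuous_on_pos_R[OF continuous_on_id]] by blast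
    then show ?thesis using that[of "pos_R x"] K(2) by (auto simp: phase_space_def)
  qed (use that[of 1] in auto)
  obtain a where a: "K \<subseteq> cbox (- a) a"
    using bounded_subset_cbox_symmetric[OF compact_imp_bounded[OF K(1)]] .
  define c where "c = (r, snd (- a))"
  have "K \<subseteq> cbox c a"
  proof
    fix x assume "x \<in> K"
    then have "x \<in> cbox (- a) a" "r \<le> fst x"
      using a r(2)[of x] by (auto simp: pos_R_inner inner_prod_def)
    then show "x \<in> cbox c a"
      by (cases x, cases a) (auto simp: c_def cbox_Pair_eq)
  qed
  moreover have "cbox (c - (r / 2) *\<^sub>R One) (a + (r / 2) *\<^sub>R One) \<subseteq> phase_space"
  proof
    fix x assume "x \<in> cbox (c - (r / 2) *\<^sub>R One) (a + (r / 2) *\<^sub>R One)"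
    moreover have "(1, 0, 0, 0) \<in> (Basis :: state set)" by (auto simp: Basis_prod_def zero_prod_def)
    ultimately have "(c - (r / 2) *\<^sub>R One) \<bullet> (1, 0, 0, 0) \<le> pos_R x"
      by (auto simp: mem_box pos_R_inner)
    moreover have "(c - (r / 2) *\<^sub>R One) \<bullet> (1, 0, 0, 0) = r / 2"
      using \<open>(1, 0, 0, 0) \<in> (Basis :: state set)\<close>
      by (simp add: inner_diff_left inner_sum_left_Basis c_def flip: zero_prod_def)
    ultimately show "x \<in> phase_space" using r(1) by (simp add: phase_space_def)
  qed
  ultimately show thesis using that[of "r / 2" c a] r(1) by simp
qed

lemma near_cbox_in_box:
  fixes c d :: "'a::euclidean_space"
  assumes "x \<in> cbox c d" "dist x y < e"
  shows "y \<in> box (c - e *\<^sub>R One) (d + e *\<^sub>R One)"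
  unfolding mem_box
proof
  fix i :: 'a assume i: "i \<in> Basis"
  have "\<bar>(y - x) \<bullet> i\<bar> \<le> norm (y - x)" using i by (rule Basis_le_norm)
  then have "\<bar>y \<bullet> i - x \<bullet> i\<bar> < e"
    using assms(2) by (simp add: dist_norm norm_minus_commute inner_diff_left)
  moreover have "c \<bullet> i \<le> x \<bullet> i" "x \<bullet> i \<le> d \<bullet> i" using assms(1) i by (auto simp: mem_box)
  ultimately show "(c - e *\<^sub>R One) \<bullet> i < y \<bullet> i \<and> y \<bullet> i < (d + e *\<^sub>R One) \<bullet> i"
    using i by (auto simp: inner_diff_left inner_add_left)
qed

lemma cbox_subset_enlarged_box:
  fixes c d :: "'a::euclidean_space"
  assumes "e > 0"
  shows "cbox c d \<subseteq> box (c - e *\<^sub>R One) (d + e *\<^sub>R One)"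
  by (intro subsetI near_cbox_in_box) (use assms in auto)


section \<open>Maximal solutions and continuous dependence for Hamiltonian systems\<close>

text \<open>
  Everything about the existence and continuation of solutions uses the Hamiltonian only through
  Lipschitz bounds of its vector field on boxes.
\<close>

locale lipschitz_hamiltonian =
  fixes H :: "state \<Rightarrow> real"
  assumes lip: "\<And>c d. cbox c d \<subseteq> phase_space \<Longrightarrow> \<exists>L. L-lipschitz_on (cbox c d) (hamiltonian_vf H)"
begin

lemma solutionD:
  assumes "solution H a b x" "t \<in> einterval a b"
  shows "x t \<in> phase_space" "(x has_vector_derivative hamiltonian_vf H (x t)) (at t)" "isCont x t"
proof -
  show "x t \<in> phase_space" "(x has_vector_derivative hamiltonian_vf H (x t)) (at t)"
    using assms by (simp_all add: solution_def)
  then show "isCont x t" by (auto intro: has_vector_derivative_continuous)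
qed

lemma einterval_segment:
  assumes "s \<in> einterval a b" "t \<in> einterval a b" "r \<in> closed_segment s t"
  shows "r \<in> einterval a b"
proof -
  have r: "min s t \<le> r" "r \<le> max s t"
    using assms(3) by (auto simp: closed_segment_eq_real_ivl split: if_splits)
  have "a < ereal (min s t)" "ereal (max s t) < b"
    using assms(1,2) by (auto simp: einterval_def min_def max_def)
  then show ?thesis
    using r by (auto simp: einterval_def simp del: ereal_min ereal_max
        intro: less_le_trans[of a "ereal (min s t)"] le_less_trans[of _ "ereal (max s t)"])
qed

lemma solution_compact_image:
  assumes "solution H a b x" "s \<in> einterval a b" "t \<in> einterval a b"
  shows "compact (x ` closed_segment s t)" "x ` closed_segment s t \<subseteq> phase_space"
proof -
  have seg: "r \<in> einterval a b" if "r \<in> closed_segment s t" for r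
    using einterval_segment[OF assms(2,3) that] .
  then have "continuous_on (closed_segment s t) x"
    using solutionD(3)[OF assms(1)] by (intro continuous_at_imp_continuous_on) blast
  then show "compact (x ` closed_segment s t)" by (rule compact_continuous_image) simp
  show "x ` closed_segment s t \<subseteq> phase_space" using solutionD(1)[OF assms(1)] seg by blast
qed

lemma solutions_agree:
  assumes x: "solution H a b x" and y: "solution H a' b' y"
    and s: "s \<in> einterval a b" "s \<in> einterval a' b'" and t: "t \<in> einterval a b" "t \<in> einterval a' b'"
    and eq: "x s = y s"
  shows "x t = y t"
proof -
  let ?I = "closed_segment s t"
  have "compact (x ` ?I \<union> y ` ?I)" "x ` ?I \<union> y ` ?I \<subseteq> phase_space"
    using solution_compact_image[OF x s(1) t(1)] solution_compact_image[OF y s(2) t(2)] by auto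
  from compact_in_phase_space_box[OF this] obtain c d e where
    e: "e > 0" and K: "x ` ?I \<union> y ` ?I \<subseteq> cbox c d"
    and ph: "cbox (c - e *\<^sub>R One) (d + e *\<^sub>R One) \<subseteq> phase_space" .
  have "cbox c d \<subseteq> phase_space"
    by (rule order_trans[OF cbox_subset_enlarged_box[OF e] order_trans[OF box_subset_cbox ph]])
  from lip[OF this] obtain L where "L-lipschitz_on (cbox c d) (hamiltonian_vf H)" ..
  then show ?thesis
  proof (rule lipschitz_ode_unique)
    fix r assume "r \<in> ?I"
    then have r: "r \<in> einterval a b" "r \<in> einterval a' b'"
      using einterval_segment s t by blast+
    show "(x has_vector_derivative hamiltonian_vf H (x r)) (at r)"
      "(y has_vector_derivative hamiltonian_vf H (y r)) (at r)"
      by (rule solutionD(2)[OF x r(1)], rule solutionD(2)[OF y r(2)])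
    show "x r \<in> cbox c d" "y r \<in> cbox c d" using K \<open>r \<in> ?I\<close> by auto
  qed (rule eq)
qed

text \<open>
  Precomposing with the retraction onto the box extends the field to a globally Lipschitz one, whose
  solutions exist for all time and solve the original system while they stay in the box.
\<close>

lemma lipschitz_extension_from_box:
  assumes ph: "cbox c d \<subseteq> phase_space" and ne: "cbox c d \<noteq> {}"
  shows "\<exists>L F. L-lipschitz_on UNIV F \<and> (\<forall>p\<in>cbox c d. F p = hamiltonian_vf H p)"
proof -
  obtain L where L: "L-lipschitz_on (cbox c d) (hamiltonian_vf H)" using lip[OF ph] by blast
  have ne': "\<And>i. i \<in> Basis \<Longrightarrow> c \<bullet> i \<le> d \<bullet> i" using ne by (simp add: box_ne_empty)
  define F where "F = (\<lambda>p. hamiltonian_vf H (clamp c d p))"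
  have "L-lipschitz_on UNIV F"
  proof (rule lipschitz_onI)
    fix p q :: state
    have "dist (F p) (F q) \<le> L * dist (clamp c d p) (clamp c d q)"
      unfolding F_def using ne' by (intro lipschitz_onD[OF L] clamp_in_interval) auto
    also have "\<dots> \<le> L * dist p q"
      using lipschitz_on_nonneg[OF L] by (intro mult_left_mono dist_clamps_le_dist_args)
    finally show "dist (F p) (F q) \<le> L * dist p q" .
  qed (rule lipschitz_on_nonneg[OF L])
  moreover have "\<forall>p\<in>cbox c d. F p = hamiltonian_vf H p"
    by (simp add: F_def)
  ultimately show ?thesis by blast
qed

lemma solution_through:
  assumes "x0 \<in> phase_space"
  shows "\<exists>a b x. solution H a b x \<and> 0 \<in> einterval a b \<and> x 0 = x0"
proof -
  obtain c d e where e: "e > 0" and K: "{x0} \<subseteq> cbox c d"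
    and ph: "cbox (c - e *\<^sub>R One) (d + e *\<^sub>R One) \<subseteq> phase_space" (is "?C \<subseteq> _")
    by (rule compact_in_phase_space_box[of "{x0}"]) (use assms in auto)
  have x0: "x0 \<in> box (c - e *\<^sub>R One) (d + e *\<^sub>R One)" (is "_ \<in> ?B")
    using near_cbox_in_box[of x0 c d x0 e] e K by simp
  then have "?C \<noteq> {}" using box_subset_cbox by blast
  from lipschitz_extension_from_box[OF ph this] obtain L F where
    F: "L-lipschitz_on UNIV F" "\<And>p. p \<in> ?C \<Longrightarrow> F p = hamiltonian_vf H p" by blast
  obtain y where y: "y 0 = x0" "\<And>t. (y has_vector_derivative F (y t)) (at t)"
    using lipschitz_ode_global_solution[OF F(1), of 0 x0] by blast
  have "continuous_on UNIV y"
    using y(2) by (meson continuous_at_imp_continuous_on has_vector_derivative_continuous)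
  then have "open (y -` ?B)" by (rule open_vimage[OF open_box])
  moreover have "0 \<in> y -` ?B" using x0 y(1) by simp
  ultimately have "\<exists>\<tau>>0. \<forall>t. \<bar>t - 0\<bar> < \<tau> \<longrightarrow> y t \<in> ?B"
    unfolding open_dist dist_real_def by blast
  then have "\<exists>\<tau>>0. \<forall>t. \<bar>t\<bar> < \<tau> \<longrightarrow> y t \<in> ?B" by simp
  then obtain \<tau> where \<tau>: "\<tau> > 0" "\<And>t. \<bar>t\<bar> < \<tau> \<Longrightarrow> y t \<in> ?B" by blast
  have "solution H (- ereal \<tau>) (ereal \<tau>) y"
    unfolding solution_def
  proof (intro conjI ballI)
    show "- ereal \<tau> < ereal \<tau>" using \<tau>(1) by simp
    fix t assume "t \<in> einterval (- ereal \<tau>) (ereal \<tau>)"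
    then have "\<bar>t\<bar> < \<tau>" by (simp add: einterval_def abs_less_iff)
    then have C: "y t \<in> ?C" by (intro subsetD[OF box_subset_cbox] \<tau>(2))
    show "y t \<in> phase_space" by (rule subsetD[OF ph C])
    show "(y has_vector_derivative hamiltonian_vf H (y t)) (at t)"
      using y(2)[of t] by (simp only: F(2)[OF C])
  qed
  moreover have "0 \<in> einterval (- ereal \<tau>) (ereal \<tau>)" using \<tau>(1) by (simp add: einterval_def)
  ultimately show ?thesis using y(1) by blast
qed

text \<open>
  Besides maximality in the sense of \<open>maximal_solution\<close>, a flow line contains every solution
  through its initial state.  Solutions obtained by other means, for example inside a box, can then
  be compared with it directly.
\<close>

definition flow_line :: "ereal \<Rightarrow> ereal \<Rightarrow> (real \<Rightarrow> state) \<Rightarrow> bool" where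
  "flow_line a b x \<longleftrightarrow> maximal_solution H a b x \<and> 0 \<in> einterval a b \<and>
     (\<forall>a' b' y. solution H a' b' y \<and> 0 \<in> einterval a' b' \<and> y 0 = x 0 \<longrightarrow>
        a \<le> a' \<and> b' \<le> b \<and> (\<forall>t \<in> einterval a' b'. y t = x t))"

text \<open>
  All solutions through \<open>x0\<close> agree where they are defined together, so they glue to one solution on
  the union of their intervals.
\<close>

theorem flow_line_exists:
  assumes "x0 \<in> phase_space"
  obtains a b x where "flow_line a b x" "x 0 = x0"
proof -
  define \<S> where "\<S> = {(a, b, y). solution H a b y \<and> 0 \<in> einterval a b \<and> y 0 = x0}"
  define a where "a = (INF (a, b, y) \<in> \<S>. a)"
  define b where "b = (SUP (a, b, y) \<in> \<S>. b)"
  have ab: "a \<le> a'" "b' \<le> b" if "(a', b', y) \<in> \<S>" for a' b' y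
    using that unfolding a_def b_def by (auto intro: INF_lower2 SUP_upper2)
  have ex: "\<exists>a' b' y. (a', b', y) \<in> \<S> \<and> t \<in> einterval a' b'" if "t \<in> einterval a b" for t
  proof (cases "t \<ge> 0")
    case True
    have "ereal t < b" using that by (simp add: einterval_def)
    then obtain a' b' y where "(a', b', y) \<in> \<S>" "ereal t < b'"
      unfolding b_def less_SUP_iff by auto
    moreover have "a' < ereal 0" using \<open>(a', b', y) \<in> \<S>\<close> by (auto simp: \<S>_def einterval_def)
    then have "a' < ereal t" using True by (meson ereal_less_eq(3) less_le_trans)
    ultimately show ?thesis by (auto simp: einterval_def)
  next
    case False
    have "a < ereal t" using that by (simp add: einterval_def)
    then obtain a' b' y where "(a', b', y) \<in> \<S>" "a' < ereal t"
      unfolding a_def INF_less_iff by auto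
    moreover have "ereal 0 < b'" using \<open>(a', b', y) \<in> \<S>\<close> by (auto simp: \<S>_def einterval_def)
    then have "ereal t < b'" using False by (meson ereal_less_eq(3) le_less_trans linear)
    ultimately show ?thesis by (auto simp: einterval_def)
  qed
  define x where "x = (\<lambda>t. THE p. \<exists>a' b' y. (a', b', y) \<in> \<S> \<and> t \<in> einterval a' b' \<and> p = y t)"
  have x: "x t = y t" if S: "(a', b', y) \<in> \<S>" and t: "t \<in> einterval a' b'" for a' b' y t
  proof -
    have "w t = y t" if w: "(a'', b'', w) \<in> \<S>" "t \<in> einterval a'' b''" for a'' b'' w
      by (rule solutions_agree[of a'' b'' w a' b' y 0]) (use w S t in \<open>simp_all add: \<S>_def\<close>)
    then show ?thesis unfolding x_def using S t by (intro the_equality) blast+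
  qed
  obtain a0 b0 y0 where S0: "(a0, b0, y0) \<in> \<S>"
    using solution_through[OF assms] by (auto simp: \<S>_def)
  have zero: "0 \<in> einterval a b"
    using ab[OF S0] S0 by (auto simp: \<S>_def einterval_def intro: le_less_trans less_le_trans)
  have x0: "x 0 = x0" using x[OF S0, of 0] S0 by (simp add: \<S>_def)
  have "solution H a b x"
    unfolding solution_def
  proof (intro conjI ballI)
    show "a < b" using zero by (auto simp: einterval_def)
    fix t assume "t \<in> einterval a b"
    from ex[OF this] obtain a' b' y where y: "(a', b', y) \<in> \<S>" "t \<in> einterval a' b'" by blast
    then have sol: "solution H a' b' y" by (simp add: \<S>_def)
    show "x t \<in> phase_space" using solutionD(1)[OF sol y(2)] x[OF y] by simp
    have "(x has_vector_derivative hamiltonian_vf H (y t)) (at t)"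
      by (rule has_vector_derivative_transform_within_open[OF solutionD(2)[OF sol y(2)] open_einterval y(2)])
        (simp add: x[OF y(1)])
    then show "(x has_vector_derivative hamiltonian_vf H (x t)) (at t)" using x[OF y] by simp
  qed
  moreover have "a' = a \<and> b' = b"
    if "a' \<le> a" "b \<le> b'" "solution H a' b' y" "\<forall>t\<in>einterval a b. y t = x t" for a' b' y
  proof -
    have "(a', b', y) \<in> \<S>"
      using that zero x0 by (auto simp: \<S>_def einterval_def intro: le_less_trans less_le_trans)
    from ab[OF this] show ?thesis using that by auto
  qed
  ultimately have "maximal_solution H a b x" unfolding maximal_solution_def by blast
  then have "flow_line a b x"
    unfolding flow_line_def using zero x0 ab x by (auto simp: \<S>_def)
  then show thesis using that x0 by blast
qed

lemma flow_line_solution: "flow_line a b x \<Longrightarrow> solution H a b x"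
  by (simp add: flow_line_def maximal_solution_def)

text \<open>
  If the orbit stayed in \<open>K\<close>, the globally defined solution of the extended field would agree with it
  up to time \<open>b\<close> and continue it past \<open>b\<close>.
\<close>

theorem flow_line_leaves_compact:
  assumes x: "flow_line a (ereal b) x" and t0: "t0 \<in> einterval a (ereal b)"
    and K: "compact K" "K \<subseteq> phase_space" and stay: "\<And>t. t0 \<le> t \<Longrightarrow> t < b \<Longrightarrow> x t \<in> K"
  shows False
proof -
  note sol = flow_line_solution[OF x]
  have "t0 < b" using t0 by (simp add: einterval_def)
  obtain c d e where e: "e > 0" and Kc: "K \<subseteq> cbox c d"
    and ph: "cbox (c - e *\<^sub>R One) (d + e *\<^sub>R One) \<subseteq> phase_space" (is "?C \<subseteq> _")
    by (rule compact_in_phase_space_box[OF K])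
  let ?B = "box (c - e *\<^sub>R One) (d + e *\<^sub>R One)"
  have CB: "p \<in> ?B" "p \<in> ?C" if "p \<in> cbox c d" for p
    using near_cbox_in_box[OF that, of p e] e subsetD[OF box_subset_cbox] by simp_all
  have xK: "x t \<in> cbox c d" if "t0 \<le> t" "t < b" for t using stay Kc that by blast
  then have "?C \<noteq> {}" using CB(2)[of "x t0"] \<open>t0 < b\<close> by auto
  from lipschitz_extension_from_box[OF ph this] obtain L F where
    F: "L-lipschitz_on UNIV F" "\<And>p. p \<in> ?C \<Longrightarrow> F p = hamiltonian_vf H p" by blast
  obtain y where y: "y t0 = x t0" "\<And>t. (y has_vector_derivative F (y t)) (at t)"
    using lipschitz_ode_global_solution[OF F(1), of t0 "x t0"] by blast
  have ein: "t \<in> einterval a (ereal b)" if "t0 \<le> t" "t < b" for t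
    using t0 that by (auto simp: einterval_def intro: less_le_trans)
  have xy: "x t = y t" if "t0 \<le> t" "t < b" for t
  proof (rule lipschitz_ode_unique[OF F(1)])
    fix r assume "r \<in> closed_segment t0 t"
    then have r: "t0 \<le> r" "r < b" using that by (auto simp: closed_segment_eq_real_ivl)
    show "(x has_vector_derivative F (x r)) (at r)"
      using solutionD(2)[OF sol ein[OF r]] F(2)[OF CB(2)[OF xK[OF r]]] by simp
  qed (use y in auto)
  have conty: "continuous_on UNIV y"
    using y(2) by (meson continuous_at_imp_continuous_on has_vector_derivative_continuous)
  have "y b \<in> cbox c d"
  proof (rule Lim_in_closed_set[OF closed_cbox])
    show "(y \<longlongrightarrow> y b) (at_left b)"
      using conty by (simp add: continuous_on_eq_continuous_at continuous_at filterlim_at_split)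
    show "\<forall>\<^sub>F t in at_left b. y t \<in> cbox c d"
      using eventually_at_left_real[OF \<open>t0 < b\<close>]
      by eventually_elim (use xy xK in \<open>force dest: less_imp_le\<close>)
  qed simp
  then have "y b \<in> ?B" by (rule CB(1))
  moreover have "open (y -` ?B)" using conty by (rule open_vimage[OF open_box])
  ultimately have "\<exists>\<tau>>0. \<forall>t. \<bar>t - b\<bar> < \<tau> \<longrightarrow> y t \<in> ?B"
    unfolding open_dist dist_real_def by blast
  then obtain \<tau> where \<tau>: "\<tau> > 0" "\<And>t. \<bar>t - b\<bar> < \<tau> \<Longrightarrow> y t \<in> ?B" by blast
  define w where "w = (\<lambda>t. if t < b then x t else y t)"
  have wsol: "solution H a (ereal (b + \<tau>)) w"
    unfolding solution_def
  proof (intro conjI ballI)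
    show "a < ereal (b + \<tau>)" using t0 \<tau>(1) by (auto simp: einterval_def intro: less_trans)
    fix t assume t: "t \<in> einterval a (ereal (b + \<tau>))"
    have "w t \<in> phase_space \<and> (w has_vector_derivative hamiltonian_vf H (w t)) (at t)"
    proof (cases "t < b")
      case True
      then have t': "t \<in> einterval a (ereal b)" using t by (simp add: einterval_def)
      have "(w has_vector_derivative hamiltonian_vf H (x t)) (at t)"
        by (rule has_vector_derivative_transform_within_open[OF solutionD(2)[OF sol t'], of "{..<b}"])
          (use True in \<open>auto simp: w_def\<close>)
      then show ?thesis using True solutionD(1)[OF sol t'] by (simp add: w_def)
    next
      case False
      then have "\<bar>t - b\<bar> < \<tau>" using t by (auto simp: einterval_def)
      then have C: "y t \<in> ?C" by (intro subsetD[OF box_subset_cbox] \<tau>(2))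
      have "(w has_vector_derivative F (y t)) (at t)"
        by (rule has_vector_derivative_transform_within_open[OF y(2), of "{t0<..}"])
          (use False \<open>t0 < b\<close> xy in \<open>auto simp: w_def\<close>)
      then show ?thesis using False F(2)[OF C] subsetD[OF ph C] by (simp add: w_def)
    qed
    then show "w t \<in> phase_space" "(w has_vector_derivative hamiltonian_vf H (w t)) (at t)" by auto
  qed
  have zero: "0 \<in> einterval a (ereal b)" using x by (simp add: flow_line_def)
  then have "w 0 = x 0" by (simp add: w_def einterval_def)
  moreover have "0 \<in> einterval a (ereal (b + \<tau>))"
    using zero \<tau>(1) by (auto simp: einterval_def)
  ultimately have "ereal (b + \<tau>) \<le> ereal b" using x wsol unfolding flow_line_def by blast
  then show False using \<tau>(1) by simp
qed

text \<open>
  An orbit that starts close to \<open>x 0\<close> is followed with the extended field, where Gronwall's estimate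
  keeps it near \<open>x\<close> up to time \<open>t1\<close>.  It thus never leaves the box, so it is an orbit of the original
  system; in particular its maximal interval contains \<open>t1\<close>.
\<close>

theorem continuous_dependence:
  assumes sol: "solution H a b x" and z: "0 \<in> einterval a b" and t1: "t1 \<in> einterval a b" "0 \<le> t1"
    and V: "open V" "x t1 \<in> V"
  obtains \<delta> where "\<delta> > 0" "\<And>a' b' y. flow_line a' b' y \<Longrightarrow> dist (x 0) (y 0) < \<delta> \<Longrightarrow>
    t1 \<in> einterval a' b' \<and> y t1 \<in> V"
proof -
  have seg: "closed_segment 0 t1 = {0..t1}" using t1(2) by (simp add: closed_segment_eq_real_ivl)
  obtain c d e where e: "e > 0" and K: "x ` {0..t1} \<subseteq> cbox c d"
    and ph: "cbox (c - e *\<^sub>R One) (d + e *\<^sub>R One) \<subseteq> phase_space" (is "?C \<subseteq> _")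
    by (rule compact_in_phase_space_box[OF solution_compact_image[OF sol z t1(1)]]) (simp add: seg)
  let ?B = "box (c - e *\<^sub>R One) (d + e *\<^sub>R One)"
  have xC: "x t \<in> ?C" if "t \<in> {0..t1}" for t
    using near_cbox_in_box[of "x t" c d "x t" e] subsetD[OF K imageI[OF that]] e
      subsetD[OF box_subset_cbox] by simp
  then have "?C \<noteq> {}" using t1(2) by force
  from lipschitz_extension_from_box[OF ph this] obtain L F where
    F: "L-lipschitz_on UNIV F" "\<And>p. p \<in> ?C \<Longrightarrow> F p = hamiltonian_vf H p" by blast
  have L: "0 \<le> L" using F(1) by (rule lipschitz_on_nonneg)
  obtain \<epsilon> where \<epsilon>: "\<epsilon> > 0" "\<And>p. dist (x t1) p < \<epsilon> \<Longrightarrow> p \<in> V"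
    using bspec[OF V(1)[unfolded open_dist] V(2)] by (auto simp only: dist_commute)
  define \<delta> where "\<delta> = min e \<epsilon> * exp (- L * t1)"
  have \<delta>: "\<delta> > 0" using e \<epsilon> by (simp add: \<delta>_def)
  have "t1 \<in> einterval a' b' \<and> y t1 \<in> V"
    if y: "flow_line a' b' y" and close: "dist (x 0) (y 0) < \<delta>" for a' b' y
  proof -
    obtain w where w: "w 0 = y 0" "\<And>t. (w has_vector_derivative F (w t)) (at t)"
      using lipschitz_ode_global_solution[OF F(1), of 0 "y 0"] by blast
    have near: "dist (x t) (w t) < min e \<epsilon>" if t: "t \<in> {0..t1}" for t
    proof -
      have ein: "r \<in> einterval a b" if "r \<in> {0..t}" for r
        using einterval_segment[OF z t1(1)] seg that t by auto
      have "dist (x t) (w t) \<le> dist (x 0) (w 0) * exp (L * (t - 0))"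
      proof (rule lipschitz_ode_dist_forward[OF F(1)])
        fix r assume r: "r \<in> {0..t}"
        show "(x has_vector_derivative F (x r)) (at r)"
          using solutionD(2)[OF sol ein[OF r]] F(2)[OF xC] r t by simp
      qed (use t w in auto)
      also have "\<dots> \<le> dist (x 0) (w 0) * exp (L * t1)"
        using t L by (intro mult_left_mono) (auto intro: mult_left_mono)
      also have "\<dots> < \<delta> * exp (L * t1)" using close w(1) by simp
      also have "\<dots> = min e \<epsilon>" by (simp add: \<delta>_def mult.assoc exp_add[symmetric])
      finally show ?thesis .
    qed
    have wB: "w t \<in> ?B" if "t \<in> {0..t1}" for t
      using near_cbox_in_box[of "x t" c d "w t" e] subsetD[OF K imageI[OF that]] near[OF that] by simp
    have "continuous_on UNIV w"
      using w(2) by (meson continuous_at_imp_continuous_on has_vector_derivative_continuous)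
    then have op: "open (w -` ?B)" by (rule open_vimage[OF open_box])
    have "\<exists>\<tau>>0. \<forall>t. \<bar>t - r\<bar> < \<tau> \<longrightarrow> w t \<in> ?B" if "r \<in> {0..t1}" for r
      using op wB[OF that] unfolding open_dist dist_real_def by blast
    from this[of 0] this[of t1] t1(2) obtain \<tau>0 \<tau>1 where
      \<tau>: "\<tau>0 > 0" "\<And>t. \<bar>t\<bar> < \<tau>0 \<Longrightarrow> w t \<in> ?B" "\<tau>1 > 0" "\<And>t. \<bar>t - t1\<bar> < \<tau>1 \<Longrightarrow> w t \<in> ?B"
      by auto
    have "solution H (ereal (- \<tau>0)) (ereal (t1 + \<tau>1)) w"
      unfolding solution_def
    proof (intro conjI ballI)
      show "ereal (- \<tau>0) < ereal (t1 + \<tau>1)" using \<tau>(1,3) t1(2) by simp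
      fix t assume "t \<in> einterval (ereal (- \<tau>0)) (ereal (t1 + \<tau>1))"
      then have "- \<tau>0 < t" "t < t1 + \<tau>1" by (auto simp: einterval_def)
      then consider "\<bar>t\<bar> < \<tau>0" | "t \<in> {0..t1}" | "\<bar>t - t1\<bar> < \<tau>1" by fastforce
      then have "w t \<in> ?B" by cases (use \<tau> wB in auto)
      then have C: "w t \<in> ?C" by (rule subsetD[OF box_subset_cbox])
      show "w t \<in> phase_space" by (rule subsetD[OF ph C])
      show "(w has_vector_derivative hamiltonian_vf H (w t)) (at t)"
        using w(2)[of t] by (simp only: F(2)[OF C])
    qed
    moreover have "0 \<in> einterval (ereal (- \<tau>0)) (ereal (t1 + \<tau>1))"
      using \<tau>(1,3) t1(2) by (simp add: einterval_def zero_ereal_def)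
    ultimately have *: "a' \<le> ereal (- \<tau>0)" "ereal (t1 + \<tau>1) \<le> b'"
      "\<And>t. t \<in> einterval (ereal (- \<tau>0)) (ereal (t1 + \<tau>1)) \<Longrightarrow> w t = y t"
      using y w(1) unfolding flow_line_def by blast+
    have "t1 \<in> einterval (ereal (- \<tau>0)) (ereal (t1 + \<tau>1))"
      using \<tau>(1,3) t1(2) by (simp add: einterval_def)
    moreover from this have "t1 \<in> einterval a' b'"
      using *(1,2) unfolding einterval_def by (auto intro: le_less_trans less_le_trans simp del: less_ereal.simps)
    moreover have "w t1 \<in> V" using near[of t1] t1(2) \<epsilon>(2) by auto
    ultimately show ?thesis using *(3)[of t1] by simp
  qed
  then show thesis using that \<delta> by blast
qed

end


section \<open>The vector field of the isosceles problem\<close>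

text \<open>
  Boundedness is carried along because only bounded Lipschitz functions are closed under products.
\<close>

definition lip_bdd_on :: "'a::metric_space set \<Rightarrow> ('a \<Rightarrow> real) \<Rightarrow> bool" where
  "lip_bdd_on S f \<longleftrightarrow> (\<exists>L. L-lipschitz_on S f) \<and> bounded (f ` S)"

lemma lip_bdd_on_const: "lip_bdd_on S (\<lambda>x. c)"
  unfolding lip_bdd_on_def by (auto intro: lipschitz_on_constant simp: image_constant_conv)

lemma lip_bdd_on_add:
  assumes "lip_bdd_on S f" "lip_bdd_on S g"
  shows "lip_bdd_on S (\<lambda>x. f x + g x)"
  using assms unfolding lip_bdd_on_def
  by (auto intro: lipschitz_on_add bounded_plus_comp)

lemma lip_bdd_on_uminus:
  assumes "lip_bdd_on S f" shows "lip_bdd_on S (\<lambda>x. - f x)"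
  using assms unfolding lip_bdd_on_def
  by (auto simp: bounded_minus_comp)

lemma lip_bdd_on_diff:
  assumes "lip_bdd_on S f" "lip_bdd_on S g"
  shows "lip_bdd_on S (\<lambda>x. f x - g x)"
  using lip_bdd_on_add[OF assms(1) lip_bdd_on_uminus[OF assms(2)]] by simp

lemma lip_bdd_on_mult:
  assumes "lip_bdd_on S f" "lip_bdd_on S g"
  shows "lip_bdd_on S (\<lambda>x. f x * g x)"
proof -
  obtain K where K: "K-lipschitz_on S f" using assms(1) unfolding lip_bdd_on_def by blast
  obtain L where L: "L-lipschitz_on S g" using assms(2) unfolding lip_bdd_on_def by blast
  obtain a where a: "a > 0" "\<And>x. x \<in> S \<Longrightarrow> \<bar>f x\<bar> \<le> a"
    using assms(1) unfolding lip_bdd_on_def bounded_pos by auto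
  obtain b where b: "b > 0" "\<And>x. x \<in> S \<Longrightarrow> \<bar>g x\<bar> \<le> b"
    using assms(2) unfolding lip_bdd_on_def bounded_pos by auto
  have "(a * L + K * b)-lipschitz_on S (\<lambda>x. f x * g x)"
  proof (rule lipschitz_onI)
    fix x y assume xy: "x \<in> S" "y \<in> S"
    have "f x * g x - f y * g y = f x * (g x - g y) + (f x - f y) * g y" by (simp add: algebra_simps)
    then have "\<bar>f x * g x - f y * g y\<bar> \<le> \<bar>f x\<bar> * \<bar>g x - g y\<bar> + \<bar>f x - f y\<bar> * \<bar>g y\<bar>"
      by (metis abs_mult abs_triangle_ineq)
    also have "\<dots> \<le> a * (L * dist x y) + (K * dist x y) * b"
      using a(2)[OF xy(1)] b(2)[OF xy(2)] lipschitz_onD[OF K xy] lipschitz_onD[OF L xy] a(1)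
        lipschitz_on_nonneg[OF K]
      by (intro add_mono mult_mono) (auto simp: dist_real_def)
    finally show "dist (f x * g x) (f y * g y) \<le> (a * L + K * b) * dist x y"
      by (simp add: dist_real_def algebra_simps)
  qed (use a(1) b(1) lipschitz_on_nonneg[OF K] lipschitz_on_nonneg[OF L] in simp)
  moreover have "bounded ((\<lambda>x. f x * g x) ` S)"
    unfolding bounded_iff using a b
    by (intro exI[of _ "a * b"]) (auto simp: abs_mult intro!: mult_mono)
  ultimately show ?thesis unfolding lip_bdd_on_def by blast
qed

lemma lip_bdd_on_power: "lip_bdd_on S f \<Longrightarrow> lip_bdd_on S (\<lambda>x. f x ^ n)"
  by (induction n) (auto intro: lip_bdd_on_const lip_bdd_on_mult)

lemma lip_bdd_on_inverse:
  assumes f: "lip_bdd_on S f" and r: "r > 0" "\<And>x. x \<in> S \<Longrightarrow> r \<le> f x"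
  shows "lip_bdd_on S (\<lambda>x. 1 / f x)"
proof -
  obtain K where K: "K-lipschitz_on S f" using f unfolding lip_bdd_on_def by blast
  have "(K / r\<^sup>2)-lipschitz_on S (\<lambda>x. 1 / f x)"
  proof (rule lipschitz_onI)
    fix x y assume xy: "x \<in> S" "y \<in> S"
    have pos: "0 < f x" "0 < f y" using r xy by (auto intro: less_le_trans)
    have "\<bar>1 / f x - 1 / f y\<bar> = \<bar>f x - f y\<bar> / (f x * f y)"
      using pos by (simp add: field_simps abs_mult abs_div abs_minus_commute)
    also have "\<dots> \<le> (K * dist x y) / (r * r)"
      using lipschitz_onD[OF K xy] r xy
      by (intro frac_le mult_mono) (auto simp: dist_real_def intro: order_trans[OF less_imp_le])
    finally show "dist (1 / f x) (1 / f y) \<le> K / r\<^sup>2 * dist x y"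
      by (simp add: dist_real_def power2_eq_square)
  qed (use lipschitz_on_nonneg[OF K] in simp)
  moreover have "bounded ((\<lambda>x. 1 / f x) ` S)"
    unfolding bounded_iff
  proof (intro exI ballI, safe)
    fix x assume "x \<in> S"
    then show "norm (1 / f x) \<le> 1 / r" using r(1) r(2)[of x] by (auto intro!: frac_le)
  qed
  ultimately show ?thesis unfolding lip_bdd_on_def by blast
qed

lemma lip_bdd_on_bounded_linear:
  assumes "bounded_linear f" "bounded S"
  shows "lip_bdd_on S f"
  unfolding lip_bdd_on_def
  using bounded_linear.lipschitz_boundE[OF assms(1)] bounded_linear_image[OF assms(2,1)]
  by (metis lipschitz_on_subset subset_UNIV)

lemmas lip_bdd_intros = lip_bdd_on_const lip_bdd_on_add lip_bdd_on_uminus lip_bdd_on_diff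
  lip_bdd_on_mult lip_bdd_on_power

locale isosceles =
  fixes M m A A1 B B1 C \<mu> :: real
  assumes pos: "M > 0" "m > 0" "A > 0" "A1 > 0" "B > 0" "B1 > 0"
    and mu: "\<mu> = (2 * M + m) / m"
begin

abbreviation H :: "state \<Rightarrow> real" where "H \<equiv> H_red M m A A1 B B1 C"

lemma mu_gt_1: "\<mu> > 1"
  using pos unfolding mu by (simp add: field_simps)

lemma H_red_sqrt:
  "H (R, z, PR, Pz) = 1 / M * (PR\<^sup>2 + C\<^sup>2 / R\<^sup>2) + \<mu> / (4 * M) * Pz\<^sup>2 - A / R - B / R ^ 3
     - 4 * A1 / sqrt (R\<^sup>2 + 4 * z\<^sup>2) - 16 * B1 / sqrt (R\<^sup>2 + 4 * z\<^sup>2) ^ 3"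
proof -
  have "(R\<^sup>2 + 4 * z\<^sup>2) powr (3 / 2) = sqrt (R\<^sup>2 + 4 * z\<^sup>2) ^ 3"
  proof (cases "R\<^sup>2 + 4 * z\<^sup>2 = 0")
    case False
    then have "R\<^sup>2 + 4 * z\<^sup>2 > 0" by (simp add: order_less_le)
    then show ?thesis
      by (simp add: powr_half_sqrt[symmetric] powr_powr flip: powr_realpow)
  qed simp
  moreover have "(2 * M + m) / (4 * M * m) = \<mu> / (4 * M)"
    using pos unfolding mu by (simp add: field_simps)
  ultimately show ?thesis by (simp add: powr_half_sqrt)
qed

definition iso_vf :: "state \<Rightarrow> state" where
  "iso_vf = (\<lambda>(R, z, PR, Pz). let i = 1 / R; j = 1 / sqrt (R\<^sup>2 + 4 * z\<^sup>2) in
     (2 / M * PR, \<mu> / (2 * M) * Pz,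
      2 * C\<^sup>2 / M * i ^ 3 - A * i ^ 2 - 3 * B * i ^ 4 - 4 * A1 * R * j ^ 3 - 48 * B1 * R * j ^ 5,
      - (16 * A1 * z * j ^ 3) - 192 * B1 * z * j ^ 5))"

lemma hamiltonian_vf_H_red:
  assumes "x \<in> phase_space"
  shows "hamiltonian_vf H x = iso_vf x"
proof -
  obtain R z PR Pz where x: "x = (R, z, PR, Pz)" by (cases x)
  have R: "R > 0" using assms by (simp add: x phase_space_def)
  define \<rho> where "\<rho> = sqrt (R\<^sup>2 + 4 * z\<^sup>2)"
  have N: "R\<^sup>2 + 4 * z\<^sup>2 > 0" using R by (simp add: add_pos_nonneg)
  then have \<rho>: "\<rho> > 0" by (simp add: \<rho>_def)
  define sq sz where "sq = (\<lambda>q. sqrt (q\<^sup>2 + 4 * z\<^sup>2))" and "sz = (\<lambda>q. sqrt (R\<^sup>2 + 4 * q\<^sup>2))"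
  have dq: "(sq has_real_derivative R / \<rho>) (at R)" and sq: "sq R = \<rho>"
    unfolding sq_def using N by (auto intro!: derivative_eq_intros simp: \<rho>_def field_simps)
  have dz: "(sz has_real_derivative 4 * z / \<rho>) (at z)" and sz: "sz z = \<rho>"
    unfolding sz_def using N by (auto intro!: derivative_eq_intros simp: \<rho>_def field_simps)
  have "((\<lambda>p. H (R, z, p, Pz)) has_real_derivative 2 / M * PR) (at PR)"
    unfolding H_red_sqrt using pos(1) by (auto intro!: derivative_eq_intros)
  moreover have "((\<lambda>p. H (R, z, PR, p)) has_real_derivative \<mu> / (2 * M) * Pz) (at Pz)"
    unfolding H_red_sqrt using pos(1) by (auto intro!: derivative_eq_intros)
  moreover have "((\<lambda>q. H (q, z, PR, Pz)) has_real_derivative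
      - (2 * C\<^sup>2 / M / R ^ 3) + A / R ^ 2 + 3 * B / R ^ 4 + 4 * A1 * R / \<rho> ^ 3 + 48 * B1 * R / \<rho> ^ 5) (at R)"
    unfolding H_red_sqrt sq_def[symmetric, THEN fun_cong]
    using R \<rho> pos(1) by (auto intro!: derivative_eq_intros dq simp: sq) (simp add: field_simps numeral_eq_Suc)
  moreover have "((\<lambda>q. H (R, q, PR, Pz)) has_real_derivative
      16 * A1 * z / \<rho> ^ 3 + 192 * B1 * z / \<rho> ^ 5) (at z)"
    unfolding H_red_sqrt sz_def[symmetric, THEN fun_cong]
    using R \<rho> pos(1) by (auto intro!: derivative_eq_intros dz simp: sz) (simp add: field_simps numeral_eq_Suc)
  ultimately show ?thesis
    by (simp add: x iso_vf_def Let_def \<rho>_def[symmetric] DERIV_imp_deriv power_one_over)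
qed

text \<open>
  The components are polynomials in the coordinates, \<open>1 / R\<close> and \<open>1 / \<rho>\<close> with \<open>\<rho> = \<bar>(R, 2 z)\<bar>\<close>.  As a
  norm, \<open>\<rho>\<close> is Lipschitz, and both \<open>R\<close> and \<open>\<rho>\<close> are bounded below on the box.
\<close>

lemma iso_vf_lipschitz:
  assumes "cbox c d \<subseteq> phase_space"
  shows "\<exists>L. L-lipschitz_on (cbox c d) iso_vf"
proof -
  let ?S = "cbox c d"
  have bl: "bounded_linear (\<lambda>x :: state. fst x)" "bounded_linear (\<lambda>x :: state. fst (snd x))"
    "bounded_linear (\<lambda>x :: state. fst (snd (snd x)))" "bounded_linear (\<lambda>x :: state. snd (snd (snd x)))"
    by (intro bounded_linear_fst bounded_linear_snd bounded_linear_fst_comp bounded_linear_snd_comp)+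
  note lin = bl[THEN lip_bdd_on_bounded_linear[OF _ bounded_cbox[of c d]]]
  obtain r where r: "r > 0" "\<And>x. x \<in> ?S \<Longrightarrow> r \<le> fst x"
  proof (cases "?S = {}")
    case False
    then obtain x where "x \<in> ?S" "\<And>y. y \<in> ?S \<Longrightarrow> fst x \<le> fst y"
      using continuous_attains_inf[OF compact_cbox False continuous_on_fst[OF continuous_on_id]] by blast
    moreover have "fst x > 0" using assms \<open>x \<in> ?S\<close> by (cases x) (auto simp: phase_space_def)
    ultimately show ?thesis using that by blast
  qed (use that[of 1] in auto)
  define \<rho> where "\<rho> = (\<lambda>x :: state. sqrt ((fst x)\<^sup>2 + 4 * (fst (snd x))\<^sup>2))"
  have \<rho>_norm: "\<rho> x = norm (fst x, 2 * fst (snd x))" for x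
    by (simp add: \<rho>_def norm_Pair power_mult_distrib)
  have "bounded_linear (\<lambda>x :: state. (fst x, 2 * fst (snd x)))"
    by (intro bounded_linear_Pair bl bounded_linear_const_mult)
  then obtain K where K: "K-lipschitz_on UNIV (\<lambda>x :: state. (fst x, 2 * fst (snd x)))"
    using bounded_linear.lipschitz_boundE by blast
  have "K-lipschitz_on ?S \<rho>"
  proof (rule lipschitz_onI)
    fix x y :: state
    have "dist (\<rho> x) (\<rho> y) \<le> dist (fst x, 2 * fst (snd x)) (fst y, 2 * fst (snd y))"
      unfolding \<rho>_norm dist_real_def dist_norm by (rule norm_triangle_ineq3)
    also have "\<dots> \<le> K * dist x y" by (rule lipschitz_onD[OF K]) auto
    finally show "dist (\<rho> x) (\<rho> y) \<le> K * dist x y" .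
  qed (rule lipschitz_on_nonneg[OF K])
  moreover from this have "bounded (\<rho> ` ?S)"
    by (intro compact_imp_bounded compact_continuous_image lipschitz_on_continuous_on) auto
  ultimately have \<rho>: "lip_bdd_on ?S \<rho>" unfolding lip_bdd_on_def by blast
  have \<rho>r: "r \<le> \<rho> x" if "x \<in> ?S" for x
    unfolding \<rho>_def using r(2)[OF that] r(1) by (intro real_le_rsqrt) (simp add: add_increasing2 power_mono)
  have j: "lip_bdd_on ?S (\<lambda>x. 1 / \<rho> x)" by (rule lip_bdd_on_inverse[OF \<rho> r(1) \<rho>r])
  have i: "lip_bdd_on ?S (\<lambda>x. 1 / fst x)" by (rule lip_bdd_on_inverse[OF lin(1) r])
  define f1 f2 f3 f4 where "f1 = (\<lambda>x :: state. 2 / M * fst (snd (snd x)))"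
    and "f2 = (\<lambda>x :: state. \<mu> / (2 * M) * snd (snd (snd x)))"
    and "f3 = (\<lambda>x :: state. 2 * C\<^sup>2 / M * (1 / fst x) ^ 3 - A * (1 / fst x) ^ 2 - 3 * B * (1 / fst x) ^ 4
        - 4 * A1 * fst x * (1 / \<rho> x) ^ 3 - 48 * B1 * fst x * (1 / \<rho> x) ^ 5)"
    and "f4 = (\<lambda>x :: state. - (16 * A1 * fst (snd x) * (1 / \<rho> x) ^ 3) - 192 * B1 * fst (snd x) * (1 / \<rho> x) ^ 5)"
  have "lip_bdd_on ?S f1" "lip_bdd_on ?S f2" "lip_bdd_on ?S f3" "lip_bdd_on ?S f4"
    unfolding f1_def f2_def f3_def f4_def by (intro lip_bdd_intros lin i j)+
  then obtain L1 L2 L3 L4 where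
    L: "L1-lipschitz_on ?S f1" "L2-lipschitz_on ?S f2" "L3-lipschitz_on ?S f3" "L4-lipschitz_on ?S f4"
    unfolding lip_bdd_on_def by blast
  have "\<exists>L. L-lipschitz_on ?S (\<lambda>x. (f1 x, f2 x, f3 x, f4 x))"
    by (rule exI lipschitz_on_Pair[OF L(1) lipschitz_on_Pair[OF L(2) lipschitz_on_Pair[OF L(3,4)]]])+
  moreover have "iso_vf = (\<lambda>x. (f1 x, f2 x, f3 x, f4 x))"
    by (auto simp: iso_vf_def f1_def f2_def f3_def f4_def \<rho>_def Let_def)
  ultimately show ?thesis by simp
qed

end

sublocale isosceles \<subseteq> lipschitz_hamiltonian H
proof
  fix c d assume ph: "cbox c d \<subseteq> phase_space"
  from iso_vf_lipschitz[OF this] obtain L where "L-lipschitz_on (cbox c d) iso_vf" ..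
  then have "L-lipschitz_on (cbox c d) (hamiltonian_vf H)"
    using hamiltonian_vf_H_red subsetD[OF ph] by (subst lipschitz_on_cong) auto
  then show "\<exists>L. L-lipschitz_on (cbox c d) (hamiltonian_vf H)" ..
qed


section \<open>Shape dynamics and homographic configurations\<close>

lemma ereal_interval_derivative_zero:
  assumes "(f has_real_derivative D) (at t)" "t \<in> einterval a b" "\<And>s. s \<in> einterval a b \<Longrightarrow> f s = c"
  shows "D = 0"
proof -
  have "((\<lambda>_. c) has_real_derivative D) (at t)"
    by (rule DERIV_cong[OF has_field_derivative_transform_within_open[OF assms(1) open_einterval assms(2)]])
      (use assms(3) in auto)
  then show ?thesis using DERIV_unique[OF _ DERIV_const] by blast
qed

context isosceles
begin

definition velR :: "state \<Rightarrow> real" where "velR x = 2 / M * fst (snd (snd x))"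
definition velz :: "state \<Rightarrow> real" where "velz x = \<mu> / (2 * M) * snd (snd (snd x))"
definition shape :: "state \<Rightarrow> real" where "shape x = pos_z x / pos_R x"
text \<open>Twice the areal velocity of \<open>(R, z)\<close>, which equals \<open>R\<^sup>2 u'\<close> for the shape \<open>u\<close>.\<close>

definition areal_rate :: "state \<Rightarrow> real" where "areal_rate x = pos_R x * velz x - pos_z x * velR x"

text \<open>
  The distance between \<open>m\<close> and an equal mass is \<open>R stretch u / 2\<close>.  The next two functions are the
  radial force and the stiffness of the shape with their dominant powers of \<open>R\<close> removed:
  \<open>R'' = - pull R u / R\<^sup>4\<close> and \<open>(R\<^sup>2 u')' = - u stiff R u / R\<^sup>3\<close>, so that both have positive limits at
  the planar collision.
\<close>

definition stretch :: "real \<Rightarrow> real" where "stretch u = sqrt (1 + 4 * u\<^sup>2)"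

definition pull :: "real \<Rightarrow> real \<Rightarrow> real" where
  "pull R u = 2 / M * (A * R\<^sup>2 + 3 * B + 4 * A1 * R\<^sup>2 / stretch u ^ 3 + 48 * B1 / stretch u ^ 5)
     - 4 * C\<^sup>2 / M\<^sup>2 * R"

definition stiff :: "real \<Rightarrow> real \<Rightarrow> real" where
  "stiff R u = 6 / M * (16 * B1 * (\<mu> - 1) / stretch u ^ 5 - B)
     + 2 / M * (4 * A1 * (\<mu> - 1) / stretch u ^ 3 - A) * R\<^sup>2 + 4 * C\<^sup>2 / M\<^sup>2 * R"

lemma stretch_ge_1: "stretch u \<ge> 1"
  by (simp add: stretch_def)

lemma reduced_equations:
  assumes sol: "solution H a b x" and t: "t \<in> einterval a b"
  defines "R \<equiv> pos_R (x t)" and "z \<equiv> pos_z (x t)" and "u \<equiv> shape (x t)"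
  shows "R > 0"
    and "((\<lambda>t. pos_R (x t)) has_real_derivative velR (x t)) (at t)"
    and "((\<lambda>t. velR (x t)) has_real_derivative - pull R u / R ^ 4) (at t)"
    and "((\<lambda>t. shape (x t)) has_real_derivative areal_rate (x t) / R\<^sup>2) (at t)"
    and "((\<lambda>t. areal_rate (x t)) has_real_derivative - u * stiff R u / R ^ 3) (at t)"
    and "((\<lambda>t. velz (x t)) has_real_derivative
      - z * (\<mu> / (2 * M) * (16 * A1 / (R * stretch u) ^ 3 + 192 * B1 / (R * stretch u) ^ 5))) (at t)"
proof -
  have ph: "x t \<in> phase_space" and d: "(x has_vector_derivative iso_vf (x t)) (at t)"
    using solutionD(1,2)[OF sol t] hamiltonian_vf_H_red by auto
  obtain PR Pz where x: "x t = (R, z, PR, Pz)" unfolding R_def z_def by (cases "x t") auto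
  show R: "R > 0" using ph by (simp add: x phase_space_def)
  define s where "s = stretch u"
  have s: "s \<ge> 1" unfolding s_def by (rule stretch_ge_1)
  have u: "z = u * R" using R by (simp add: u_def shape_def R_def[symmetric] z_def[symmetric])
  have "sqrt (R\<^sup>2 + 4 * z\<^sup>2) = sqrt (R\<^sup>2 * (1 + 4 * u\<^sup>2))"
    by (simp add: u power_mult_distrib algebra_simps)
  also have "\<dots> = R * s" using R by (simp add: real_sqrt_mult s_def stretch_def)
  finally have sq: "sqrt (R\<^sup>2 + 4 * z\<^sup>2) = R * s" .
  define F3 where "F3 = 2 * C\<^sup>2 / M * (1 / R) ^ 3 - A * (1 / R) ^ 2 - 3 * B * (1 / R) ^ 4
      - 4 * A1 * R * (1 / (R * s)) ^ 3 - 48 * B1 * R * (1 / (R * s)) ^ 5"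
  define F4 where "F4 = - (16 * A1 * z * (1 / (R * s)) ^ 3) - 192 * B1 * z * (1 / (R * s)) ^ 5"
  have vf: "iso_vf (x t) = (velR (x t), velz (x t), F3, F4)"
    unfolding x iso_vf_def velR_def velz_def Let_def prod.case sq F3_def F4_def by simp
  have bl: "bounded_linear (\<lambda>x :: state. fst x)" "bounded_linear (\<lambda>x :: state. fst (snd x))"
    "bounded_linear (\<lambda>x :: state. fst (snd (snd x)))" "bounded_linear (\<lambda>x :: state. snd (snd (snd x)))"
    by (intro bounded_linear_fst bounded_linear_snd bounded_linear_fst_comp bounded_linear_snd_comp)+
  have pos_fst: "pos_R p = fst p" "pos_z p = fst (snd p)" for p by (cases p; simp)+
  note comp = bl[THEN bounded_linear.has_vector_derivative, OF d, unfolded vf]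
  have dR: "((\<lambda>t. pos_R (x t)) has_real_derivative velR (x t)) (at t)"
    and dz: "((\<lambda>t. pos_z (x t)) has_real_derivative velz (x t)) (at t)"
    and dP: "((\<lambda>t. fst (snd (snd (x t)))) has_real_derivative F3) (at t)"
    and dQ: "((\<lambda>t. snd (snd (snd (x t)))) has_real_derivative F4) (at t)"
    using comp by (simp_all add: has_real_derivative_iff_has_vector_derivative pos_fst)
  show "((\<lambda>t. pos_R (x t)) has_real_derivative velR (x t)) (at t)" by (rule dR)
  have e3: "2 / M * F3 = - pull R u / R ^ 4"
    using R s pos(1) unfolding F3_def pull_def s_def[symmetric]
    by (simp add: field_simps numeral_eq_Suc)
  show dV: "((\<lambda>t. velR (x t)) has_real_derivative - pull R u / R ^ 4) (at t)"
    unfolding velR_def e3[symmetric] by (rule DERIV_cmult[OF dP])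
  have e4: "\<mu> / (2 * M) * F4 = - z * (\<mu> / (2 * M) * (16 * A1 / (R * s) ^ 3 + 192 * B1 / (R * s) ^ 5))"
    unfolding F4_def by (simp add: power_one_over algebra_simps)
  show dW: "((\<lambda>t. velz (x t)) has_real_derivative
      - z * (\<mu> / (2 * M) * (16 * A1 / (R * stretch u) ^ 3 + 192 * B1 / (R * stretch u) ^ 5))) (at t)"
    unfolding velz_def s_def[symmetric] e4[symmetric] by (rule DERIV_cmult[OF dQ])
  show "((\<lambda>t. shape (x t)) has_real_derivative areal_rate (x t) / R\<^sup>2) (at t)"
    unfolding shape_def
    by (rule DERIV_cong[OF DERIV_divide[OF dz dR]])
      (use R in \<open>auto simp: areal_rate_def R_def z_def power2_eq_square mult.commute\<close>)
  have "((\<lambda>t. areal_rate (x t)) has_real_derivative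
      (velR (x t) * velz (x t) + \<mu> / (2 * M) * F4 * pos_R (x t))
      - (velz (x t) * velR (x t) + - pull R u / R ^ 4 * pos_z (x t))) (at t)"
    unfolding areal_rate_def by (intro DERIV_diff DERIV_mult dR dz dV dW[folded s_def, folded e4])
  moreover have "(velR (x t) * velz (x t) + \<mu> / (2 * M) * F4 * R)
      - (velz (x t) * velR (x t) + - pull R u / R ^ 4 * z) = - u * stiff R u / R ^ 3"
  proof -
    have "\<mu> / (2 * M) * F4 * R + pull R u / R ^ 4 * z = - u * stiff R u / R ^ 3"
      using R s pos(1) unfolding F4_def pull_def stiff_def s_def[symmetric] u
      by (simp add: field_simps numeral_eq_Suc)
    then show ?thesis by simp
  qed
  ultimately show "((\<lambda>t. areal_rate (x t)) has_real_derivative - u * stiff R u / R ^ 3) (at t)"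
    by (simp add: R_def z_def)
qed

text \<open>
  Reflection in the horizontal plane maps solutions to solutions and fixes a state at rest in the
  plane, so by uniqueness the orbit of that state stays in the plane.
\<close>

lemma planar_homographic_configuration: "homographic_configuration M m A A1 B B1 C 0"
proof -
  define reflect :: "state \<Rightarrow> state" where "reflect = (\<lambda>(R, z, PR, Pz). (R, - z, PR, - Pz))"
  have bl: "bounded_linear reflect"
  proof -
    have "reflect = (\<lambda>x. (fst x, - fst (snd x), fst (snd (snd x)), - snd (snd (snd x))))"
      by (auto simp: reflect_def)
    then show ?thesis
      by (simp only:) (intro bounded_linear_Pair bounded_linear_minus bounded_linear_fst
          bounded_linear_fst_comp bounded_linear_snd_comp bounded_linear_snd)
  qed
  have vf: "iso_vf (reflect p) = reflect (iso_vf p)" for p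
    by (cases p) (simp add: reflect_def iso_vf_def Let_def)
  have ph: "(1, 0, 0, 0) \<in> phase_space" by (simp add: phase_space_def)
  then obtain a b x where fl: "flow_line a b x" and x0: "x 0 = (1, 0, 0, 0)"
    by (rule flow_line_exists)
  have sol: "solution H a b x" and max: "maximal_solution H a b x" and z0: "0 \<in> einterval a b"
    by (rule flow_line_solution[OF fl], (rule fl[unfolded flow_line_def, THEN conjunct1] fl[unfolded flow_line_def, THEN conjunct2, THEN conjunct1])+)
  have "solution H a b (\<lambda>t. reflect (x t))"
    unfolding solution_def
  proof (intro conjI ballI)
    show "a < b" using sol by (simp add: solution_def)
    fix t assume t: "t \<in> einterval a b"
    have xp: "x t \<in> phase_space" by (rule solutionD(1)[OF sol t])
    then show rp: "reflect (x t) \<in> phase_space"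
      by (cases "x t") (simp add: reflect_def phase_space_def)
    show "((\<lambda>t. reflect (x t)) has_vector_derivative hamiltonian_vf H (reflect (x t))) (at t)"
      using bounded_linear.has_vector_derivative[OF bl solutionD(2)[OF sol t]]
      by (simp add: hamiltonian_vf_H_red xp rp vf)
  qed
  then have "reflect (x t) = x t" if "t \<in> einterval a b" for t
    by (rule solutions_agree[OF _ sol z0 z0 that that]) (simp add: x0 reflect_def)
  then have planar: "pos_z (x t) = 0" if "t \<in> einterval a b" for t
    using that by (cases "x t") (force simp: reflect_def)
  have "a < b" using sol by (simp add: solution_def)
  have "isCont (\<lambda>t. 2 * C / (M * (pos_R (x t))\<^sup>2)) t" if "a < ereal t" "ereal t < b" for t
  proof -
    have t: "t \<in> einterval a b" using that by (simp add: einterval_def)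
    show ?thesis
      using reduced_equations(1)[OF sol t] DERIV_isCont[OF reduced_equations(2)[OF sol t]] pos(1)
      by (intro continuous_intros) auto
  qed
  then obtain \<theta> where \<theta>: "\<And>t. t \<in> einterval a b \<Longrightarrow>
      (\<theta> has_real_derivative 2 * C / (M * (pos_R (x t))\<^sup>2)) (at t)"
    using einterval_antiderivative[OF \<open>a < b\<close>, of "\<lambda>t. 2 * C / (M * (pos_R (x t))\<^sup>2)"]
    by (auto simp: einterval_def has_real_derivative_iff_has_vector_derivative)
  define r1 r2 where "r1 = (\<lambda>t. pos_R (x t) *\<^sub>R (vector [cos (\<theta> t), sin (\<theta> t), 0] :: real ^ 3))"
    and "r2 = (\<lambda>t. vector [0, 0, pos_z (x t)] :: real ^ 3)"
  have "jacobi_lift M C a b x r1 r2"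
    unfolding jacobi_lift_def using \<theta> by (intro exI[of _ \<theta>]) (simp add: r1_def r2_def)
  moreover have "homographic a b r1 r2"
    unfolding homographic_def
  proof (intro exI conjI ballI)
    let ?a1 = "vector [1, 0, 0] :: real ^ 3"
    show "?a1 $ 3 = 0" "(0 :: real ^ 3) $ 1 = 0" "(0 :: real ^ 3) $ 2 = 0" by simp_all
    show "\<not> (?a1 = 0 \<and> (0 :: real ^ 3) = 0)" by (simp add: vec_eq_iff forall_3)
    fix t assume t: "t \<in> einterval a b"
    show "pos_R (x t) \<noteq> 0" using reduced_equations(1)[OF sol t] by simp
    show "r1 t = pos_R (x t) *\<^sub>R rot_vertical (\<theta> t) ?a1"
      by (simp add: r1_def rot_vertical_def)
    show "r2 t = pos_R (x t) *\<^sub>R 0"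
      using planar[OF t] by (simp add: r2_def vec_eq_iff forall_3)
  qed
  moreover have "ereal (pos_z (x t) / pos_R (x t)) = 0" if "t \<in> einterval a b" for t
    using planar[OF that] by (simp add: zero_ereal_def)
  ultimately show ?thesis
    unfolding homographic_configuration_def using max by blast
qed

text \<open>
  With constant size and shape the mass \<open>m\<close> would be at rest off the plane, against its vertical
  attraction towards the plane.
\<close>

lemma nonplanar_homographic_size_not_constant:
  assumes sol: "solution H a b x" and sh: "\<And>t. t \<in> einterval a b \<Longrightarrow> shape (x t) = l" and "l \<noteq> 0"
  shows "\<exists>s \<in> einterval a b. \<exists>t \<in> einterval a b. pos_R (x s) < pos_R (x t)"
proof (rule ccontr)
  assume contra: "\<not> ?thesis"
  have const: "pos_R (x s) = pos_R (x t)" if "s \<in> einterval a b" "t \<in> einterval a b" for s t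
    proof -
    have "\<not> pos_R (x s) < pos_R (x t)" "\<not> pos_R (x t) < pos_R (x s)"
      using that contra by blast+
    then show ?thesis by simp
  qed
  have "a < b" using sol by (simp add: solution_def)
  then obtain t where t: "t \<in> einterval a b" using einterval_nonempty by blast
  have "velR (x s) = 0" if "s \<in> einterval a b" for s
    by (rule ereal_interval_derivative_zero[OF reduced_equations(2)[OF sol that] that]) (rule const[OF _ t])
  moreover have "areal_rate (x s) = 0" if s: "s \<in> einterval a b" for s
    using ereal_interval_derivative_zero[OF reduced_equations(4)[OF sol s] s, OF sh]
      reduced_equations(1)[OF sol s] by auto
  ultimately have "velz (x s) = 0" if s: "s \<in> einterval a b" for s
    using s reduced_equations(1)[OF sol s] by (fastforce simp: areal_rate_def)
  from ereal_interval_derivative_zero[OF reduced_equations(6)[OF sol t] t, OF this]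
  have "pos_z (x t) * (\<mu> / (2 * M) * (16 * A1 / (pos_R (x t) * stretch (shape (x t))) ^ 3 +
      192 * B1 / (pos_R (x t) * stretch (shape (x t))) ^ 5)) = 0" by simp
  moreover have "0 < \<mu> / (2 * M) * (16 * A1 / (pos_R (x t) * stretch (shape (x t))) ^ 3 +
      192 * B1 / (pos_R (x t) * stretch (shape (x t))) ^ 5)"
    using pos mu_gt_1 reduced_equations(1)[OF sol t] stretch_ge_1[of "shape (x t)"]
    by (intro mult_pos_pos add_pos_pos divide_pos_pos zero_less_power) auto
  ultimately have "pos_z (x t) = 0" by (metis less_irrefl mult_eq_0_iff)
  then show False using sh[OF t] \<open>l \<noteq> 0\<close> by (simp add: shape_def)
qed

text \<open>
  Constant shape \<open>l \<noteq> 0\<close> forces \<open>stiff R l = 0\<close> for all sizes \<open>R\<close> that occur.  This is a quadratic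
  polynomial in \<open>R\<close> with infinitely many zeros, so its coefficients vanish: \<open>\<sigma> = stretch l\<close> satisfies
  \<open>\<sigma>\<^sup>3 = 4 A1 (\<mu> - 1) / A\<close> and \<open>\<sigma>\<^sup>5 = 16 B1 (\<mu> - 1) / B\<close>.  Equating the two values of \<open>\<sigma>\<^sup>2\<close> gives the
  equality that \<open>ne\<close> excludes.
\<close>

lemma homographic_configuration_planar:
  assumes hc: "homographic_configuration M m A A1 B B1 C \<l>"
    and ne: "(\<mu> - 1) powr (4 / 15) * (4 * A1 / A) powr (2 / 3) \<noteq> (16 * B1 / B) powr (2 / 5)"
  shows "\<l> = 0"
proof -
  obtain a b x where max: "maximal_solution H a b x"
    and conf: "\<And>t. t \<in> einterval a b \<Longrightarrow> ereal (shape (x t)) = \<l>"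
    using hc unfolding homographic_configuration_def shape_def by blast
  have sol: "solution H a b x" using max by (simp add: maximal_solution_def)
  have "a < b" using sol by (simp add: solution_def)
  then obtain t0 where t0: "t0 \<in> einterval a b" using einterval_nonempty by blast
  define l where "l = shape (x t0)"
  have sh: "shape (x t) = l" if "t \<in> einterval a b" for t
    using conf[OF that] conf[OF t0] unfolding l_def by (metis ereal.inject)
  have "l = 0"
  proof (rule ccontr)
    assume "l \<noteq> 0"
    have areal_rate: "areal_rate (x s) = 0" if s: "s \<in> einterval a b" for s
      using ereal_interval_derivative_zero[OF reduced_equations(4)[OF sol s] s, OF sh]
        reduced_equations(1)[OF sol s] by auto
    have stiff: "stiff (pos_R (x s)) l = 0" if s: "s \<in> einterval a b" for s
      using ereal_interval_derivative_zero[OF reduced_equations(5)[OF sol s] s, OF areal_rate]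
        reduced_equations(1)[OF sol s] sh[OF s] \<open>l \<noteq> 0\<close> by auto
    obtain s t where st: "s \<in> einterval a b" "t \<in> einterval a b" "pos_R (x s) < pos_R (x t)"
      using nonplanar_homographic_size_not_constant[OF sol sh \<open>l \<noteq> 0\<close>] by blast
    define p q r where "p = pos_R (x s)" and "q = pos_R (x t)" and "r = (p + q) / 2"
    have "r \<in> (\<lambda>t. pos_R (x t)) ` closed_segment s t"
    proof -
      have "continuous_on (closed_segment s t) (\<lambda>t. pos_R (x t))"
        using DERIV_isCont[OF reduced_equations(2)[OF sol]] einterval_segment[OF st(1,2)]
        by (intro continuous_at_imp_continuous_on) blast
      then have "connected ((\<lambda>t. pos_R (x t)) ` closed_segment s t)"
        by (rule connected_continuous_image) simp
      moreover have "p \<le> r" "r \<le> q" using st(3) by (simp_all add: p_def q_def r_def)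
      ultimately show ?thesis
        unfolding p_def q_def by (meson connectedD_interval ends_in_segment imageI)
    qed
    then obtain t' where t': "t' \<in> closed_segment s t" "r = pos_R (x t')" by blast
    \<comment> \<open>three zeros of a quadratic suffice; the intermediate value theorem supplies the midpoint as the third\<close>
    define c0 c1 c2 where "c0 = 6 / M * (16 * B1 * (\<mu> - 1) / stretch l ^ 5 - B)"
      and "c1 = 4 * C\<^sup>2 / M\<^sup>2" and "c2 = 2 / M * (4 * A1 * (\<mu> - 1) / stretch l ^ 3 - A)"
    have quad: "c0 + c2 * y\<^sup>2 + c1 * y = 0" if "y \<in> {p, q, r}" for y
      using that stiff st t' einterval_segment[OF st(1,2) t'(1)]
      by (auto simp: stiff_def c0_def c1_def c2_def p_def q_def)
    have "p \<noteq> q" using st(3) by (simp add: p_def q_def)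
    have "(p - q) * (c1 + c2 * (p + q)) = 0" "(p - r) * (c1 + c2 * (p + r)) = 0"
      using quad[of p] quad[of q] quad[of r] by (simp_all add: algebra_simps power2_eq_square)
    then have "c1 + c2 * (p + q) = 0" "c1 + c2 * (p + r) = 0"
      using \<open>p \<noteq> q\<close> by (auto simp: r_def)
    moreover have "c2 * (q - r) = (c1 + c2 * (p + q)) - (c1 + c2 * (p + r))" by (simp add: algebra_simps)
    ultimately have "c2 * (q - r) = 0" by simp
    then have c2: "c2 = 0" using \<open>p \<noteq> q\<close> by (auto simp: r_def field_simps)
    with \<open>c1 + c2 * (p + q) = 0\<close> quad[of p] have c0: "c0 = 0" by simp
    define \<sigma> where "\<sigma> = stretch l"
    have \<sigma>: "\<sigma> \<ge> 1" unfolding \<sigma>_def by (rule stretch_ge_1)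
    have mu0: "\<mu> - 1 > 0" using mu_gt_1 by simp
    have "4 * A1 / A = \<sigma> ^ 3 / (\<mu> - 1)" "16 * B1 / B = \<sigma> ^ 5 / (\<mu> - 1)"
      using c0 c2 pos \<sigma> mu0 unfolding c0_def c2_def \<sigma>_def[symmetric]
      by (auto simp: field_simps)
    moreover have "(\<sigma> ^ 3) powr (2 / 3) = \<sigma>\<^sup>2" "(\<sigma> ^ 5) powr (2 / 5) = \<sigma>\<^sup>2"
    proof -
      have "\<sigma> ^ 3 = \<sigma> powr 3" "\<sigma> ^ 5 = \<sigma> powr 5" "\<sigma>\<^sup>2 = \<sigma> powr 2"
        using powr_realpow[of \<sigma> 3] powr_realpow[of \<sigma> 5] powr_realpow[of \<sigma> 2] \<sigma> by simp_all
      then show "(\<sigma> ^ 3) powr (2 / 3) = \<sigma>\<^sup>2" "(\<sigma> ^ 5) powr (2 / 5) = \<sigma>\<^sup>2"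
        by (simp_all add: powr_powr)
    qed
    ultimately have e: "(4 * A1 / A) powr (2 / 3) = \<sigma>\<^sup>2 / (\<mu> - 1) powr (2 / 3)"
      "(16 * B1 / B) powr (2 / 5) = \<sigma>\<^sup>2 / (\<mu> - 1) powr (2 / 5)"
      using \<sigma> mu0 by (simp_all add: powr_divide)
    have "(\<mu> - 1) powr (4 / 15) / (\<mu> - 1) powr (2 / 3) = 1 / (\<mu> - 1) powr (2 / 5)"
    proof -
      have "(\<mu> - 1) powr (4 / 15) / (\<mu> - 1) powr (2 / 3) = (\<mu> - 1) powr (4 / 15 - 2 / 3)"
        by (rule powr_diff[symmetric])
      also have "4 / 15 - 2 / 3 = - (2 / 5 :: real)" by simp
      finally show ?thesis by (simp only: powr_minus_divide)
    qed
    then have "\<sigma>\<^sup>2 * ((\<mu> - 1) powr (4 / 15) / (\<mu> - 1) powr (2 / 3)) = \<sigma>\<^sup>2 * (1 / (\<mu> - 1) powr (2 / 5))"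
      by simp
    then have "(\<mu> - 1) powr (4 / 15) * (4 * A1 / A) powr (2 / 3) = (16 * B1 / B) powr (2 / 5)"
      unfolding e by (simp add: mult.commute)
    with ne show False by simp
  qed
  then show ?thesis using conf[OF t0] by (simp add: l_def zero_ereal_def)
qed

end


section \<open>The planar configuration attracts near collision\<close>

definition lyap :: "real \<Rightarrow> real \<Rightarrow> real \<Rightarrow> real \<Rightarrow> real" where
  "lyap g \<eta> u w = w\<^sup>2 / 2 + g * u\<^sup>2 / 2 + \<eta> * u * w"

text \<open>
  For \<open>u' = w\<close>, \<open>w' = - G u + v w / 2\<close> the energy \<open>w\<^sup>2 / 2 + g u\<^sup>2 / 2\<close> only loses \<open>w\<^sup>2\<close>.  The cross term
  with a small coefficient \<open>\<eta>\<close> adds a loss of \<open>u\<^sup>2\<close>, at a cost in \<open>w\<^sup>2\<close> and \<open>u w\<close> that the damping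
  absorbs; the same margin absorbs the deviation \<open>\<gamma>\<close> of the stiffness from its limit \<open>g\<close>.  The decay
  is stated relative to \<open>v\<close> because \<open>v\<close> is the logarithmic derivative of \<open>R\<close> in the rescaled time, so
  it translates into a power of \<open>R\<close>.
\<close>

lemma damped_oscillator_lyapunov:
  fixes g a b :: real
  assumes "g > 0" "a > 0" "a \<le> b"
  shows "\<exists>\<eta> \<gamma> \<kappa>. \<gamma> > 0 \<and> \<kappa> > 0 \<and>
    (\<forall>u w v G. - b \<le> v \<longrightarrow> v \<le> - a \<longrightarrow> \<bar>G - g\<bar> \<le> \<gamma> \<longrightarrow>
       w * (- G * u + v * w / 2) + g * u * w + \<eta> * (w\<^sup>2 + u * (- G * u + v * w / 2)) \<le> \<kappa> * v * lyap g \<eta> u w) \<and>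
    (\<forall>u w. w\<^sup>2 / 4 + g * u\<^sup>2 / 4 \<le> lyap g \<eta> u w)"
proof -
  have b: "b > 0" using assms by simp
  \<comment> \<open>the first two bounds keep the form positive definite, the third leaves half of the damping\<close>
  define \<eta> where "\<eta> = min (1 / 2) (min (g / 2) (a / 4 / (1 + b\<^sup>2 / g)))"
  have D: "1 + b\<^sup>2 / g > 0" using \<open>g > 0\<close> by (simp add: add_pos_nonneg)
  have \<eta>: "\<eta> > 0" "\<eta> \<le> 1 / 2" "\<eta> \<le> g / 2" "\<eta> \<le> a / 4 / (1 + b\<^sup>2 / g)"
    using assms D unfolding \<eta>_def by (simp, linarith+)
  have \<eta>a: "\<eta> * (1 + b\<^sup>2 / g) \<le> a / 4"
    using \<eta>(4) unfolding pos_le_divide_eq[OF D] .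
  define \<gamma> where "\<gamma> = min (g / 2) (\<eta> * b / 2)"
  define \<kappa> where "\<kappa> = min (a / (4 * b)) (\<eta> / (4 * b))"
  have \<gamma>: "\<gamma> > 0" "\<gamma> \<le> g / 2" "\<gamma> \<le> \<eta> * b / 2" using assms b \<eta> by (auto simp: \<gamma>_def)
  have \<kappa>: "\<kappa> > 0" "\<kappa> * b \<le> a / 4" "\<kappa> * b \<le> \<eta> / 4"
    using assms b \<eta> by (auto simp: \<kappa>_def min_def field_simps)
  have cross: "2 * \<bar>u * w\<bar> \<le> u\<^sup>2 + w\<^sup>2" for u w :: real
    using sum_squares_bound[of "\<bar>u\<bar>" "\<bar>w\<bar>"] by (simp add: abs_mult)
  have \<eta>cross: "\<bar>\<eta> * u * w\<bar> \<le> w\<^sup>2 / 4 + g * u\<^sup>2 / 4" for u w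
  proof -
    have "\<bar>\<eta> * u * w\<bar> = \<eta> * \<bar>u * w\<bar>" using \<eta>(1) by (simp add: abs_mult)
    also have "\<dots> \<le> \<eta> * ((u\<^sup>2 + w\<^sup>2) / 2)" using \<eta>(1) cross[of u w] by (intro mult_left_mono) auto
    also have "\<dots> = \<eta> * u\<^sup>2 / 2 + \<eta> * w\<^sup>2 / 2" by (simp add: algebra_simps)
    also have "\<dots> \<le> (g / 2) * u\<^sup>2 / 2 + (1 / 2) * w\<^sup>2 / 2"
      using \<eta> by (intro add_mono divide_right_mono mult_right_mono) auto
    finally show ?thesis by simp
  qed
  have lower: "w\<^sup>2 / 4 + g * u\<^sup>2 / 4 \<le> lyap g \<eta> u w" for u w
    using \<eta>cross[of u w] unfolding lyap_def by (simp add: abs_le_iff)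
  have upper: "lyap g \<eta> u w \<le> w\<^sup>2 + g * u\<^sup>2" for u w
  proof -
    have "0 \<le> g * u\<^sup>2" using \<open>g > 0\<close> by simp
    then show ?thesis using \<eta>cross[of u w] zero_le_power2[of w] unfolding lyap_def abs_le_iff by linarith
  qed
  have "w * (- G * u + v * w / 2) + g * u * w + \<eta> * (w\<^sup>2 + u * (- G * u + v * w / 2)) \<le> \<kappa> * v * lyap g \<eta> u w"
    if v: "- b \<le> v" "v \<le> - a" and G: "\<bar>G - g\<bar> \<le> \<gamma>" for u w v G
  proof -
    have 1: "v * w\<^sup>2 \<le> - a * w\<^sup>2" using v by (intro mult_right_mono) auto
    have 2: "((g - G) + \<eta> * v / 2) * (u * w) \<le> (\<eta> * b) * \<bar>u * w\<bar>"
    proof -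
      have "\<bar>(g - G) + \<eta> * v / 2\<bar> \<le> \<bar>g - G\<bar> + \<bar>\<eta> * v / 2\<bar>" by (rule abs_triangle_ineq)
      also have "\<bar>\<eta> * v / 2\<bar> \<le> \<eta> * b / 2"
        using v \<eta>(1) \<open>a > 0\<close> mult_left_mono[of "- v" b \<eta>] by (simp add: abs_mult)
      finally have "\<bar>(g - G) + \<eta> * v / 2\<bar> \<le> \<eta> * b" using G \<gamma>(3) by (simp add: abs_minus_commute)
      then have "\<bar>((g - G) + \<eta> * v / 2) * (u * w)\<bar> \<le> (\<eta> * b) * \<bar>u * w\<bar>"
        unfolding abs_mult[of "(g - G) + \<eta> * v / 2"] by (intro mult_right_mono) auto
      then show ?thesis by (simp add: abs_le_iff)
    qed
    \<comment> \<open>the weights are chosen so that the share of \<open>u\<^sup>2\<close> is half of what \<open>4\<close> provides\<close>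
    have 3: "(\<eta> * b) * \<bar>u * w\<bar> \<le> \<eta> * (g / 4 * u\<^sup>2) + \<eta> * (b\<^sup>2 / g) * w\<^sup>2"
    proof -
      have "0 \<le> (g / 2 * \<bar>u\<bar> - b * \<bar>w\<bar>)\<^sup>2" by simp
      also have "(g / 2 * \<bar>u\<bar> - b * \<bar>w\<bar>)\<^sup>2
          = g\<^sup>2 / 4 * \<bar>u\<bar>\<^sup>2 + b\<^sup>2 * \<bar>w\<bar>\<^sup>2 - g * (b * \<bar>u * w\<bar>)"
        by (simp add: power2_diff power_mult_distrib power_divide abs_mult del: power2_abs)
      also have "g\<^sup>2 / 4 * \<bar>u\<bar>\<^sup>2 + b\<^sup>2 * \<bar>w\<bar>\<^sup>2 = g * (g / 4 * u\<^sup>2 + b\<^sup>2 / g * w\<^sup>2)"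
        using \<open>g > 0\<close> by (simp add: distrib_left power2_eq_square[of g])
      finally have "g * (b * \<bar>u * w\<bar>) \<le> g * (g / 4 * u\<^sup>2 + b\<^sup>2 / g * w\<^sup>2)" by simp
      then have "b * \<bar>u * w\<bar> \<le> g / 4 * u\<^sup>2 + b\<^sup>2 / g * w\<^sup>2"
        using \<open>g > 0\<close> by simp
      from mult_left_mono[OF this, of \<eta>] \<eta>(1) show ?thesis by (simp add: algebra_simps)
    qed
    have 4: "\<eta> * (g / 2) * u\<^sup>2 \<le> \<eta> * G * u\<^sup>2"
      using G \<gamma>(2) \<eta>(1) by (intro mult_right_mono mult_left_mono) (auto simp: abs_le_iff)
    have 5: "\<eta> * (1 + b\<^sup>2 / g) * w\<^sup>2 \<le> a / 4 * w\<^sup>2"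
      using \<eta>a by (intro mult_right_mono) auto
    have 6: "- (a / 4) * w\<^sup>2 - \<eta> / 4 * (g * u\<^sup>2) \<le> \<kappa> * v * lyap g \<eta> u w"
    proof -
      have gu: "0 \<le> g * u\<^sup>2" using \<open>g > 0\<close> by simp
      have l0: "0 \<le> lyap g \<eta> u w" using lower[of w u] gu zero_le_power2[of w] by linarith
      have "- (a / 4) * w\<^sup>2 - \<eta> / 4 * (g * u\<^sup>2) \<le> - (\<kappa> * b) * w\<^sup>2 - (\<kappa> * b) * (g * u\<^sup>2)"
        using mult_right_mono[OF \<kappa>(2), of "w\<^sup>2"] mult_right_mono[OF \<kappa>(3) gu] by simp
      also have "\<dots> = - (\<kappa> * b) * (w\<^sup>2 + g * u\<^sup>2)" by (simp add: algebra_simps)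
      also have "\<dots> \<le> - (\<kappa> * b) * lyap g \<eta> u w"
        using upper[of u w] \<kappa>(1) b by (intro mult_left_mono_neg) auto
      also have "\<dots> \<le> \<kappa> * v * lyap g \<eta> u w"
        using v(1) \<kappa>(1) l0 by (intro mult_right_mono) (auto simp: mult_le_cancel_left_pos[of \<kappa> "- b" v, simplified])
      finally show ?thesis .
    qed
    have "w * (- G * u + v * w / 2) + g * u * w + \<eta> * (w\<^sup>2 + u * (- G * u + v * w / 2))
        = v * w\<^sup>2 / 2 + ((g - G) + \<eta> * v / 2) * (u * w) + \<eta> * w\<^sup>2 - \<eta> * G * u\<^sup>2"
      by (simp add: algebra_simps power2_eq_square)
    also have "\<dots> \<le> - (a / 4) * w\<^sup>2 - \<eta> / 4 * (g * u\<^sup>2)"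
    proof -
      define p q x where "p = \<eta> * (g * u\<^sup>2)" and "q = \<eta> * (b\<^sup>2 / g) * w\<^sup>2" and "x = a * w\<^sup>2"
      have "\<eta> * b * \<bar>u * w\<bar> \<le> p / 4 + q" "p / 2 \<le> \<eta> * G * u\<^sup>2" "\<eta> * w\<^sup>2 + q \<le> x / 4" "v * w\<^sup>2 \<le> - x"
        using 1 3 4 5 by (simp_all add: p_def q_def x_def distrib_left distrib_right)
      then have "v * w\<^sup>2 / 2 + ((g - G) + \<eta> * v / 2) * (u * w) + \<eta> * w\<^sup>2 - \<eta> * G * u\<^sup>2 \<le> - (x / 4) - p / 4"
        using 2 by linarith
      then show ?thesis by (simp add: p_def x_def)
    qed
    finally show ?thesis using 6 by linarith
  qed
  then show ?thesis using \<gamma>(1) \<kappa>(1) lower by blast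
qed

text \<open>
  The continuity argument for bounds that improve themselves: at the first time with \<open>f = c\<close> the weak
  bound would hold up to that time and hence be strict there.
\<close>

lemma stays_below:
  fixes f :: "real \<Rightarrow> real"
  assumes cont: "continuous_on {s..t} f" and start: "f s < c"
    and step: "\<And>r. r \<in> {s..t} \<Longrightarrow> (\<And>q. q \<in> {s..r} \<Longrightarrow> f q \<le> c) \<Longrightarrow> f r < c"
    and r: "r \<in> {s..t}"
  shows "f r < c"
proof (rule ccontr)
  have hit: "\<exists>p\<in>{s..q}. f p = c" if "q \<in> {s..t}" "c \<le> f q" for q
  proof -
    have "continuous_on {s..q} f" using that(1) by (intro continuous_on_subset[OF cont]) auto
    then show ?thesis using IVT'[of f s c q] start that by auto
  qed
  let ?Z = "{p \<in> {s..t}. f p = c}"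
  assume "\<not> f r < c"
  then have "?Z \<noteq> {}" using hit[OF r] r by fastforce
  moreover have "compact ?Z"
  proof -
    have "closed ({s..t} \<inter> f -` {c})" using cont by (intro continuous_closed_preimage) auto
    moreover have "?Z = ({s..t} \<inter> f -` {c}) \<inter> {s..t}" by auto
    ultimately show ?thesis by (simp only: closed_Int_compact compact_Icc)
  qed
  ultimately obtain p where p: "p \<in> ?Z" "\<And>q. q \<in> ?Z \<Longrightarrow> p \<le> q"
    using compact_attains_inf[of ?Z] by blast
  have "f q \<le> c" if q: "q \<in> {s..p}" for q
  proof (rule ccontr)
    assume "\<not> f q \<le> c"
    then have "q \<in> {s..t}" "c \<le> f q" "q \<noteq> p" using q p(1) by auto
    from hit[OF this(1,2)] obtain p' where "p' \<in> {s..q}" "f p' = c" by blast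
    then show False using p(2)[of p'] q p(1) \<open>q \<noteq> p\<close> by auto
  qed
  then have "f p < c" using step p(1) by blast
  then show False using p(1) by simp
qed

context isosceles
begin

definition "pull_min = 3 * B / M"
definition "pull_max = 2 / M * (A + 3 * B + 4 * A1 + 48 * B1)"
definition "stiff0 = 6 / M * (16 * B1 * (\<mu> - 1) - B)"

lemma pull_min_pos: "pull_min > 0" and pull_min_max: "2 * pull_min < pull_max"
  using pos by (simp_all add: pull_min_def pull_max_def field_simps)

text \<open>
  Only the centrifugal term \<open>- 4 C\<^sup>2 R / M\<^sup>2\<close> is negative; for small \<open>R\<close> it costs at most half of the
  contribution \<open>6 B / M\<close>.  The bounds are uniform in the shape.
\<close>

lemma pull_bounds:
  assumes "0 < R" "R \<le> 1" "4 * C\<^sup>2 * R \<le> 3 * B * M"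
  shows "pull_min \<le> pull R u" "pull R u \<le> pull_max"
proof -
  define s where "s = stretch u"
  have s: "s \<ge> 1" unfolding s_def by (rule stretch_ge_1)
  have R2: "R\<^sup>2 \<le> 1" "0 \<le> R\<^sup>2" using assms by (simp_all add: power_le_one)
  have frac: "0 \<le> c / s ^ n" "c / s ^ n \<le> c" if "0 \<le> c" for c n
    using s that by (auto simp: divide_le_eq mult_ge1_I one_le_power mult_left_le
        intro!: order_trans[OF _ mult_left_mono[OF one_le_power[OF s, of n]]])
  define X where "X = A * R\<^sup>2 + 3 * B + 4 * A1 * R\<^sup>2 / s ^ 3 + 48 * B1 / s ^ 5"
  have X: "pull R u = 2 / M * X - 4 * C\<^sup>2 / M\<^sup>2 * R" by (simp add: pull_def X_def s_def)
  have "3 * B \<le> X" using pos R2 frac(1)[of "4 * A1 * R\<^sup>2" 3] frac(1)[of "48 * B1" 5]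
    by (simp add: X_def)
  then have "2 / M * (3 * B) \<le> 2 / M * X" using pos by (intro mult_left_mono) auto
  moreover have "4 * C\<^sup>2 / M\<^sup>2 * R \<le> 3 * B / M"
    using assms(3) pos(1) by (simp add: field_simps power2_eq_square)
  ultimately show "pull_min \<le> pull R u" unfolding X pull_min_def by simp
  have "A * R\<^sup>2 \<le> A" "4 * A1 * R\<^sup>2 \<le> 4 * A1" using pos R2 by (simp_all add: mult_left_le)
  moreover have "4 * A1 * R\<^sup>2 / s ^ 3 \<le> 4 * A1 * R\<^sup>2" "48 * B1 / s ^ 5 \<le> 48 * B1"
    using pos R2 by (intro frac(2); simp)+
  ultimately have "X \<le> A + 3 * B + 4 * A1 + 48 * B1" unfolding X_def by linarith
  then have "2 / M * X \<le> pull_max" unfolding pull_max_def using pos by (intro mult_left_mono) auto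
  moreover have "0 \<le> 4 * C\<^sup>2 / M\<^sup>2 * R" using assms(1) by simp
  ultimately show "pull R u \<le> pull_max" unfolding X by linarith
qed

lemma stiff_near_collision:
  assumes "\<gamma> > 0"
  obtains \<delta> where "\<delta> > 0" "\<And>R u. \<bar>R\<bar> \<le> \<delta> \<Longrightarrow> \<bar>u\<bar> \<le> \<delta> \<Longrightarrow> \<bar>stiff R u - stiff0\<bar> \<le> \<gamma>"
proof -
  define f where "f = (\<lambda>p :: real \<times> real. stiff (fst p) (snd p))"
  have "stretch u \<noteq> 0" for u using stretch_ge_1[of u] by auto
  then have "continuous_on UNIV f"
    unfolding f_def stiff_def stretch_def
    by (intro continuous_intros) (auto simp: stretch_def)
  then have "isCont f (0, 0)" by (simp add: continuous_on_eq_continuous_at)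
  then obtain d where d: "d > 0" "\<And>p. dist p (0, 0) < d \<Longrightarrow> dist (f p) (f (0, 0)) < \<gamma>"
    using assms unfolding continuous_at_eps_delta by blast
  have f0: "f (0, 0) = stiff0" by (simp add: f_def stiff_def stiff0_def stretch_def)
  show thesis
  proof
    show "d / 3 > 0" using d(1) by simp
    fix R u :: real assume "\<bar>R\<bar> \<le> d / 3" "\<bar>u\<bar> \<le> d / 3"
    then have "dist (R, u) (0, 0) < d"
      using norm_Pair_le[of R u] d(1) by (simp add: dist_norm)
    from d(2)[OF this] show "\<bar>stiff R u - stiff0\<bar> \<le> \<gamma>"
      unfolding f0 by (simp add: f_def dist_real_def)
  qed
qed

end

text \<open>
  The constants of the trap, recorded by the properties that the rest of the argument uses.  The
  bounds on \<open>v\<close> are those that the radial motion alone guarantees: in the limit \<open>R \<rightarrow> 0\<close> it drives \<open>v\<^sup>2\<close>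
  into the interval from \<open>2 / 3 * pull_min\<close> to \<open>2 / 3 * pull_max\<close>, which lies strictly inside
  \<open>pull_min / 2 < v\<^sup>2 < pull_max\<close>.
\<close>

locale collision_trap = isosceles +
  fixes r0 \<epsilon> \<eta> \<kappa> :: real
  assumes small: "r0 > 0" "\<epsilon> > 0" "\<kappa> > 0"
    and pull_near: "\<And>R u. 0 < R \<Longrightarrow> R < r0 \<Longrightarrow> pull_min \<le> pull R u \<and> pull R u \<le> pull_max"
    and stiff0_pos: "stiff0 > 0"
    and lyap_decay: "\<And>R u v w. 0 < R \<Longrightarrow> R < r0 \<Longrightarrow> \<bar>u\<bar> \<le> \<epsilon> \<Longrightarrow>
        - sqrt pull_max \<le> v \<Longrightarrow> v \<le> - sqrt (pull_min / 2) \<Longrightarrow>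
        w * (- stiff R u * u + v * w / 2) + stiff0 * u * w + \<eta> * (w\<^sup>2 + u * (- stiff R u * u + v * w / 2))
          \<le> \<kappa> * v * lyap stiff0 \<eta> u w"
    and lyap_lower: "\<And>u w. w\<^sup>2 / 4 + stiff0 * u\<^sup>2 / 4 \<le> lyap stiff0 \<eta> u w"

lemma (in isosceles) collision_trap_exists:
  assumes "\<mu> > 1 + B / (16 * B1)"
  shows "\<exists>r0 \<epsilon> \<eta> \<kappa>. collision_trap M m A A1 B B1 C \<mu> r0 \<epsilon> \<eta> \<kappa>"
proof -
  have "B < 16 * B1 * (\<mu> - 1)" using assms pos by (simp add: field_simps)
  then have g: "stiff0 > 0" using pos by (simp add: stiff0_def)
  have "sqrt (pull_min / 2) > 0" "sqrt (pull_min / 2) \<le> sqrt pull_max"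
    using pull_min_pos pull_min_max by simp_all
  from damped_oscillator_lyapunov[OF g this] obtain \<eta> \<gamma> \<kappa> where *: "\<gamma> > 0" "\<kappa> > 0"
    and decay: "\<And>u w v G. - sqrt pull_max \<le> v \<Longrightarrow> v \<le> - sqrt (pull_min / 2) \<Longrightarrow> \<bar>G - stiff0\<bar> \<le> \<gamma> \<Longrightarrow>
       w * (- G * u + v * w / 2) + stiff0 * u * w + \<eta> * (w\<^sup>2 + u * (- G * u + v * w / 2)) \<le> \<kappa> * v * lyap stiff0 \<eta> u w"
    and lower: "\<And>u w. w\<^sup>2 / 4 + stiff0 * u\<^sup>2 / 4 \<le> lyap stiff0 \<eta> u w" by metis
  obtain \<delta> where \<delta>: "\<delta> > 0" "\<And>R u. \<bar>R\<bar> \<le> \<delta> \<Longrightarrow> \<bar>u\<bar> \<le> \<delta> \<Longrightarrow> \<bar>stiff R u - stiff0\<bar> \<le> \<gamma>"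
    by (rule stiff_near_collision[OF *(1)]) blast
  define r0 where "r0 = min \<delta> (min 1 (3 * B * M / (4 * C\<^sup>2 + 1)))"
  have "0 < 4 * C\<^sup>2 + 1" by (simp add: add_nonneg_pos)
  then have r0: "r0 > 0" "r0 \<le> \<delta>" "r0 \<le> 1" "r0 \<le> 3 * B * M / (4 * C\<^sup>2 + 1)"
    using \<delta> pos by (auto simp: r0_def)
  have small: "4 * C\<^sup>2 * R \<le> 3 * B * M" if "0 < R" "R < r0" for R
  proof -
    have "R \<le> 3 * B * M / (4 * C\<^sup>2 + 1)" using that r0(4) by simp
    then have "R * (4 * C\<^sup>2 + 1) \<le> 3 * B * M" using \<open>0 < 4 * C\<^sup>2 + 1\<close> by (simp add: pos_le_divide_eq)
    then show ?thesis using that by (simp add: algebra_simps)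
  qed
  have "collision_trap M m A A1 B B1 C \<mu> r0 \<delta> \<eta> \<kappa>"
  proof (intro collision_trap.intro isosceles_axioms collision_trap_axioms.intro)
    show "r0 > 0" "\<delta> > 0" "\<kappa> > 0" "stiff0 > 0" by fact+
    show "pull_min \<le> pull R u \<and> pull R u \<le> pull_max" if "0 < R" "R < r0" for R u
      using pull_bounds[of R u] small[OF that] that r0 by simp
    show "w * (- stiff R u * u + v * w / 2) + stiff0 * u * w + \<eta> * (w\<^sup>2 + u * (- stiff R u * u + v * w / 2))
          \<le> \<kappa> * v * lyap stiff0 \<eta> u w"
      if "0 < R" "R < r0" "\<bar>u\<bar> \<le> \<delta>" "- sqrt pull_max \<le> v" "v \<le> - sqrt (pull_min / 2)" for R u v w
      using that r0 by (intro decay \<delta>(2)) auto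
  qed (rule lower)
  then show ?thesis by blast
qed

context collision_trap
begin

text \<open>
  The bound on the Lyapunov function is the largest for which \<open>lyap_lower\<close> yields \<open>\<bar>u\<bar> < \<epsilon>\<close>.
\<close>

definition trapped :: "real \<Rightarrow> real \<Rightarrow> real \<Rightarrow> real \<Rightarrow> bool" where
  "trapped R V u L \<longleftrightarrow> 0 < R \<and> R < r0 \<and> V < 0 \<and>
     pull_min / 2 < V\<^sup>2 * R ^ 3 \<and> V\<^sup>2 * R ^ 3 < pull_max \<and>
     \<bar>u\<bar> < \<epsilon> \<and> lyap stiff0 \<eta> u (sqrt R * L) < stiff0 * \<epsilon>\<^sup>2 / 4"

definition trajectory :: "real set \<Rightarrow> (real \<Rightarrow> real) \<Rightarrow> (real \<Rightarrow> real) \<Rightarrow> (real \<Rightarrow> real) \<Rightarrow> (real \<Rightarrow> real) \<Rightarrow> bool" where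
  "trajectory I R V u L \<longleftrightarrow> (\<forall>t\<in>I. R t > 0 \<and>
     (R has_real_derivative V t) (at t) \<and>
     (V has_real_derivative - pull (R t) (u t) / R t ^ 4) (at t) \<and>
     (u has_real_derivative L t / (R t)\<^sup>2) (at t) \<and>
     (L has_real_derivative - u t * stiff (R t) (u t) / R t ^ 3) (at t))"

lemma trajectory_subset: "trajectory I R V u L \<Longrightarrow> J \<subseteq> I \<Longrightarrow> trajectory J R V u L"
  by (auto simp: trajectory_def subset_iff)

lemma trajectoryD:
  assumes "trajectory I R V u L" "t \<in> I"
  shows "R t > 0" "(R has_real_derivative V t) (at t)"
    "(V has_real_derivative - pull (R t) (u t) / R t ^ 4) (at t)"
    "(u has_real_derivative L t / (R t)\<^sup>2) (at t)"
    "(L has_real_derivative - u t * stiff (R t) (u t) / R t ^ 3) (at t)"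
  using bspec[OF assms(1)[unfolded trajectory_def] assms(2)] by simp_all

lemma trajectory_continuous:
  assumes "trajectory I R V u L"
  shows "continuous_on I R" "continuous_on I V" "continuous_on I u" "continuous_on I L"
  by (intro continuous_at_imp_continuous_on ballI DERIV_isCont; rule trajectoryD(2-5)[OF assms], assumption)+

text \<open>
  While \<open>V \<le> 0\<close>, the size does not grow, so \<open>pull_near\<close> applies and \<open>V\<close> does not grow either; hence
  \<open>V\<close> remains below its negative initial value.
\<close>

lemma infall_continues:
  assumes tr: "trajectory {s..t} R V u L" and start: "R s < r0" "V s < 0" and r: "r \<in> {s..t}"
  shows "R r \<le> R s" "V r \<le> V s"
proof -
  have main: "R q \<le> R s \<and> V q \<le> V s"
    if q: "q \<in> {s..t}" and neg: "\<And>p. p \<in> {s..q} \<Longrightarrow> V p \<le> 0" for q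
  proof -
    have R: "R p \<le> R s" if p: "p \<in> {s..q}" for p
    proof (rule DERIV_nonpos_imp_nonincreasing[of s p R])
      show "s \<le> p" using p by simp
      fix y assume "s \<le> y" "y \<le> p"
      then show "\<exists>D. (R has_real_derivative D) (at y) \<and> D \<le> 0"
        using trajectoryD(2)[OF tr, of y] neg[of y] p q by (intro exI[of _ "V y"]) auto
    qed
    have "V q \<le> V s"
    proof (rule DERIV_nonpos_imp_nonincreasing[of s q V])
      show "s \<le> q" using q by simp
      fix y assume y: "s \<le> y" "y \<le> q"
      then have "R y > 0" using trajectoryD(1)[OF tr, of y] q by auto
      moreover have "R y < r0" using R[of y] start(1) y by simp
      ultimately have "- pull (R y) (u y) / R y ^ 4 \<le> 0"
        using pull_near[of "R y" "u y"] pull_min_pos by (simp add: divide_nonpos_pos)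
      then show "\<exists>D. (V has_real_derivative D) (at y) \<and> D \<le> 0"
        using trajectoryD(3)[OF tr, of y] y q by (intro exI[of _ "- pull (R y) (u y) / R y ^ 4"]) auto
    qed
    with R[of q] q show ?thesis by auto
  qed
  have neg: "V q < 0" if "q \<in> {s..t}" for q
  proof (rule stays_below[OF trajectory_continuous(2)[OF tr] start(2) _ that])
    fix q assume "q \<in> {s..t}" "\<And>p. p \<in> {s..q} \<Longrightarrow> V p \<le> 0"
    from main[OF this] show "V q < 0" using start(2) by simp
  qed
  have "V p \<le> 0" if "p \<in> {s..r}" for p using neg[of p] that r by auto
  from main[OF r this] show "R r \<le> R s" "V r \<le> V s" by auto
qed

text \<open>
  The derivative of \<open>V\<^sup>2 - \<alpha> / R\<^sup>3\<close> is \<open>V / R\<^sup>4\<close> times \<open>3 \<alpha> - 2 pull\<close>, so during infall it has the opposite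
  sign of the second factor.
\<close>

lemma infall_speed:
  assumes tr: "trajectory {s..t} R V u L" and start: "R s < r0" "V s < 0" and "s \<le> t"
  shows "3 * \<alpha> \<le> 2 * pull_min \<Longrightarrow> (V s)\<^sup>2 - \<alpha> / R s ^ 3 \<le> (V t)\<^sup>2 - \<alpha> / R t ^ 3"
    and "2 * pull_max \<le> 3 * \<alpha> \<Longrightarrow> (V t)\<^sup>2 - \<alpha> / R t ^ 3 \<le> (V s)\<^sup>2 - \<alpha> / R s ^ 3"
proof -
  define N where "N = (\<lambda>r. pull (R r) (u r))"
  have der: "((\<lambda>r. (V r)\<^sup>2 - \<alpha> / R r ^ 3) has_real_derivative (V r / R r ^ 4) * (3 * \<alpha> - 2 * N r)) (at r)"
    and N: "pull_min \<le> N r" "N r \<le> pull_max" and f: "V r / R r ^ 4 \<le> 0" if r: "s \<le> r" "r \<le> t" for r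
  proof -
    have ri: "r \<in> {s..t}" using r by simp
    note d = trajectoryD[OF tr ri]
    show "((\<lambda>r. (V r)\<^sup>2 - \<alpha> / R r ^ 3) has_real_derivative (V r / R r ^ 4) * (3 * \<alpha> - 2 * N r)) (at r)"
      using d(1) by (auto intro!: derivative_eq_intros d(2,3)) (simp add: N_def field_simps numeral_eq_Suc)
    have "R r < r0" "V r < 0" using infall_continues[OF tr start ri] start by auto
    then show "pull_min \<le> N r" "N r \<le> pull_max" "V r / R r ^ 4 \<le> 0"
      using pull_near[of "R r" "u r"] d(1) by (auto simp: N_def divide_nonpos_pos)
  qed
  show "(V s)\<^sup>2 - \<alpha> / R s ^ 3 \<le> (V t)\<^sup>2 - \<alpha> / R t ^ 3" if "3 * \<alpha> \<le> 2 * pull_min"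
  proof (rule DERIV_nonneg_imp_nondecreasing[OF \<open>s \<le> t\<close>])
    fix r assume r: "s \<le> r" "r \<le> t"
    show "\<exists>D. ((\<lambda>r. (V r)\<^sup>2 - \<alpha> / R r ^ 3) has_real_derivative D) (at r) \<and> 0 \<le> D"
      using der[OF r] mult_nonpos_nonpos[OF f[OF r], of "3 * \<alpha> - 2 * N r"] N[OF r] that by auto
  qed
  show "(V t)\<^sup>2 - \<alpha> / R t ^ 3 \<le> (V s)\<^sup>2 - \<alpha> / R s ^ 3" if "2 * pull_max \<le> 3 * \<alpha>"
  proof (rule DERIV_nonpos_imp_nonincreasing[OF \<open>s \<le> t\<close>])
    fix r assume r: "s \<le> r" "r \<le> t"
    show "\<exists>D. ((\<lambda>r. (V r)\<^sup>2 - \<alpha> / R r ^ 3) has_real_derivative D) (at r) \<and> D \<le> 0"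
      using der[OF r] mult_nonpos_nonneg[OF f[OF r], of "3 * \<alpha> - 2 * N r"] N[OF r] that by auto
  qed
qed

text \<open>
  In the original time the oscillator equations carry the factor \<open>\<rho> = R\<^bsup>-5/2\<^esup>\<close>, and \<open>\<rho> v = V / R\<close> is the
  derivative of \<open>ln R\<close>.  Thus \<open>lyap_decay\<close> says that the Lyapunov function times \<open>R powr - \<kappa>\<close> does
  not increase.
\<close>

lemma lyap_decay_along:
  assumes tr: "trajectory {s..t} R V u L" and "s \<le> t"
    and reg: "\<And>r. r \<in> {s..t} \<Longrightarrow> R r < r0 \<and> V r < 0 \<and> pull_min / 2 \<le> (V r)\<^sup>2 * R r ^ 3 \<and>
      (V r)\<^sup>2 * R r ^ 3 \<le> pull_max \<and> \<bar>u r\<bar> \<le> \<epsilon>"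
  shows "lyap stiff0 \<eta> (u t) (sqrt (R t) * L t)
    \<le> lyap stiff0 \<eta> (u s) (sqrt (R s) * L s) * (R t / R s) powr \<kappa>"
proof -
  define W where "W = (\<lambda>r. sqrt (R r) * L r)"
  define \<Psi> where "\<Psi> = (\<lambda>r. lyap stiff0 \<eta> (u r) (W r))"
  have "\<Psi> t * R t powr - \<kappa> \<le> \<Psi> s * R s powr - \<kappa>"
  proof (rule DERIV_nonpos_imp_nonincreasing[OF \<open>s \<le> t\<close>])
    fix r assume "s \<le> r" "r \<le> t"
    then have r: "r \<in> {s..t}" by simp
    note d = trajectoryD[OF tr r]
    define G where "G = stiff (R r) (u r)"
    define v where "v = V r * R r * sqrt (R r)"
    define \<rho> where "\<rho> = 1 / ((R r)\<^sup>2 * sqrt (R r))"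
    have Rr: "R r > 0" by (rule d(1))
    have sq: "sqrt (R r) > 0" "sqrt (R r) * sqrt (R r) = R r" using Rr by auto
    have \<rho>: "\<rho> > 0" using Rr by (simp add: \<rho>_def)
    have v2: "v\<^sup>2 = (V r)\<^sup>2 * R r ^ 3"
      using Rr by (simp add: v_def power_mult_distrib power2_eq_square power3_eq_cube)
    have vneg: "v < 0" using reg[OF r] Rr by (simp add: v_def mult_neg_pos)
    have "pull_min / 2 \<le> (- v)\<^sup>2" "(- v)\<^sup>2 \<le> pull_max" using reg[OF r] by (simp_all add: v2)
    then have v: "- sqrt pull_max \<le> v" "v \<le> - sqrt (pull_min / 2)"
      using real_le_rsqrt[of "- v" pull_max] real_le_lsqrt[of "- v" "pull_min / 2"] vneg by auto
    have du: "(u has_real_derivative \<rho> * W r) (at r)"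
      by (rule DERIV_cong[OF d(4)]) (use Rr in \<open>simp add: \<rho>_def W_def\<close>)
    have "(W has_real_derivative (inverse (sqrt (R r)) / 2 * V r) * L r
        + (- u r * stiff (R r) (u r) / R r ^ 3) * sqrt (R r)) (at r)"
      unfolding W_def using Rr by (auto intro!: derivative_eq_intros d(2,5) DERIV_real_sqrt)
    moreover have "(inverse (sqrt (R r)) / 2 * V r) * L r + (- u r * stiff (R r) (u r) / R r ^ 3) * sqrt (R r)
        = \<rho> * (- G * u r + v * W r / 2)"
    proof -
      have "sqrt (R r) / R r ^ 3 = \<rho>"
        unfolding \<rho>_def using sq Rr by (simp add: field_simps power2_eq_square power3_eq_cube)
      moreover have "inverse (sqrt (R r)) / 2 * V r * L r = \<rho> * (v * W r / 2)"
        unfolding \<rho>_def v_def W_def using sq Rr by (simp add: field_simps power2_eq_square)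
      moreover have "(- u r * stiff (R r) (u r) / R r ^ 3) * sqrt (R r) = (sqrt (R r) / R r ^ 3) * (- G * u r)"
        by (simp add: G_def)
      ultimately show ?thesis by (simp only: distrib_left add.commute)
    qed
    ultimately have dW: "(W has_real_derivative \<rho> * (- G * u r + v * W r / 2)) (at r)" by simp
    define E where "E = W r * (- G * u r + v * W r / 2) + stiff0 * u r * W r
        + \<eta> * ((W r)\<^sup>2 + u r * (- G * u r + v * W r / 2))"
    have d\<Psi>: "(\<Psi> has_real_derivative \<rho> * E) (at r)"
      unfolding \<Psi>_def lyap_def
      by (auto intro!: derivative_eq_intros du dW) (simp add: E_def algebra_simps power2_eq_square)
    have dp: "((\<lambda>r. R r powr - \<kappa>) has_real_derivative - \<kappa> * V r / R r * R r powr - \<kappa>) (at r)"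
      using has_real_derivative_powr'[OF d(2) DERIV_const Rr, of "- \<kappa>"] by (simp add: ac_simps)
    have "E \<le> \<kappa> * v * \<Psi> r"
      unfolding E_def G_def \<Psi>_def using reg[OF r] Rr v by (intro lyap_decay) auto
    then have "\<rho> * E \<le> \<rho> * (\<kappa> * v * \<Psi> r)" using \<rho> by (intro mult_left_mono) auto
    also have "\<dots> = \<kappa> * V r / R r * \<Psi> r"
      unfolding \<rho>_def v_def using sq Rr by (simp add: field_simps power2_eq_square)
    finally have le: "\<rho> * E - \<kappa> * V r / R r * \<Psi> r \<le> 0" by simp
    have "((\<lambda>r. \<Psi> r * R r powr - \<kappa>) has_real_derivative
        \<rho> * E * R r powr - \<kappa> + - \<kappa> * V r / R r * R r powr - \<kappa> * \<Psi> r) (at r)"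
      by (rule DERIV_mult[OF d\<Psi> dp])
    moreover have "\<rho> * E * R r powr - \<kappa> + - \<kappa> * V r / R r * R r powr - \<kappa> * \<Psi> r
        = (\<rho> * E - \<kappa> * V r / R r * \<Psi> r) * R r powr - \<kappa>" by (simp add: algebra_simps)
    ultimately show "\<exists>D. ((\<lambda>r. \<Psi> r * R r powr - \<kappa>) has_real_derivative D) (at r) \<and> D \<le> 0"
      using mult_nonpos_nonneg[OF le, of "R r powr - \<kappa>"] by auto
  qed
  moreover have "R s > 0" "R t > 0" using trajectoryD(1)[OF tr] \<open>s \<le> t\<close> by auto
  ultimately show ?thesis
    unfolding \<Psi>_def W_def by (simp add: powr_divide powr_minus field_simps)
qed

lemma lyap_nonneg: "0 \<le> lyap stiff0 \<eta> u w"
proof -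
  have "0 \<le> w\<^sup>2 / 4 + stiff0 * u\<^sup>2 / 4" using stiff0_pos by simp
  then show ?thesis using lyap_lower[of w u] by linarith
qed

text \<open>
  Size and speed are controlled without reference to the shape.  The bound on the shape improves
  itself: as long as \<open>\<bar>u\<bar> \<le> \<epsilon>\<close>, the Lyapunov function decays, and its value then forces \<open>\<bar>u\<bar> < \<epsilon>\<close>.
\<close>

theorem trapped_forward_invariant:
  assumes tr: "trajectory {s..t} R V u L" and trap: "trapped (R s) (V s) (u s) (L s)" and "s \<le> t"
  shows "trapped (R t) (V t) (u t) (L t)"
    and "lyap stiff0 \<eta> (u t) (sqrt (R t) * L t)
      \<le> lyap stiff0 \<eta> (u s) (sqrt (R s) * L s) * (R t / R s) powr \<kappa>"
proof -
  have start: "R s < r0" "V s < 0" using trap by (auto simp: trapped_def)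
  have Rs: "R s > 0" using trap by (simp add: trapped_def)
  have sub: "trajectory {s..r} R V u L" if "r \<in> {s..t}" for r
    using that by (intro trajectory_subset[OF tr]) auto
  have speed: "pull_min / 2 < (V r)\<^sup>2 * R r ^ 3" "(V r)\<^sup>2 * R r ^ 3 < pull_max"
    and fall: "R r < r0" "V r < 0" "0 < R r" "R r \<le> R s" if r: "r \<in> {s..t}" for r
  proof -
    show Rr: "0 < R r" by (rule trajectoryD(1)[OF tr r])
    show "R r < r0" "V r < 0" "R r \<le> R s" using infall_continues[OF tr start r] start by auto
    have "s \<le> r" using r by simp
    note sp = infall_speed[OF sub[OF r] start this]
    have "(V s)\<^sup>2 - (pull_min / 2) / R s ^ 3 > 0" "(V s)\<^sup>2 - pull_max / R s ^ 3 < 0"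
      using trap Rs by (auto simp: trapped_def field_simps)
    then have "(V r)\<^sup>2 - (pull_min / 2) / R r ^ 3 > 0" "(V r)\<^sup>2 - pull_max / R r ^ 3 < 0"
      using sp(1)[of "pull_min / 2"] sp(2)[of pull_max] pull_min_pos pull_min_max by auto
    then show "pull_min / 2 < (V r)\<^sup>2 * R r ^ 3" "(V r)\<^sup>2 * R r ^ 3 < pull_max"
      using Rr by (auto simp: field_simps)
  qed
  let ?\<Psi> = "\<lambda>r. lyap stiff0 \<eta> (u r) (sqrt (R r) * L r)"
  have decay: "?\<Psi> r \<le> ?\<Psi> s * (R r / R s) powr \<kappa>"
    if r: "r \<in> {s..t}" and le: "\<And>q. q \<in> {s..r} \<Longrightarrow> \<bar>u q\<bar> \<le> \<epsilon>" for r
  proof (rule lyap_decay_along[OF sub[OF r]])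
    show "s \<le> r" using r by simp
    fix q assume q: "q \<in> {s..r}"
    then have "q \<in> {s..t}" using r by auto
    from speed[OF this] fall[OF this] le[OF q]
    show "R q < r0 \<and> V q < 0 \<and> pull_min / 2 \<le> (V q)\<^sup>2 * R q ^ 3 \<and> (V q)\<^sup>2 * R q ^ 3 \<le> pull_max \<and> \<bar>u q\<bar> \<le> \<epsilon>"
      by auto
  qed
  have bound: "\<bar>u r\<bar> < \<epsilon> \<and> ?\<Psi> r < stiff0 * \<epsilon>\<^sup>2 / 4"
    if r: "r \<in> {s..t}" and le: "\<And>q. q \<in> {s..r} \<Longrightarrow> \<bar>u q\<bar> \<le> \<epsilon>" for r
  proof -
    have "(R r / R s) powr \<kappa> \<le> 1 powr \<kappa>"
      using fall[OF r] Rs small(3) by (intro powr_mono2) auto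
    then have "?\<Psi> r \<le> ?\<Psi> s" using decay[OF r le] lyap_nonneg[of "u s" "sqrt (R s) * L s"] by (simp add: mult_left_le order_trans)
    also have "\<dots> < stiff0 * \<epsilon>\<^sup>2 / 4" using trap by (simp add: trapped_def)
    finally have lt: "?\<Psi> r < stiff0 * \<epsilon>\<^sup>2 / 4" .
    then have "stiff0 * (u r)\<^sup>2 / 4 < stiff0 * \<epsilon>\<^sup>2 / 4"
      using lyap_lower[of "sqrt (R r) * L r" "u r"] zero_le_power2[of "sqrt (R r) * L r"] by linarith
    then have "\<bar>u r\<bar>\<^sup>2 < \<epsilon>\<^sup>2" using stiff0_pos by simp
    then show ?thesis using lt small(2) power_less_imp_less_base by fastforce
  qed
  have uin: "\<bar>u r\<bar> < \<epsilon>" if "r \<in> {s..t}" for r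
  proof (rule stays_below[where f = "\<lambda>r. \<bar>u r\<bar>", OF _ _ _ that])
    show "continuous_on {s..t} (\<lambda>r. \<bar>u r\<bar>)"
      by (intro continuous_intros trajectory_continuous[OF tr])
    show "\<bar>u s\<bar> < \<epsilon>" using trap by (simp add: trapped_def)
    show "\<bar>u r\<bar> < \<epsilon>" if "r \<in> {s..t}" "\<And>q. q \<in> {s..r} \<Longrightarrow> \<bar>u q\<bar> \<le> \<epsilon>" for r
      using bound[OF that] by blast
  qed
  have t: "t \<in> {s..t}" using \<open>s \<le> t\<close> by simp
  have le: "\<bar>u q\<bar> \<le> \<epsilon>" if "q \<in> {s..t}" for q using uin[OF that] by simp
  show "trapped (R t) (V t) (u t) (L t)"
    unfolding trapped_def using speed[OF t] fall[OF t] bound[OF t le] by auto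
  show "?\<Psi> t \<le> ?\<Psi> s * (R t / R s) powr \<kappa>" by (rule decay[OF t le])
qed

end


section \<open>The basin of planar triple collision\<close>

text \<open>
  Turns the limits at a possibly infinite endpoint into statements about real times.
\<close>

lemma eventually_at_left_ereal_iff:
  fixes a b :: ereal
  assumes "a < b"
  shows "eventually (\<lambda>s. P (real_of_ereal s)) (at_left b)
    \<longleftrightarrow> (\<exists>s\<in>einterval a b. \<forall>t\<in>einterval a b. s \<le> t \<longrightarrow> P t)"
proof
  assume "eventually (\<lambda>s. P (real_of_ereal s)) (at_left b)"
  then obtain c where c: "c < b" "\<And>y. c < y \<Longrightarrow> y < b \<Longrightarrow> P (real_of_ereal y)"
    unfolding eventually_at_left[OF assms] by blast
  then obtain s where s: "max c a < ereal s" "ereal s < b"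
    using ereal_dense2[of "max c a" b] assms by auto
  have "P t" if "t \<in> einterval a b" "s \<le> t" for t
  proof -
    have "c < ereal s" using s(1) by simp
    also have "ereal s \<le> ereal t" using that(2) by simp
    finally show ?thesis using c(2)[of "ereal t"] that(1) by (simp add: einterval_def)
  qed
  then show "\<exists>s\<in>einterval a b. \<forall>t\<in>einterval a b. s \<le> t \<longrightarrow> P t"
    using s by (intro bexI[of _ s]) (auto simp: einterval_def)
next
  assume "\<exists>s\<in>einterval a b. \<forall>t\<in>einterval a b. s \<le> t \<longrightarrow> P t"
  then obtain s where s: "s \<in> einterval a b" "\<And>t. t \<in> einterval a b \<Longrightarrow> s \<le> t \<Longrightarrow> P t" by blast
  show "eventually (\<lambda>s. P (real_of_ereal s)) (at_left b)"
    unfolding eventually_at_left[OF assms]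
  proof (intro exI[of _ "ereal s"] conjI allI impI)
    show "ereal s < b" using s(1) by (simp add: einterval_def)
    fix y assume y: "ereal s < y" "y < b"
    then obtain t where t: "y = ereal t" by (cases y) auto
    have "a < ereal s" using s(1) by (simp add: einterval_def)
    then have "a < ereal t" using y(1) unfolding t by (rule less_trans)
    then have "t \<in> einterval a b" using y(2) by (simp add: einterval_def t)
    then show "P (real_of_ereal y)" using s(2)[of t] y(1) by (simp add: t)
  qed
qed

lemma tendsto_at_left_ereal_iff:
  fixes f :: "real \<Rightarrow> 'a::metric_space" and a b :: ereal
  assumes "a < b"
  shows "((f \<circ> real_of_ereal) \<longlongrightarrow> l) (at_left b)
    \<longleftrightarrow> (\<forall>e>0. \<exists>s\<in>einterval a b. \<forall>t\<in>einterval a b. s \<le> t \<longrightarrow> dist (f t) l < e)"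
proof -
  have "eventually (\<lambda>s. dist ((f \<circ> real_of_ereal) s) l < e) (at_left b)
      \<longleftrightarrow> (\<exists>s\<in>einterval a b. \<forall>t\<in>einterval a b. s \<le> t \<longrightarrow> dist (f t) l < e)" for e
    using eventually_at_left_ereal_iff[OF assms, of "\<lambda>t. dist (f t) l < e"] by (simp add: o_def)
  then show ?thesis unfolding tendsto_iff by simp
qed

lemma powr_ratio_small:
  fixes p R0 \<kappa> d :: real
  assumes "p \<ge> 0" "R0 > 0" "\<kappa> > 0" "d > 0"
  obtains e where "e > 0" "\<And>R. 0 < R \<Longrightarrow> R < e \<Longrightarrow> p * (R / R0) powr \<kappa> < d"
proof
  define q where "q = d / (p + 1)"
  have q: "q > 0" using assms by (simp add: q_def)
  show "R0 * q powr (1 / \<kappa>) > 0" using assms q by simp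
  fix R :: real assume R: "0 < R" "R < R0 * q powr (1 / \<kappa>)"
  then have "R / R0 < q powr (1 / \<kappa>)" using assms by (simp add: field_simps)
  then have "(R / R0) powr \<kappa> < (q powr (1 / \<kappa>)) powr \<kappa>"
    using R assms by (intro powr_less_mono2) auto
  also have "\<dots> = q" using assms q by (simp add: powr_powr)
  finally have "(p + 1) * (R / R0) powr \<kappa> < d"
    using assms by (simp add: q_def field_simps)
  moreover have "p * (R / R0) powr \<kappa> \<le> (p + 1) * (R / R0) powr \<kappa>"
    by (intro mult_right_mono) auto
  ultimately show "p * (R / R0) powr \<kappa> < d" by linarith
qed

context isosceles
begin

lemma continuous_on_state_observables [continuous_intros]:
  "continuous_on phase_space pos_R" "continuous_on phase_space pos_z"
  "continuous_on phase_space velR" "continuous_on phase_space velz"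
  "continuous_on phase_space shape" "continuous_on phase_space areal_rate"
proof -
  have z: "pos_z = (\<lambda>x. fst (snd x))" by (intro ext) (auto split: prod.split)
  show R: "continuous_on phase_space pos_R" by (intro continuous_intros)
  show cz: "continuous_on phase_space pos_z" unfolding z by (intro continuous_intros)
  show v: "continuous_on phase_space velR" "continuous_on phase_space velz"
    unfolding velR_def[abs_def] velz_def[abs_def] by (intro continuous_intros)+
  show "continuous_on phase_space shape"
    unfolding shape_def[abs_def] by (intro continuous_intros R cz) (auto simp: phase_space_def)
  show "continuous_on phase_space areal_rate"
    unfolding areal_rate_def[abs_def] by (intro continuous_intros R cz v)
qed

lemma continuous_on_H: "continuous_on phase_space H"
proof -
  have "continuous_on phase_space (\<lambda>x. H (fst x, fst (snd x), fst (snd (snd x)), snd (snd (snd x))))"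
  proof -
    have "fst x > 0" if "x \<in> phase_space" for x :: state
      using that by (cases x) (simp add: phase_space_def)
    then have "fst x \<noteq> 0" "(fst x)\<^sup>2 + 4 * (fst (snd x))\<^sup>2 \<noteq> 0" if "x \<in> phase_space" for x :: state
      using that by (fastforce simp: sum_power2_eq_zero_iff add_nonneg_eq_0_iff)+
    then show ?thesis
      unfolding H_red_sqrt by (intro continuous_intros) auto
  qed
  then show ?thesis by simp
qed

lemma energy_level_borel: "energy_level H h \<in> sets borel"
proof -
  have "closedin (top_of_set phase_space) (phase_space \<inter> H -` {h})"
    by (intro continuous_closedin_preimage continuous_on_H) simp
  then obtain T where "closed T" "phase_space \<inter> H -` {h} = phase_space \<inter> T"
    unfolding closedin_closed by blast
  moreover have "energy_level H h = phase_space \<inter> H -` {h}"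
    unfolding energy_level_def by blast
  ultimately show ?thesis using open_phase_space by (simp add: sets.Int)
qed

end

context collision_trap
begin

lemma solution_trajectory:
  assumes "solution H a b x"
  shows "trajectory (einterval a b) (\<lambda>t. pos_R (x t)) (\<lambda>t. velR (x t)) (\<lambda>t. shape (x t)) (\<lambda>t. areal_rate (x t))"
  unfolding trajectory_def
  by (intro ballI conjI; rule reduced_equations[OF assms], assumption)

definition trap :: "state set" where
  "trap = {x \<in> phase_space. trapped (pos_R x) (velR x) (shape x) (areal_rate x)}"

lemma open_trap: "open trap"
proof -
  define F :: "(state \<Rightarrow> real) set" where "F =
    {\<lambda>x. r0 - pos_R x, \<lambda>x. - velR x, \<lambda>x. (velR x)\<^sup>2 * pos_R x ^ 3 - pull_min / 2,
     \<lambda>x. pull_max - (velR x)\<^sup>2 * pos_R x ^ 3, \<lambda>x. \<epsilon> - \<bar>shape x\<bar>,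
     \<lambda>x. stiff0 * \<epsilon>\<^sup>2 / 4 - lyap stiff0 \<eta> (shape x) (sqrt (pos_R x) * areal_rate x)}"
  have "continuous_on phase_space f" if "f \<in> F" for f
    using that unfolding F_def lyap_def
    by (elim insertE emptyE; simp only:) (auto intro!: continuous_intros)
  then have "open (phase_space \<inter> f -` {0<..})" if "f \<in> F" for f
    using that by (intro continuous_open_preimage open_phase_space) auto
  then have "open (\<Inter>f\<in>F. phase_space \<inter> f -` {0<..})"
    by (intro open_INT) (auto simp: F_def)
  also have "(\<Inter>f\<in>F. phase_space \<inter> f -` {0<..}) = trap"
    unfolding F_def trap_def trapped_def by (auto simp: phase_space_def)
  finally show ?thesis .
qed

lemma trap_imp_bounds:
  assumes "trapped R V u L" "e \<le> R" "e > 0"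
  shows "\<bar>V\<bar> \<le> sqrt (pull_max / e ^ 3)" "\<bar>L\<bar> \<le> sqrt (stiff0 * \<epsilon>\<^sup>2 / e)"
proof -
  have R: "R > 0" "V\<^sup>2 * R ^ 3 < pull_max" "lyap stiff0 \<eta> u (sqrt R * L) < stiff0 * \<epsilon>\<^sup>2 / 4"
    using assms by (auto simp: trapped_def)
  have "V\<^sup>2 * e ^ 3 \<le> V\<^sup>2 * R ^ 3" using assms by (intro mult_left_mono power_mono) auto
  then have "V\<^sup>2 \<le> pull_max / e ^ 3" using R(2) assms(3) by (simp add: pos_le_divide_eq)
  then show "\<bar>V\<bar> \<le> sqrt (pull_max / e ^ 3)" by (intro real_le_rsqrt) simp
  have "0 \<le> stiff0 * u\<^sup>2 / 4" using stiff0_pos by simp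
  then have "(sqrt R * L)\<^sup>2 / 4 \<le> stiff0 * \<epsilon>\<^sup>2 / 4" using lyap_lower[of "sqrt R * L" u] R(3) by linarith
  then have "R * L\<^sup>2 \<le> stiff0 * \<epsilon>\<^sup>2" using R(1) by (simp add: power_mult_distrib)
  moreover have "e * L\<^sup>2 \<le> R * L\<^sup>2" using assms by (intro mult_right_mono) auto
  ultimately have "L\<^sup>2 \<le> stiff0 * \<epsilon>\<^sup>2 / e" using assms(3) by (simp add: pos_le_divide_eq mult.commute)
  then show "\<bar>L\<bar> \<le> sqrt (stiff0 * \<epsilon>\<^sup>2 / e)" by (intro real_le_rsqrt) simp
qed

text \<open>
  The state is a continuous function of \<open>(R, u, V, L)\<close> for \<open>R > 0\<close>, and in the trap with \<open>R \<ge> e\<close> these four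
  quantities range over a compact box.
\<close>

lemma trap_bounded_size_compact:
  assumes "e > 0"
  obtains K where "compact K" "K \<subseteq> phase_space" "\<And>x. x \<in> trap \<Longrightarrow> e \<le> pos_R x \<Longrightarrow> x \<in> K"
proof -
  define \<Phi> :: "state \<Rightarrow> state" where
    "\<Phi> = (\<lambda>(R, u, V, L). (R, u * R, M * V / 2, 2 * M / \<mu> * ((L + u * R * V) / R)))"
  define Q :: "state set" where "Q = cbox (e, - \<epsilon>, - sqrt (pull_max / e ^ 3), - sqrt (stiff0 * \<epsilon>\<^sup>2 / e))
      (r0, \<epsilon>, sqrt (pull_max / e ^ 3), sqrt (stiff0 * \<epsilon>\<^sup>2 / e))"
  have Qpos: "fst p > 0" if "p \<in> Q" for p
    using that assms by (cases p) (auto simp: Q_def cbox_Pair_eq)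
  then have Qne: "fst p \<noteq> 0" if "p \<in> Q" for p using that by fastforce
  have "continuous_on Q \<Phi>"
    unfolding \<Phi>_def case_prod_unfold using Qne by (intro continuous_intros) auto
  then have "compact (\<Phi> ` Q)" by (rule compact_continuous_image) (simp add: Q_def)
  moreover have "\<Phi> ` Q \<subseteq> phase_space"
    using Qpos by (force simp: \<Phi>_def phase_space_def case_prod_unfold)
  moreover have "x \<in> \<Phi> ` Q" if x: "x \<in> trap" "e \<le> pos_R x" for x
  proof (rule image_eqI)
    have t: "trapped (pos_R x) (velR x) (shape x) (areal_rate x)" using x(1) by (simp add: trap_def)
    then have R: "pos_R x > 0" "pos_R x < r0" "\<bar>shape x\<bar> < \<epsilon>" by (auto simp: trapped_def)
    show "(pos_R x, shape x, velR x, areal_rate x) \<in> Q"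
      using R x(2) trap_imp_bounds[OF t x(2) assms] by (auto simp: Q_def cbox_Pair_eq abs_le_iff)
    obtain a b c d where xx: "x = (a, b, c, d)" by (cases x)
    show "x = \<Phi> (pos_R x, shape x, velR x, areal_rate x)"
      using R(1) pos mu_gt_1 by (simp add: xx \<Phi>_def shape_def velR_def areal_rate_def velz_def)
  qed
  ultimately show thesis using that by blast
qed

text \<open>
  In the trap \<open>R\<close> is positive and decreases at least linearly, so the orbit ends at a finite time.
  There it leaves every compact set, which is possible only if \<open>R \<rightarrow> 0\<close>.  The power law for the
  Lyapunov function then gives \<open>u \<rightarrow> 0\<close>, and \<open>z = u R\<close>.
\<close>

theorem trap_imp_planar_triple_collision:
  assumes fl: "flow_line a b x" and t0: "t0 \<in> einterval a b" "x t0 \<in> trap"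
  shows "triple_collision b x" "limiting_configuration b x 0"
proof -
  note sol = flow_line_solution[OF fl]
  define R V u L where "R = (\<lambda>t. pos_R (x t))" and "V = (\<lambda>t. velR (x t))"
    and "u = (\<lambda>t. shape (x t))" and "L = (\<lambda>t. areal_rate (x t))"
  have tr: "trajectory (einterval a b) R V u L"
    unfolding R_def V_def u_def L_def by (rule solution_trajectory[OF sol])
  have "a < b" using sol by (simp add: solution_def)
  have trap0: "trapped (R t0) (V t0) (u t0) (L t0)"
    using t0(2) by (simp add: trap_def R_def V_def u_def L_def)
  have sub: "trajectory {s..t} R V u L" if "s \<in> einterval a b" "t \<in> einterval a b" for s t
    by (rule trajectory_subset[OF tr]) (use einterval_segment[OF that] in \<open>auto simp: closed_segment_eq_real_ivl split: if_splits\<close>)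
  have inv: "trapped (R t) (V t) (u t) (L t)"
    and decay: "lyap stiff0 \<eta> (u t) (sqrt (R t) * L t)
      \<le> lyap stiff0 \<eta> (u t0) (sqrt (R t0) * L t0) * (R t / R t0) powr \<kappa>"
    if "t \<in> einterval a b" "t0 \<le> t" for t
    using trapped_forward_invariant[OF sub[OF t0(1) that(1)] trap0 that(2)] by auto
  have fall: "R t \<le> R s" "V t \<le> V s" if "s \<in> einterval a b" "t \<in> einterval a b" "t0 \<le> s" "s \<le> t" for s t
    using infall_continues[OF sub[OF that(1,2)], of t] inv[OF that(1,3)] that(4)
    by (auto simp: trapped_def)
  have Rpos: "R t > 0" if "t \<in> einterval a b" for t using trajectoryD(1)[OF tr that] .
  have V0: "V t0 < 0" using trap0 by (simp add: trapped_def)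
  have line: "R t \<le> R t0 + V t0 * (t - t0)" if t: "t \<in> einterval a b" "t0 \<le> t" for t
  proof -
    have "R t - V t0 * t \<le> R t0 - V t0 * t0"
    proof (rule DERIV_nonpos_imp_nonincreasing[OF t(2), of "\<lambda>t. R t - V t0 * t"])
      fix r assume r: "t0 \<le> r" "r \<le> t"
      then have "r \<in> einterval a b"
        using einterval_segment[OF t0(1) t(1), of r] by (auto simp: closed_segment_eq_real_ivl)
      then have "((\<lambda>t. R t - V t0 * t) has_real_derivative V r - V t0 * 1) (at r)" "V r \<le> V t0"
        using fall(2)[OF t0(1), of r] r by (auto intro!: derivative_intros trajectoryD(2)[OF tr])
      then show "\<exists>D. ((\<lambda>t. R t - V t0 * t) has_real_derivative D) (at r) \<and> D \<le> 0" by force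
    qed
    then show ?thesis by (simp add: algebra_simps)
  qed
  have "b \<le> ereal (t0 + R t0 / (- V t0))"
  proof (rule ccontr)
    assume "\<not> b \<le> ereal (t0 + R t0 / (- V t0))"
    then have lt: "ereal (t0 + R t0 / (- V t0)) < b" by simp
    have "0 \<le> R t0 / (- V t0)" using Rpos[OF t0(1)] V0 by (intro divide_nonneg_pos) auto
    then have ge: "t0 \<le> t0 + R t0 / (- V t0)" by simp
    have "a < ereal t0" using t0(1) by (simp add: einterval_def)
    also have "ereal t0 \<le> ereal (t0 + R t0 / (- V t0))" using ge by simp
    finally have mem: "t0 + R t0 / (- V t0) \<in> einterval a b" using lt by (simp add: einterval_def)
    from line[OF mem ge] Rpos[OF mem] V0 show False by (simp add: field_simps)
  qed
  moreover have "ereal t0 < b" using t0(1) by (simp add: einterval_def)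
  ultimately obtain \<beta> where \<beta>: "b = ereal \<beta>" by (cases b) auto
  have late: "\<exists>s\<in>einterval a b. t0 \<le> s \<and> (\<forall>t\<in>einterval a b. s \<le> t \<longrightarrow> R t < e)" if "e > 0" for e
  proof -
    have "\<exists>s\<in>einterval a b. t0 \<le> s \<and> R s < e"
    proof (rule ccontr)
      assume none: "\<not> ?thesis"
      obtain K where K: "compact K" "K \<subseteq> phase_space" "\<And>x. x \<in> trap \<Longrightarrow> e \<le> pos_R x \<Longrightarrow> x \<in> K"
        by (rule trap_bounded_size_compact[OF \<open>e > 0\<close>]) blast
      have "x t \<in> K" if "t0 \<le> t" "t < \<beta>" for t
      proof (rule K(3))
        have "a < ereal t0" using t0(1) by (simp add: einterval_def)
        also have "ereal t0 \<le> ereal t" using that by simp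
        finally have t: "t \<in> einterval a b" using that by (simp add: einterval_def \<beta>)
        show "e \<le> pos_R (x t)" using none t that(1) unfolding R_def by force
        show "x t \<in> trap" using inv[OF t that(1)] solutionD(1)[OF sol t]
          by (simp add: trap_def R_def V_def u_def L_def)
      qed
      then show False
        using flow_line_leaves_compact[OF fl[unfolded \<beta>] t0(1)[unfolded \<beta>] K(1,2)] by blast
    qed
    then obtain s where s: "s \<in> einterval a b" "t0 \<le> s" "R s < e" by blast
    have "R t < e" if "t \<in> einterval a b" "s \<le> t" for t
      using fall(1)[OF s(1) that(1) s(2) that(2)] s(3) by simp
    then show ?thesis using s by blast
  qed
  have R0: "((R \<circ> real_of_ereal) \<longlongrightarrow> 0) (at_left b)"
    unfolding tendsto_at_left_ereal_iff[OF \<open>a < b\<close>]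
  proof (intro allI impI)
    fix e :: real assume "e > 0"
    from late[OF this] obtain s where s: "s \<in> einterval a b" "\<And>t. t \<in> einterval a b \<Longrightarrow> s \<le> t \<Longrightarrow> R t < e"
      by blast
    then show "\<exists>s\<in>einterval a b. \<forall>t\<in>einterval a b. s \<le> t \<longrightarrow> dist (R t) 0 < e"
      using Rpos by (intro bexI[OF _ s(1)]) (force simp: dist_real_def)
  qed
  have u0: "((u \<circ> real_of_ereal) \<longlongrightarrow> 0) (at_left b)"
    unfolding tendsto_at_left_ereal_iff[OF \<open>a < b\<close>]
  proof (intro allI impI)
    fix e :: real assume e: "e > 0"
    then have "stiff0 * e\<^sup>2 / 4 > 0" using stiff0_pos by simp
    then obtain d where d: "d > 0" "\<And>r. 0 < r \<Longrightarrow> r < d \<Longrightarrow>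
        lyap stiff0 \<eta> (u t0) (sqrt (R t0) * L t0) * (r / R t0) powr \<kappa> < stiff0 * e\<^sup>2 / 4"
      using powr_ratio_small[OF lyap_nonneg Rpos[OF t0(1)] small(3)] by metis
    obtain s where s: "s \<in> einterval a b" "t0 \<le> s" "\<And>t. t \<in> einterval a b \<Longrightarrow> s \<le> t \<Longrightarrow> R t < d"
      using late[OF d(1)] by blast
    have "dist (u t) 0 < e" if t: "t \<in> einterval a b" "s \<le> t" for t
    proof -
      have "lyap stiff0 \<eta> (u t) (sqrt (R t) * L t) < stiff0 * e\<^sup>2 / 4"
        using decay[OF t(1)] d(2)[OF Rpos[OF t(1)] s(3)[OF t]] s(2) t(2) by linarith
      then have "stiff0 * (u t)\<^sup>2 / 4 < stiff0 * e\<^sup>2 / 4"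
        using lyap_lower[of "sqrt (R t) * L t" "u t"] zero_le_power2[of "sqrt (R t) * L t"] by linarith
      then have "\<bar>u t\<bar>\<^sup>2 < e\<^sup>2" using stiff0_pos by simp
      then have "\<bar>u t\<bar> < e" using e by (intro power_less_imp_less_base[of "\<bar>u t\<bar>" 2 e]) auto
      then show ?thesis by (simp add: dist_real_def)
    qed
    then show "\<exists>s\<in>einterval a b. \<forall>t\<in>einterval a b. s \<le> t \<longrightarrow> dist (u t) 0 < e"
      using s(1) by blast
  qed
  show "limiting_configuration b x 0"
    unfolding limiting_configuration_def
    using tendsto_ereal[OF u0] by (simp add: u_def shape_def o_def zero_ereal_def)
  show "triple_collision b x"
    unfolding triple_collision_def
  proof (rule Lim_transform_eventually)
    show "((\<lambda>s. (R (real_of_ereal s), u (real_of_ereal s) * R (real_of_ereal s))) \<longlongrightarrow> (0, 0)) (at_left b)"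
      using tendsto_Pair[OF R0 tendsto_mult[OF u0 R0]] by (simp add: o_def)
    have "\<exists>s\<in>einterval a b. \<forall>t\<in>einterval a b. s \<le> t \<longrightarrow> (R t, u t * R t) = (pos_R (x t), pos_z (x t))"
    proof (intro bexI[OF _ t0(1)] ballI impI)
      fix t assume "t \<in> einterval a b"
      from Rpos[OF this] show "(R t, u t * R t) = (pos_R (x t), pos_z (x t))"
        by (simp add: R_def u_def shape_def)
    qed
    then show "\<forall>\<^sub>F s in at_left b. (R (real_of_ereal s), u (real_of_ereal s) * R (real_of_ereal s))
        = ((\<lambda>t. (pos_R (x t), pos_z (x t))) \<circ> real_of_ereal) s"
      using eventually_at_left_ereal_iff[OF \<open>a < b\<close>, of "\<lambda>t. (R t, u t * R t) = (pos_R (x t), pos_z (x t))"]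
      by (simp add: o_def)
  qed
qed

text \<open>
  Once \<open>R\<close> and \<open>u\<close> are small for good, \<open>R\<close> must decrease at some time and then falls for ever.  The
  two monotone quantities of \<open>infall_speed\<close> confine \<open>V\<^sup>2 R\<^sup>3\<close> when \<open>R\<close> is small.  After that
  \<open>lyap_decay_along\<close> applies without a smallness assumption on its initial value, so the Lyapunov
  function falls below the threshold of the trap.
\<close>

theorem planar_collision_enters_trap:
  assumes sol: "solution H a b x" and z: "0 \<in> einterval a b"
    and col: "triple_collision b x" and lim: "limiting_configuration b x 0"
  shows "\<exists>t\<in>einterval a b. 0 \<le> t \<and> x t \<in> trap"
proof -
  define R V u L where "R = (\<lambda>t. pos_R (x t))" and "V = (\<lambda>t. velR (x t))"
    and "u = (\<lambda>t. shape (x t))" and "L = (\<lambda>t. areal_rate (x t))"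
  define J where "J = einterval a b"
  have tr: "trajectory J R V u L"
    unfolding R_def V_def u_def L_def J_def by (rule solution_trajectory[OF sol])
  have "a < b" using sol by (simp add: solution_def)
  have between: "r \<in> J" if "s \<in> J" "t \<in> J" "s \<le> r" "r \<le> t" for r s t
    using einterval_segment[of s a b t r] that by (auto simp: J_def closed_segment_eq_real_ivl)
  have sub: "trajectory {s..t} R V u L" if "s \<in> J" "t \<in> J" for s t
    by (rule trajectory_subset[OF tr]) (use between[OF that] in auto)
  have Rpos: "R t > 0" if "t \<in> J" for t using trajectoryD(1)[OF tr that] .
  have R0: "((R \<circ> real_of_ereal) \<longlongrightarrow> 0) (at_left b)"
    using tendsto_fst[OF col[unfolded triple_collision_def]] by (simp add: o_def R_def)
  have u0: "((u \<circ> real_of_ereal) \<longlongrightarrow> 0) (at_left b)"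
    using lim unfolding limiting_configuration_def zero_ereal_def
    by (simp add: o_def u_def shape_def)
  have Rlate: "\<exists>s\<in>J. s0 \<le> s \<and> (\<forall>t\<in>J. s \<le> t \<longrightarrow> R t < e)" if "s0 \<in> J" "e > 0" for s0 e
  proof -
    obtain s where "s \<in> J" "\<And>t. t \<in> J \<Longrightarrow> s \<le> t \<Longrightarrow> dist (R t) 0 < e"
      using R0[unfolded tendsto_at_left_ereal_iff[OF \<open>a < b\<close>]] \<open>e > 0\<close> unfolding J_def by blast
    then show ?thesis using \<open>s0 \<in> J\<close> by (intro bexI[of _ "max s s0"]) (auto simp: dist_real_def max_def abs_less_iff)
  qed
  obtain s0 where s0: "s0 \<in> J" "\<And>t. t \<in> J \<Longrightarrow> s0 \<le> t \<Longrightarrow> \<bar>u t\<bar> < \<epsilon>"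
    using u0[unfolded tendsto_at_left_ereal_iff[OF \<open>a < b\<close>]] small(2) unfolding J_def by (auto simp: dist_real_def)
  have "max s0 0 \<in> J" using s0(1) z by (simp add: J_def max_def)
  from Rlate[OF this small(1)] obtain s1 where s1: "s1 \<in> J" "s0 \<le> s1" "0 \<le> s1"
    "\<And>t. t \<in> J \<Longrightarrow> s1 \<le> t \<Longrightarrow> R t < r0" by auto
  obtain s2 where s2: "s2 \<in> J" "s1 \<le> s2" "V s2 < 0"
  proof -
    obtain t where t: "t \<in> J" "s1 \<le> t" "R t < R s1"
      using Rlate[OF s1(1) Rpos[OF s1(1)]] by blast
    then have "s1 < t" by (cases "s1 = t") auto
    then obtain r where "s1 < r" "r < t" "R t - R s1 = (t - s1) * V r"
      using MVT2[of s1 t R V] trajectoryD(2)[OF sub[OF s1(1) t(1)]] by auto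
    moreover have "V r < 0"
      using t(3) \<open>s1 < t\<close> calculation(3) by (metis diff_gt_0_iff_gt diff_less_0_iff_less mult_less_0_iff not_less_iff_gr_or_eq)
    ultimately show thesis using that between[OF s1(1) t(1), of r] by auto
  qed
  have speed: "(V s2)\<^sup>2 - (2 / 3 * pull_min) / R s2 ^ 3 \<le> (V t)\<^sup>2 - (2 / 3 * pull_min) / R t ^ 3"
    "(V t)\<^sup>2 - (2 / 3 * pull_max) / R t ^ 3 \<le> (V s2)\<^sup>2 - (2 / 3 * pull_max) / R s2 ^ 3"
    "V t < 0" if t: "t \<in> J" "s2 \<le> t" for t
  proof -
    have st: "R s2 < r0" using s1(4)[OF s2(1,2)] .
    note sp = infall_speed[OF sub[OF s2(1) t(1)] st s2(3) t(2)]
    show "(V s2)\<^sup>2 - (2 / 3 * pull_min) / R s2 ^ 3 \<le> (V t)\<^sup>2 - (2 / 3 * pull_min) / R t ^ 3"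
      by (rule sp(1)) simp
    show "(V t)\<^sup>2 - (2 / 3 * pull_max) / R t ^ 3 \<le> (V s2)\<^sup>2 - (2 / 3 * pull_max) / R s2 ^ 3"
      by (rule sp(2)) simp
    show "V t < 0"
      using infall_continues(2)[OF sub[OF s2(1) t(1)] st s2(3), of t] t s2(3) by auto
  qed
  \<comment> \<open>\<open>k\<close> bounds both initial values, and \<open>k R\<^sup>3\<close> must stay below the gap \<open>2/3 - 1/2 = 1/6\<close>\<close>
  define k where "k = \<bar>(V s2)\<^sup>2 - (2 / 3 * pull_min) / R s2 ^ 3\<bar> + \<bar>(V s2)\<^sup>2 - (2 / 3 * pull_max) / R s2 ^ 3\<bar> + 1"
  have k: "k > 0" "\<bar>(V s2)\<^sup>2 - (2 / 3 * pull_min) / R s2 ^ 3\<bar> \<le> k"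
    "\<bar>(V s2)\<^sup>2 - (2 / 3 * pull_max) / R s2 ^ 3\<bar> \<le> k" by (auto simp: k_def)
  define e where "e = min 1 (pull_min / (6 * k))"
  have "e > 0" using k(1) pull_min_pos by (simp add: e_def)
  from Rlate[OF s2(1) this] obtain s3 where s3: "s3 \<in> J" "s2 \<le> s3" "\<And>t. t \<in> J \<Longrightarrow> s3 \<le> t \<Longrightarrow> R t < e"
    by blast
  have range: "pull_min / 2 < (V t)\<^sup>2 * R t ^ 3" "(V t)\<^sup>2 * R t ^ 3 < pull_max" if t: "t \<in> J" "s3 \<le> t" for t
  proof -
    have R: "0 < R t" "R t < e" using Rpos[OF t(1)] s3(3)[OF t] by auto
    have "R t ^ 3 \<le> R t" using R power_decreasing[of 1 3 "R t"] by (simp add: e_def)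
    then have "k * R t ^ 3 \<le> k * R t" using k(1) by simp
    also have "\<dots> < pull_min / 6" using R k(1) by (simp add: e_def field_simps)
    finally have kR: "k * R t ^ 3 < pull_min / 6" .
    have t2: "s2 \<le> t" using t(2) s3(2) by simp
    have "- k \<le> (V t)\<^sup>2 - (2 / 3 * pull_min) / R t ^ 3" "(V t)\<^sup>2 - (2 / 3 * pull_max) / R t ^ 3 \<le> k"
      using speed(1,2)[OF t(1) t2] k(2,3) by linarith+
    then have "- k * R t ^ 3 \<le> ((V t)\<^sup>2 - (2 / 3 * pull_min) / R t ^ 3) * R t ^ 3"
      "((V t)\<^sup>2 - (2 / 3 * pull_max) / R t ^ 3) * R t ^ 3 \<le> k * R t ^ 3"
      using R(1) by (intro mult_right_mono; simp)+
    then have "- (k * R t ^ 3) \<le> (V t)\<^sup>2 * R t ^ 3 - 2 / 3 * pull_min"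
      "(V t)\<^sup>2 * R t ^ 3 - 2 / 3 * pull_max \<le> k * R t ^ 3"
      using R(1) by (simp_all add: left_diff_distrib)
    then show "pull_min / 2 < (V t)\<^sup>2 * R t ^ 3" "(V t)\<^sup>2 * R t ^ 3 < pull_max"
      using kR pull_min_pos pull_min_max by linarith+
  qed
  have decay: "lyap stiff0 \<eta> (u t) (sqrt (R t) * L t)
      \<le> lyap stiff0 \<eta> (u s3) (sqrt (R s3) * L s3) * (R t / R s3) powr \<kappa>"
    if t: "t \<in> J" "s3 \<le> t" for t
  proof (rule lyap_decay_along[OF sub[OF s3(1) t(1)] t(2)])
    fix r assume "r \<in> {s3..t}"
    then have r: "r \<in> J" "s3 \<le> r" using between[OF s3(1) t(1)] by auto
    then show "R r < r0 \<and> V r < 0 \<and> pull_min / 2 \<le> (V r)\<^sup>2 * R r ^ 3 \<and> (V r)\<^sup>2 * R r ^ 3 \<le> pull_max \<and> \<bar>u r\<bar> \<le> \<epsilon>"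
      using range[OF r] s1(4)[OF r(1)] speed(3)[OF r(1)] s0(2)[OF r(1)] s1 s2 s3 by auto
  qed
  have "stiff0 * \<epsilon>\<^sup>2 / 4 > 0" using stiff0_pos small(2) by simp
  then obtain d where d: "d > 0" "\<And>r. 0 < r \<Longrightarrow> r < d \<Longrightarrow>
      lyap stiff0 \<eta> (u s3) (sqrt (R s3) * L s3) * (r / R s3) powr \<kappa> < stiff0 * \<epsilon>\<^sup>2 / 4"
    using powr_ratio_small[OF lyap_nonneg Rpos[OF s3(1)] small(3)] by metis
  from Rlate[OF s3(1) d(1)] obtain t where t: "t \<in> J" "s3 \<le> t" "R t < d" by auto
  have "trapped (R t) (V t) (u t) (L t)"
    unfolding trapped_def
    using Rpos[OF t(1)] range[OF t(1,2)] s1(4)[OF t(1)] speed(3)[OF t(1)] s0(2)[OF t(1)] s1 s2 s3 t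
      decay[OF t(1,2)] d(2)[OF Rpos[OF t(1)] t(3)] by auto
  then have "x t \<in> trap"
    using solutionD(1)[OF sol] t(1) by (simp add: trap_def J_def R_def V_def u_def L_def)
  moreover have "0 \<le> t" using s1 s2 s3 t by auto
  ultimately show ?thesis using t(1) unfolding J_def by blast
qed

definition basin :: "state set" where
  "basin = {x0. \<exists>a b x. flow_line a b x \<and> x 0 = x0 \<and> (\<exists>t\<in>einterval a b. 0 \<le> t \<and> x t \<in> trap)}"

theorem open_basin: "open basin"
  unfolding open_dist
proof
  fix x0 assume "x0 \<in> basin"
  then obtain a b x t where fl: "flow_line a b x" and x0: "x 0 = x0"
    and t: "t \<in> einterval a b" "0 \<le> t" "x t \<in> trap" unfolding basin_def by blast
  note sol = flow_line_solution[OF fl]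
  have z: "0 \<in> einterval a b" using fl unfolding flow_line_def by blast
  obtain \<delta> where \<delta>: "\<delta> > 0" "\<And>a' b' y. flow_line a' b' y \<Longrightarrow> dist (x 0) (y 0) < \<delta> \<Longrightarrow>
      t \<in> einterval a' b' \<and> y t \<in> trap"
    by (rule continuous_dependence[OF sol z t(1,2) open_trap t(3)]) blast
  have "x0 \<in> phase_space" using solutionD(1)[OF sol z] x0 by simp
  then obtain \<delta>' where \<delta>': "\<delta>' > 0" "ball x0 \<delta>' \<subseteq> phase_space"
    using open_phase_space openE by blast
  show "\<exists>e>0. \<forall>y0. dist y0 x0 < e \<longrightarrow> y0 \<in> basin"
  proof (intro exI[of _ "min \<delta> \<delta>'"] conjI allI impI)
    show "min \<delta> \<delta>' > 0" using \<delta>(1) \<delta>'(1) by simp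
    fix y0 assume y0: "dist y0 x0 < min \<delta> \<delta>'"
    then have "y0 \<in> phase_space" by (intro subsetD[OF \<delta>'(2)]) (simp add: dist_commute)
    then obtain a' b' y where y: "flow_line a' b' y" "y 0 = y0" by (rule flow_line_exists)
    have "dist (x 0) (y 0) < \<delta>" using y0 y(2) x0 by (simp add: dist_commute)
    from \<delta>(2)[OF y(1) this] show "y0 \<in> basin" unfolding basin_def using y t(2) by blast
  qed
qed

lemma trap_subset_basin: "trap \<subseteq> basin"
proof
  fix p assume p: "p \<in> trap"
  then have "p \<in> phase_space" by (simp add: trap_def)
  then obtain a b x where "flow_line a b x" "x 0 = p" by (rule flow_line_exists)
  moreover have "0 \<in> einterval a b" using \<open>flow_line a b x\<close> unfolding flow_line_def by blast
  ultimately show "p \<in> basin" unfolding basin_def using p by blast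
qed

theorem homographic_triple_collisions_eq:
  assumes ne: "(\<mu> - 1) powr (4 / 15) * (4 * A1 / A) powr (2 / 3) \<noteq> (16 * B1 / B) powr (2 / 5)"
  shows "homographic_triple_collisions M m A A1 B B1 C h = energy_level H h \<inter> basin"
proof (intro equalityI subsetI)
  fix x0 assume "x0 \<in> homographic_triple_collisions M m A A1 B B1 C h"
  then obtain a b x \<l> where E: "x0 \<in> energy_level H h" and max: "maximal_solution H a b x"
    and z: "0 \<in> einterval a b" and x0: "x 0 = x0" and col: "triple_collision b x"
    and lim: "limiting_configuration b x \<l>" and hc: "homographic_configuration M m A A1 B B1 C \<l>"
    unfolding homographic_triple_collisions_def by blast
  have "\<l> = 0" by (rule homographic_configuration_planar[OF hc ne])
  have sol: "solution H a b x" using max by (simp add: maximal_solution_def)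
  obtain t where t: "t \<in> einterval a b" "0 \<le> t" "x t \<in> trap"
    using planar_collision_enters_trap[OF sol z col] lim \<open>\<l> = 0\<close> by blast
  have "x0 \<in> phase_space" using E by (simp add: energy_level_def)
  then obtain a' b' y where y: "flow_line a' b' y" "y 0 = x0" by (rule flow_line_exists)
  then have "a' \<le> a" "b \<le> b'" "x t = y t"
    using sol z x0 t(1) unfolding flow_line_def by metis+
  moreover from this have "t \<in> einterval a' b'"
    using t(1) by (auto simp: einterval_def intro: le_less_trans less_le_trans simp del: less_ereal.simps)
  ultimately have "x0 \<in> basin" unfolding basin_def using y t by auto
  then show "x0 \<in> energy_level H h \<inter> basin" using E by blast
next
  fix x0 assume "x0 \<in> energy_level H h \<inter> basin"
  then obtain a b x t where E: "x0 \<in> energy_level H h" and fl: "flow_line a b x" and x0: "x 0 = x0"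
    and t: "t \<in> einterval a b" "x t \<in> trap" unfolding basin_def by blast
  have "maximal_solution H a b x" "0 \<in> einterval a b" using fl unfolding flow_line_def by blast+
  then show "x0 \<in> homographic_triple_collisions M m A A1 B B1 C h"
    unfolding homographic_triple_collisions_def
    using E x0 trap_imp_planar_triple_collision[OF fl t] planar_homographic_configuration by blast
qed

end


section \<open>Positive measure on every energy level\<close>

context isosceles
begin

text \<open>The value of \<open>P\<^sub>R\<^sup>2\<close> that energy \<open>h\<close> prescribes at \<open>(R, z, P\<^sub>z)\<close>.\<close>

definition radial_momentum_sq :: "real \<Rightarrow> real \<Rightarrow> real \<Rightarrow> real \<Rightarrow> real" where
  "radial_momentum_sq h R z Pz = M * (h + A / R + B / R ^ 3 + 4 * A1 / sqrt (R\<^sup>2 + 4 * z\<^sup>2)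
     + 16 * B1 / sqrt (R\<^sup>2 + 4 * z\<^sup>2) ^ 3 - \<mu> / (4 * M) * Pz\<^sup>2) - C\<^sup>2 / R\<^sup>2"

definition infall_graph :: "real \<Rightarrow> real \<times> real \<times> real \<Rightarrow> state" where
  "infall_graph h q = (case q of (R, z, Pz) \<Rightarrow> (R, z, - sqrt (radial_momentum_sq h R z Pz), Pz))"

lemma infall_graph_energy:
  assumes "R > 0" "radial_momentum_sq h R z Pz \<ge> 0"
  shows "infall_graph h (R, z, Pz) \<in> energy_level H h"
proof -
  have "H (infall_graph h (R, z, Pz)) = h"
    unfolding infall_graph_def prod.case H_red_sqrt using assms pos(1)
    by (simp add: radial_momentum_sq_def field_simps)
  then show ?thesis using assms(1) by (simp add: energy_level_def phase_space_def infall_graph_def)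
qed

lemma continuous_on_infall_graph:
  "continuous_on {q. fst q > 0} (infall_graph h)"
  "continuous_on {q. fst q > 0} (\<lambda>q. radial_momentum_sq h (fst q) (fst (snd q)) (snd (snd q)))"
proof -
  have nz: "(fst q)\<^sup>2 + 4 * (fst (snd q))\<^sup>2 \<noteq> 0" if "fst q > 0" for q :: "real \<times> real \<times> real"
    using that by (simp add: add_nonneg_eq_0_iff)
  show k: "continuous_on {q. fst q > 0} (\<lambda>q. radial_momentum_sq h (fst q) (fst (snd q)) (snd (snd q)))"
    unfolding radial_momentum_sq_def using nz by (intro continuous_intros) auto
  show "continuous_on {q. fst q > 0} (infall_graph h)"
    unfolding infall_graph_def[abs_def] case_prod_unfold by (intro continuous_intros k)
qed

end

context collision_trap
begin

text \<open>
  For planar states without vertical momentum the energy equation fixes \<open>V\<^sup>2 R\<^sup>3\<close>, which tends to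
  \<open>4 (B + 16 B1) / M\<close> as \<open>R \<rightarrow> 0\<close> whatever \<open>h\<close> and \<open>C\<close> are; this lies strictly between the bounds
  of the trap.
\<close>

lemma energy_level_meets_trap:
  obtains R where "R > 0" "radial_momentum_sq h R 0 0 > 0" "infall_graph h (R, 0, 0) \<in> trap"
proof -
  define F where "F = (\<lambda>R. 4 / M * (h * R ^ 3 + (A + 4 * A1) * R\<^sup>2 + B + 16 * B1) - 4 * C\<^sup>2 / M\<^sup>2 * R)"
  have "(F \<longlongrightarrow> 4 / M * (h * 0 ^ 3 + (A + 4 * A1) * 0\<^sup>2 + B + 16 * B1) - 4 * C\<^sup>2 / M\<^sup>2 * 0) (at_right 0)"
    unfolding F_def by (intro tendsto_intros)
  then have F: "(F \<longlongrightarrow> 4 / M * (B + 16 * B1)) (at_right 0)" by simp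
  have bounds: "pull_min / 2 < 4 / M * (B + 16 * B1)" "4 / M * (B + 16 * B1) < pull_max"
  proof -
    have "3 * B / 2 < 4 * (B + 16 * B1)" using pos by simp
    from mult_strict_left_mono[OF this, of "1 / M"] pos(1)
    show "pull_min / 2 < 4 / M * (B + 16 * B1)" by (simp add: pull_min_def)
    have "2 * (B + 16 * B1) < A + 3 * B + 4 * A1 + 48 * B1" using pos by simp
    from mult_strict_left_mono[OF this, of "2 / M"] pos(1)
    show "4 / M * (B + 16 * B1) < pull_max" by (simp add: pull_max_def)
  qed
  have "\<forall>\<^sub>F R in at_right 0. pull_min / 2 < F R" "\<forall>\<^sub>F R in at_right 0. F R < pull_max"
    by (rule order_tendstoD(1)[OF F bounds(1)], rule order_tendstoD(2)[OF F bounds(2)])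
  moreover have "\<forall>\<^sub>F R in at_right 0. 0 < R \<and> R < r0"
    using eventually_at_right_real[OF small(1)] by eventually_elim simp
  ultimately have "\<forall>\<^sub>F R in at_right 0. pull_min / 2 < F R \<and> F R < pull_max \<and> 0 < R \<and> R < r0"
    by eventually_elim simp
  then obtain R where R: "pull_min / 2 < F R" "F R < pull_max" "0 < R" "R < r0"
    using eventually_happens[of _ "at_right (0::real)"] by auto
  have FR: "(2 / M)\<^sup>2 * radial_momentum_sq h R 0 0 * R ^ 3 = F R"
    using R(3) pos(1) by (simp add: radial_momentum_sq_def F_def field_simps) (simp add: numeral_eq_Suc algebra_simps)
  have "0 < F R" using R(1) pull_min_pos by simp
  then have kin: "radial_momentum_sq h R 0 0 > 0"
    unfolding FR[symmetric] using R(3) pos(1) by (simp add: zero_less_mult_iff)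
  define p where "p = infall_graph h (R, 0, 0)"
  have obs: "pos_R p = R" "velR p = - (2 / M * sqrt (radial_momentum_sq h R 0 0))" "shape p = 0" "areal_rate p = 0"
    by (simp_all add: p_def infall_graph_def velR_def shape_def areal_rate_def velz_def)
  have "(velR p)\<^sup>2 * R ^ 3 = F R"
    unfolding obs FR[symmetric] using kin by (simp add: power_mult_distrib power_divide)
  moreover have "velR p < 0" using obs(2) kin pos(1) by simp
  moreover have "lyap stiff0 \<eta> 0 0 < stiff0 * \<epsilon>\<^sup>2 / 4"
    using stiff0_pos small(2) by (simp add: lyap_def)
  ultimately have "trapped (pos_R p) (velR p) (shape p) (areal_rate p)"
    unfolding trapped_def using R small(2) by (simp add: obs)
  moreover have "p \<in> phase_space" using R(3) by (simp add: p_def infall_graph_def phase_space_def)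
  ultimately have "p \<in> trap" by (simp add: trap_def)
  then show thesis using that R(3) kin unfolding p_def by blast
qed

lemma energy_level_basin_projects_onto_box:
  obtains a b :: "real \<times> real \<times> real" where "emeasure lborel (box a b) > 0"
    "box a b \<subseteq> (\<lambda>x. (fst x, fst (snd x), snd (snd (snd x)))) ` (energy_level H h \<inter> basin)"
proof -
  obtain R where R: "R > 0" "radial_momentum_sq h R 0 0 > 0" "infall_graph h (R, 0, 0) \<in> trap"
    by (rule energy_level_meets_trap)
  let ?S = "{q :: real \<times> real \<times> real. fst q > 0}"
  let ?k = "\<lambda>q. radial_momentum_sq h (fst q) (fst (snd q)) (snd (snd q))"
  have S: "open ?S" by (intro open_Collect_less continuous_intros)
  have "open ((?S \<inter> infall_graph h -` basin) \<inter> (?S \<inter> ?k -` {0<..}))"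
    by (intro open_Int continuous_open_preimage continuous_on_infall_graph S open_basin open_greaterThan)
  moreover have "(R, 0, 0) \<in> (?S \<inter> infall_graph h -` basin) \<inter> (?S \<inter> ?k -` {0<..})"
    using R trap_subset_basin by auto
  ultimately obtain e where e: "e > 0"
    "ball (R, 0, 0) e \<subseteq> (?S \<inter> infall_graph h -` basin) \<inter> (?S \<inter> ?k -` {0<..})"
    using openE by blast
  obtain a b :: "real \<times> real \<times> real" where ab: "(R, 0, 0) \<in> box a b" "box a b \<subseteq> ball (R, 0, 0) e"
    using rational_boxes[OF e(1), of "(R, 0, 0)"] by blast
  have "box a b \<subseteq> (\<lambda>x. (fst x, fst (snd x), snd (snd (snd x)))) ` (energy_level H h \<inter> basin)"
  proof
    fix q assume "q \<in> box a b"
    then have q: "fst q > 0" "infall_graph h q \<in> basin" "?k q > 0" using ab(2) e(2) by auto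
    have "infall_graph h q \<in> energy_level H h"
      using infall_graph_energy[of "fst q" h "fst (snd q)" "snd (snd q)"] q by simp
    moreover have "q = (\<lambda>x. (fst x, fst (snd x), snd (snd (snd x)))) (infall_graph h q)"
      by (simp add: infall_graph_def case_prod_unfold)
    ultimately show "q \<in> (\<lambda>x. (fst x, fst (snd x), snd (snd (snd x)))) ` (energy_level H h \<inter> basin)"
      using q(2) by blast
  qed
  moreover have "emeasure lborel (box a b) > 0"
  proof -
    have "\<And>i. i \<in> Basis \<Longrightarrow> a \<bullet> i < b \<bullet> i" using ab(1) by (auto simp: mem_box intro: less_trans)
    then show ?thesis
      by (subst emeasure_lborel_box) (auto intro!: prod_pos simp: less_imp_le inner_diff_left)
  qed
  ultimately show thesis using that by blast
qed

theorem energy_level_basin_positive: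
  "energy_level H h \<inter> basin \<in> sets (level_measure H h)"
  "emeasure (level_measure H h) (energy_level H h \<inter> basin) > 0"
proof -
  let ?M = "hausdorff_measure 3 :: state measure"
  have E: "energy_level H h \<in> sets ?M" and Bs: "basin \<in> sets ?M"
    using energy_level_borel open_basin by (auto intro!: borel_sets_hausdorff_measure)
  show meas: "energy_level H h \<inter> basin \<in> sets (level_measure H h)"
    unfolding level_measure_def sets_restrict_space using Bs by blast
  have "emeasure (level_measure H h) (energy_level H h \<inter> basin) = emeasure ?M (energy_level H h \<inter> basin)"
    unfolding level_measure_def
    by (rule emeasure_restrict_space) (use E in \<open>auto simp: space_hausdorff_measure\<close>)
  also have "\<dots> = hausdorff_outer 3 (energy_level H h \<inter> basin)"
    using E Bs by (intro emeasure_hausdorff_measure) auto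
  also have "\<dots> > 0"
  proof -
    obtain a b :: "real \<times> real \<times> real" where box: "emeasure lborel (box a b) > 0"
      "box a b \<subseteq> (\<lambda>x. (fst x, fst (snd x), snd (snd (snd x)))) ` (energy_level H h \<inter> basin)"
      by (rule energy_level_basin_projects_onto_box)
    have "1-lipschitz_on UNIV (\<lambda>x :: state. (fst x, fst (snd x), snd (snd (snd x))))"
      by (rule lipschitz_onI) (auto simp: dist_prod_def intro!: real_sqrt_le_mono)
    moreover have "DIM(real \<times> real \<times> real) = 3" by simp
    ultimately
    have "emeasure lborel (box a b) \<le> 2 ^ 3 * hausdorff_outer 3 (energy_level H h \<inter> basin)"
      using hausdorff_outer_ge_lebesgue_projection[OF _ box(2)] by metis
    with box(1) show ?thesis by (auto simp: zero_less_iff_neq_zero)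
  qed
  finally show "emeasure (level_measure H h) (energy_level H h \<inter> basin) > 0" .
qed

end

theorem proposition5:
  fixes M m A A1 B B1 C h \<mu> :: real
  assumes "M > 0" "m > 0" "A > 0" "A1 > 0" "B > 0" "B1 > 0"
    and "\<mu> = (2 * M + m) / m"
    and "\<mu> > 1 + A / (4 * A1)"
    and "\<mu> > 1 + B / (16 * B1)"
    and "(\<mu> - 1) powr (4 / 15) * (4 * A1 / A) powr (2 / 3) \<noteq> (16 * B1 / B) powr (2 / 5)"
  shows "homographic_triple_collisions M m A A1 B B1 C h
           \<in> sets (level_measure (H_red M m A A1 B B1 C) h)
       \<and> emeasure (level_measure (H_red M m A A1 B B1 C) h)
           (homographic_triple_collisions M m A A1 B B1 C h) > 0"
proof -
  interpret isosceles M m A A1 B B1 C \<mu>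
    using assms(1-7) by unfold_locales
  obtain r0 \<epsilon> \<eta> \<kappa> where "collision_trap M m A A1 B B1 C \<mu> r0 \<epsilon> \<eta> \<kappa>"
    using collision_trap_exists[OF assms(9)] by blast
  then interpret collision_trap M m A A1 B B1 C \<mu> r0 \<epsilon> \<eta> \<kappa> .
  show ?thesis
    unfolding homographic_triple_collisions_eq[OF assms(10)]
    using energy_level_basin_positive by blast
qed


end
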